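(* Let $\epsilon\in(0,1)$, $\Delta\in(0,1)$ and consider a single buyer with unknown value distribution $D$, accessed through targeted samples with parameter $\Delta$. With high probability, an auction $M$ with $\mathrm{Rev}(M,D)\ge(1-\epsilon)\mathrm{OPT}(D)$ can be learned using $\tilde O(\max\{1,\min\{\Delta^2\epsilon^{-4},\Delta\epsilon^{-3}\}\})$ targeted samples if $D$ is regular, $\tilde O(\max\{1,\Delta^2\epsilon^{-2}\})$ targeted samples if $D$ is MHR, and $\tilde O(\max\{H^{1/2}\epsilon^{-1},\Delta H\epsilon^{-2}\})$ targeted samples if $D$ is $[1,H]$-bounded; and an auction with $\mathrm{Rev}(M,D)\ge\mathrm{OPT}(D)-\epsilon$ can be learned using $\tilde O(\max\{\epsilon^{-1},\Delta\epsilon^{-2}\})$ targeted samples if $D$ is $[0,1]$-bounded.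
   Context: Single buyer with value $v\sim D$ on $[0,\infty)$; $\mathrm{OPT}(D)$ is the maximum expected revenue over DSIC, IR mechanisms (best posted price). Quantile $q^D(v)=\Pr_{x\sim D}[x\ge v]$; value at quantile $v^D(q)=\sup\{v\ge0:q^D(v)\ge q\}$. A targeted sample with parameter $\Delta$ is a request $[a,b]\subseteq[0,1]$ with $b-a\ge\Delta$, answered by $v^D(u)$ with $u$ uniform on $[a,b]$ independently. Families: regular, MHR, $[1,H]$-bounded, $[0,1]$-bounded as usual. $\tilde O$ hides polylogarithmic factors in $1/\epsilon$, $H$ and the inverse failure probability. *)

theory Defs
  imports "HOL-Probability.Probability"
begin

definition value_dist :: "real measure \<Rightarrow> bool" where
  "value_dist D \<longleftrightarrow> prob_space D \<and> sets D = sets borel \<and> measure D {0..} = 1"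

definition quant :: "real measure \<Rightarrow> real \<Rightarrow> real" where
  "quant D v = measure D {x. v \<le> x}"

definition val_at :: "real measure \<Rightarrow> real \<Rightarrow> real" where
  "val_at D q = Sup {v. 0 \<le> v \<and> q \<le> quant D v}"

definition rev :: "real measure \<Rightarrow> real \<Rightarrow> real" where
  "rev D p = p * quant D p"

text \<open>Optimal revenue over DSIC, IR mechanisms = revenue of the best posted price.\<close>
definition OPT :: "real measure \<Rightarrow> real" where
  "OPT D = Sup (rev D ` {0..})"

definition regular_dist :: "real measure \<Rightarrow> bool" where
  "regular_dist D \<longleftrightarrow> value_dist D \<and>
     (\<exists>f S. is_interval S \<and> S \<subseteq> {0..} \<and> f \<in> borel_measurable borel \<and>
        (\<forall>x\<in>S. 0 < f x) \<and> (\<forall>x. x \<notin> S \<longrightarrow> f x = 0) \<and>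
        D = density lborel (\<lambda>x. ennreal (f x)) \<and>
        mono_on S (\<lambda>v. v - measure D {v<..} / f v))"

definition mhr_dist :: "real measure \<Rightarrow> bool" where
  "mhr_dist D \<longleftrightarrow> value_dist D \<and>
     (\<exists>f S. is_interval S \<and> S \<subseteq> {0..} \<and> f \<in> borel_measurable borel \<and>
        (\<forall>x\<in>S. 0 < f x) \<and> (\<forall>x. x \<notin> S \<longrightarrow> f x = 0) \<and>
        D = density lborel (\<lambda>x. ennreal (f x)) \<and>
        mono_on {v\<in>S. 0 < measure D {v<..}} (\<lambda>v. f v / measure D {v<..}))"

definition bounded_dist :: "real \<Rightarrow> real \<Rightarrow> real measure \<Rightarrow> bool" where
  "bounded_dist lo hi D \<longleftrightarrow> value_dist D \<and> measure D {lo..hi} = 1"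

text \<open>A (possibly randomised, adaptive) learner using N targeted samples is given by
  a query rule Q and an output rule P. Both get a random seed s (uniform on [0,1]) and
  the history of answers so far. Q returns the interval [a,b] requested next; P returns
  the posted price after all N samples.
  The randomness: omega 0 is the seed, omega i (1 \<le> i \<le> N) are i.i.d. uniform on [0,1];
  the i-th answer is v^D(a + (b-a) * omega i), i.e. v^D(u) with u uniform on [a,b].\<close>

definition sample_space :: "nat \<Rightarrow> (nat \<Rightarrow> real) measure" where
  "sample_space N = Pi\<^sub>M {..N} (\<lambda>_. uniform_measure lborel {0..1::real})"

primrec hist :: "real measure \<Rightarrow> (real \<Rightarrow> real list \<Rightarrow> real \<times> real) \<Rightarrow> (nat \<Rightarrow> real)
                   \<Rightarrow> nat \<Rightarrow> real list" where
  "hist D Q \<omega> 0 = []"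
| "hist D Q \<omega> (Suc i) = hist D Q \<omega> i @
     [val_at D (fst (Q (\<omega> 0) (hist D Q \<omega> i))
        + (snd (Q (\<omega> 0) (hist D Q \<omega> i)) - fst (Q (\<omega> 0) (hist D Q \<omega> i))) * \<omega> (Suc i))]"

definition valid_queries :: "real \<Rightarrow> (real \<Rightarrow> real list \<Rightarrow> real \<times> real) \<Rightarrow> bool" where
  "valid_queries \<Delta> Q \<longleftrightarrow> (\<forall>s h. 0 \<le> fst (Q s h) \<and> fst (Q s h) + \<Delta> \<le> snd (Q s h)
                                 \<and> snd (Q s h) \<le> 1)"

definition success_prob :: "real measure \<Rightarrow> nat \<Rightarrow> (real \<Rightarrow> real list \<Rightarrow> real \<times> real)
     \<Rightarrow> (real \<Rightarrow> real list \<Rightarrow> real) \<Rightarrow> (real \<Rightarrow> bool) \<Rightarrow> real" where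
  "success_prob D N Q P Goal =
     measure (sample_space N) {\<omega> \<in> space (sample_space N). Goal (P (\<omega> 0) (hist D Q \<omega> N))}"

definition learns :: "real \<Rightarrow> nat \<Rightarrow> (real \<Rightarrow> real list \<Rightarrow> real \<times> real)
     \<Rightarrow> (real \<Rightarrow> real list \<Rightarrow> real) \<Rightarrow> (real measure \<Rightarrow> bool)
     \<Rightarrow> (real measure \<Rightarrow> real \<Rightarrow> bool) \<Rightarrow> real \<Rightarrow> bool" where
  "learns \<Delta> N Q P Class Goal \<delta> \<longleftrightarrow> valid_queries \<Delta> Q \<and>
     (\<forall>D. Class D \<longrightarrow> success_prob D N Q P (Goal D) \<ge> 1 - \<delta>)"

definition mult_goal :: "real \<Rightarrow> real measure \<Rightarrow> real \<Rightarrow> bool" where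
  "mult_goal \<epsilon> D p \<longleftrightarrow> rev D p \<ge> (1 - \<epsilon>) * OPT D"

definition add_goal :: "real \<Rightarrow> real measure \<Rightarrow> real \<Rightarrow> bool" where
  "add_goal \<epsilon> D p \<longleftrightarrow> rev D p \<ge> OPT D - \<epsilon>"

end

theory Submission
  imports Defs
begin

text \<open>A value known to lie between the values at two quantiles \<open>lo < hi\<close> guarantees a revenue computable
  from \<open>lo\<close>, so it suffices to obtain such brackets with \<open>hi - lo\<close> small and to post the price with the
  best guarantee. For \<open>\<Delta> \<le> 1/2\<close> a bracket costs about \<open>\<Delta> / (hi - lo)\<close> samples: request an interval
  having \<open>lo\<close> (or \<open>hi\<close>) as an endpoint and keep the extreme answer. For \<open>\<Delta> > 1/2\<close> the whole of \<open>[0,1]\<close>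
  is sampled and Chernoff's bound locates order statistics to accuracy \<open>hi - lo\<close> with about
  \<open>hi / (hi - lo)\<^sup>2\<close> samples shared by all brackets. For bounded values, and for all families when
  \<open>\<Delta> > 1/2\<close>, the brackets form a fixed grid. For regular and MHR values with \<open>\<Delta> \<le> 1/2\<close> the revenue curve
  is concave in the quantile and a noisy ternary search needs only logarithmically many brackets.
  The good event of the search speaks about the normalised uniforms only, not about the adaptively
  chosen intervals, so no conditioning on the history is needed.\<close>

subsection \<open>Quantiles and revenue\<close>

text \<open>The threshold 1/2 is where a request of length \<open>\<Delta>\<close> can always be
  placed in \<open>[0,1]\<close> with its end at \<open>lo\<close> or at \<open>hi\<close>. Beyond
  it \<open>\<Delta>\<close> is a constant, and the claimed rates have the order of plain sampling.
  A bracket of relative width \<open>\<eta>\<close> above a quantile floor \<open>q0\<close> has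
  absolute width at least \<open>\<eta> * q0\<close> and costs about
  \<open>1 + \<Delta> / (\<eta> * q0)\<close> samples. So for small \<open>\<Delta>\<close> the
  search costs about \<open>1 + a\<close>, where \<open>a\<close> is
  \<open>\<Delta> / \<epsilon>\<^sup>2\<close> for regular values (\<open>q0\<close> of order
  \<open>\<epsilon>\<close>) and \<open>\<Delta> / \<epsilon>\<close> for MHR values
  (\<open>q0 = 1/4\<close>). As \<open>a \<le> max 1 (a * a)\<close>, this fits the claim; a fixed
  grid would add a factor of about \<open>1 / \<epsilon>\<close>. The obstacle in the search is that
  it compares guarantees, not revenues, and a guarantee knows its quantile only up to the factor
  \<open>1 - \<eta>\<close>, so comparisons may go wrong and thirds of a short window cannot be told
  apart. The analysis therefore follows one competing price and shows that whenever its quantile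
  leaves the window, some probe was already nearly as good.\<close>

lemma value_distD:
  assumes "value_dist D"
  shows "prob_space D" "sets D = sets borel" "space D = UNIV" "measure D {0..} = 1"
  using assms sets_eq_imp_space_eq[of D borel] by (auto simp: value_dist_def)

lemma quant_antimono:
  assumes "value_dist D" "v \<le> w" shows "quant D w \<le> quant D v"
proof -
  interpret prob_space D using value_distD[OF assms(1)] by simp
  show ?thesis unfolding quant_def
    using assms by (intro finite_measure_mono) (auto simp: value_distD)
qed

lemma quant_nonneg [simp]: "0 \<le> quant D v"
  by (simp add: quant_def)

lemma quant_le_1:
  assumes "value_dist D" shows "quant D v \<le> 1"
proof -
  interpret prob_space D using value_distD[OF assms(1)] by simp
  show ?thesis by (simp add: quant_def)
qed

lemma quant_eq_1:
  assumes "value_dist D" "v \<le> 0" shows "quant D v = 1"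
proof -
  have "quant D 0 = 1" using value_distD(4)[OF assms(1)] by (simp add: quant_def atLeast_def)
  then show ?thesis using quant_antimono[OF assms] quant_le_1[OF assms(1), of v] by linarith
qed

text \<open>Continuity from above along the half-lines \<open>{n..}\<close>, whose intersection is
  empty. It bounds the set under the supremum in \<open>val_at\<close>, so that this supremum is
  genuine for positive levels.\<close>

lemma quant_below:
  assumes "value_dist D" "0 < u" shows "\<exists>v\<ge>0. quant D v < u"
proof -
  interpret prob_space D using value_distD[OF assms(1)] by simp
  have "(\<lambda>n. measure D {real n..}) \<longlonglongrightarrow> measure D (\<Inter>n. {real n..})"
    by (rule finite_Lim_measure_decseq) (auto simp: value_distD[OF assms(1)] decseq_def)
  moreover have "(\<Inter>n. {real n..}) = {}"
  proof -
    have "\<not> (\<forall>n. real n \<le> x)" for x using reals_Archimedean2[of x] by (auto simp: not_le)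
    then show ?thesis by auto
  qed
  ultimately have "(\<lambda>n. measure D {real n..}) \<longlonglongrightarrow> 0" by simp
  then have "eventually (\<lambda>n. measure D {real n..} < u) sequentially"
    using assms(2) by (rule order_tendstoD)
  then obtain n where "measure D {real n..} < u" by (auto simp: eventually_sequentially)
  then show ?thesis by (intro exI[of _ "real n"]) (auto simp: quant_def atLeast_def)
qed

lemma quant_levels_bdd:
  assumes "value_dist D" "0 < u" shows "bdd_above {v. 0 \<le> v \<and> u \<le> quant D v}"
proof -
  obtain w where w: "quant D w < u" using quant_below[OF assms] by auto
  have "v \<le> w" if "u \<le> quant D v" for v
    using that w quant_antimono[OF assms(1), of w v] by linarith
  then show ?thesis by (auto simp: bdd_above_def)
qed

lemma le_val_at:
  assumes "value_dist D" "0 < u" "0 \<le> v" "u \<le> quant D v" shows "v \<le> val_at D u"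
  unfolding val_at_def using assms quant_levels_bdd[OF assms(1,2)] by (intro cSup_upper) auto

text \<open>The tail over closed half-lines is left-continuous, so the supremum is attained. With
  \<open>le_val_at\<close> this makes the two functions adjoint: for \<open>0 \<le> v\<close> and
  \<open>0 < u \<le> 1\<close>, \<open>v \<le> val_at D u\<close> holds exactly when
  \<open>u \<le> quant D v\<close>. At an atom the inequality can be strict.\<close>

lemma quant_val_at:
  assumes "value_dist D" "0 < u" "u \<le> 1" shows "u \<le> quant D (val_at D u)"
proof -
  interpret prob_space D using value_distD[OF assms(1)] by simp
  let ?A = "{v. 0 \<le> v \<and> u \<le> quant D v}"
  let ?s = "val_at D u"
  have ne: "0 \<in> ?A" using quant_eq_1[OF assms(1), of 0] assms by simp
  have *: "u \<le> quant D (?s - 1 / real (Suc n))" for n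
  proof -
    have "?s - 1 / real (Suc n) < Sup ?A"
      unfolding val_at_def by (simp del: of_nat_Suc)
    then obtain v where v: "v \<in> ?A" "?s - 1 / real (Suc n) < v"
      using ne less_cSup_iff[OF _ quant_levels_bdd[OF assms(1,2)]] by blast
    have "quant D v \<le> quant D (?s - 1 / real (Suc n))"
      using v(2) by (intro quant_antimono[OF assms(1)]) linarith
    then show ?thesis using v(1) by simp
  qed
  have "(\<lambda>n. measure D {?s - 1 / real (Suc n)..}) \<longlonglongrightarrow> measure D (\<Inter>n. {?s - 1 / real (Suc n)..})"
  proof (rule finite_Lim_measure_decseq)
    show "range (\<lambda>n. {?s - 1 / real (Suc n)..}) \<subseteq> events"
      by (auto simp: value_distD[OF assms(1)])
    show "decseq (\<lambda>n. {?s - 1 / real (Suc n)..})"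
    proof (rule decseq_SucI)
      fix n
      have "1 / real (Suc (Suc n)) \<le> 1 / real (Suc n)" by (simp add: frac_le)
      then show "{?s - 1 / real (Suc (Suc n))..} \<subseteq> {?s - 1 / real (Suc n)..}" by auto
    qed
  qed
  moreover have "(\<Inter>n. {?s - 1 / real (Suc n)..}) = {?s..}"
  proof (intro equalityI subsetI)
    fix x assume x: "x \<in> (\<Inter>n. {?s - 1 / real (Suc n)..})"
    show "x \<in> {?s..}"
    proof (rule ccontr)
      assume "x \<notin> {?s..}"
      then obtain n where "1 / real (Suc n) < ?s - x"
        using reals_Archimedean[of "?s - x"] by (auto simp: inverse_eq_divide)
      moreover have "?s - 1 / real (Suc n) \<le> x" using x by auto
      ultimately show False by linarith
    qed
  next
    fix x assume x: "x \<in> {?s..}"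
    have "?s - 1 / real (Suc n) \<le> x" for n
    proof -
      have "0 \<le> 1 / real (Suc n)" by simp
      moreover have "?s \<le> x" using x by simp
      ultimately show ?thesis by linarith
    qed
    then show "x \<in> (\<Inter>n. {?s - 1 / real (Suc n)..})" by auto
  qed
  ultimately have "(\<lambda>n. measure D {?s - 1 / real (Suc n)..}) \<longlonglongrightarrow> measure D {?s..}" by simp
  then have "u \<le> measure D {?s..}"
    by (rule LIMSEQ_le_const) (use * in \<open>auto simp: quant_def atLeast_def\<close>)
  then show ?thesis by (simp add: quant_def atLeast_def)
qed

lemma val_at_nonneg:
  assumes "value_dist D" "0 < u" "u \<le> 1" shows "0 \<le> val_at D u"
  using le_val_at[OF assms(1,2), of 0] quant_eq_1[OF assms(1), of 0] assms(3) by simp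

lemma val_at_antimono:
  assumes "value_dist D" "0 < u" "u \<le> u'" "u' \<le> 1" shows "val_at D u' \<le> val_at D u"
  using assms quant_val_at[OF assms(1), of u'] val_at_nonneg[OF assms(1), of u']
  by (intro le_val_at[OF assms(1,2)]) linarith+

text \<open>At arguments outside \<open>(0,1]\<close> the supremum defining \<^const>\<open>val_at\<close> is a constant junk value, so
  only piecewise monotonicity is available.\<close>
lemma val_at_measurable [measurable]:
  assumes "value_dist D" shows "val_at D \<in> borel_measurable borel"
proof -
  have "(\<lambda>u. - val_at D u) \<in> borel_measurable borel"
  proof (rule borel_measurable_piecewise_mono[of "{{..0}, {0<..1}, {1<..}}"])
    fix c :: "real set" assume c: "c \<in> {{..0}, {0<..1}, {1<..}}"
    show "mono_on c (\<lambda>u. - val_at D u)"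
    proof (rule mono_onI)
      fix r s :: real assume rs: "r \<in> c" "s \<in> c" "r \<le> s"
      consider "s \<le> 0" | "0 < r" "s \<le> 1" | "1 < r" using c rs by auto
      then show "- val_at D r \<le> - val_at D s"
      proof cases
        case 1
        then have "r \<le> quant D v" "s \<le> quant D v" for v
          using rs(3) quant_nonneg[of D v] by linarith+
        then show ?thesis by (simp add: val_at_def)
      next
        case 2 then show ?thesis using val_at_antimono[OF assms] rs by auto
      next
        case 3
        then have "\<not> r \<le> quant D v" "\<not> s \<le> quant D v" for v
          using rs(3) quant_le_1[OF assms, of v] by linarith+
        then show ?thesis by (simp add: val_at_def)
      qed
    qed
  next
    show "\<Union>{{..0}, {0<..1}, {1<..}} = (UNIV :: real set)"
      using linear not_le by fastforce
  qed auto
  then have "(\<lambda>u. - (- val_at D u)) \<in> borel_measurable borel" by (rule borel_measurable_uminus)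
  then show ?thesis by simp
qed

lemma rev_measurable [measurable]:
  assumes "value_dist D" shows "rev D \<in> borel_measurable borel"
proof -
  have "(\<lambda>v. - quant D v) \<in> borel_measurable borel"
    by (rule borel_measurable_mono) (use quant_antimono[OF assms] in \<open>auto simp: mono_def\<close>)
  then have [measurable]: "quant D \<in> borel_measurable borel"
    using borel_measurable_uminus[of "\<lambda>v. - quant D v" borel] by simp
  have "(\<lambda>p. p * quant D p) \<in> borel_measurable borel" by measurable
  then show ?thesis by (simp add: rev_def[abs_def])
qed

text \<open>A bound valid for all posted prices also proves that the set of revenues is bounded, so
  finiteness of \<open>OPT\<close> never has to be settled separately.\<close>

lemma OPT_le:
  assumes "\<And>p. 0 \<le> p \<Longrightarrow> rev D p \<le> x" shows "OPT D \<le> x"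
  unfolding OPT_def using assms by (intro cSup_least) auto

lemma mult_goalI:
  assumes "\<epsilon> < 1" "\<And>p. 0 \<le> p \<Longrightarrow> (1 - \<epsilon>) * rev D p \<le> rev D x"
  shows "mult_goal \<epsilon> D x"
proof -
  have "OPT D \<le> rev D x / (1 - \<epsilon>)"
    using assms by (intro OPT_le) (simp add: field_simps)
  then show ?thesis using assms(1) by (simp add: mult_goal_def field_simps)
qed

lemma add_goalI:
  assumes "\<And>p. 0 \<le> p \<Longrightarrow> rev D p \<le> rev D x + \<epsilon>"
  shows "add_goal \<epsilon> D x"
  using OPT_le[OF assms] by (simp add: add_goal_def)

lemma mult_goal_borel:
  assumes "value_dist D" shows "{p. mult_goal \<epsilon> D p} \<in> sets borel"
  using measurable_sets[OF rev_measurable[OF assms], of "{(1 - \<epsilon>) * OPT D..}"]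
  by (simp add: mult_goal_def vimage_def)

lemma add_goal_borel:
  assumes "value_dist D" shows "{p. add_goal \<epsilon> D p} \<in> sets borel"
  using measurable_sets[OF rev_measurable[OF assms], of "{OPT D - \<epsilon>..}"]
  by (simp add: add_goal_def vimage_def)

subsection \<open>Independent uniform samples\<close>

abbreviation "unif \<equiv> uniform_measure lborel {0..1::real}"

lemma prob_space_unif: "prob_space unif"
  by (rule prob_space_uniform_measure) auto

lemma measure_unif:
  assumes "A \<in> sets borel" shows "measure unif A = measure lborel ({0..1} \<inter> A)"
  using assms by (subst measure_uniform_measure) auto

lemma prob_space_sample: "prob_space (sample_space N)"
proof -
  interpret product_prob_space "\<lambda>_::nat. unif" "{..N}"
    by (rule product_prob_spaceI) (rule prob_space_unif)
  show ?thesis unfolding sample_space_def by (rule prob_space_axioms)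
qed

lemma sample_component:
  "i \<le> N \<Longrightarrow> (\<lambda>\<omega>. \<omega> i) \<in> borel_measurable (sample_space N)"
  using measurable_component_singleton[of i "{..N}" "\<lambda>_. unif"]
  by (simp add: sample_space_def cong: measurable_cong_sets)

text \<open>Its main use is the event that a whole block of samples misses an end piece of
  \<open>[0,1]\<close>.\<close>

lemma prob_all_in:
  assumes "J \<subseteq> {..N}" "A \<in> sets borel"
  shows "measure (sample_space N) {\<omega> \<in> space (sample_space N). \<forall>i\<in>J. \<omega> i \<in> A}
           = measure unif A ^ card J"
proof -
  interpret product_prob_space "\<lambda>_::nat. unif" "{..N}"
    by (rule product_prob_spaceI) (rule prob_space_unif)
  have "finite J" using assms(1) finite_subset by blast
  then have "emeasure (sample_space N) {\<omega> \<in> space (sample_space N). \<forall>i\<in>J. \<omega> i \<in> A}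
      = (\<Prod>i\<in>J. emeasure unif A)"
    unfolding sample_space_def using assms by (intro emeasure_PiM_Collect) auto
  also have "\<dots> = ennreal (measure unif A ^ card J)"
    by (simp add: M.emeasure_eq_measure prod_ennreal ennreal_power)
  finally show ?thesis by (simp add: measure_def)
qed

lemma sets_sample_all:
  assumes "J \<subseteq> {..N}" "\<And>i. i \<in> J \<Longrightarrow> A i \<in> sets borel"
  shows "{\<omega> \<in> space (sample_space N). \<forall>i\<in>J. \<omega> i \<in> A i} \<in> sets (sample_space N)"
proof -
  have "{\<omega> \<in> space (sample_space N). \<omega> i \<in> A i} \<in> sets (sample_space N)" if "i \<in> J" for i
  proof -
    have "(\<lambda>\<omega>. \<omega> i) -` A i \<inter> space (sample_space N) \<in> sets (sample_space N)"
      using assms that by (intro measurable_sets[OF sample_component]) auto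
    also have "(\<lambda>\<omega>. \<omega> i) -` A i \<inter> space (sample_space N) = {\<omega> \<in> space (sample_space N). \<omega> i \<in> A i}"
      by auto
    finally show ?thesis .
  qed
  moreover have "finite J" using assms(1) finite_subset by blast
  ultimately show ?thesis by (intro sets.sets_Collect_finite_All) auto
qed

lemma sets_sample_count:
  assumes "J \<subseteq> {..N}" "A \<in> sets borel"
  shows "{\<omega> \<in> space (sample_space N). R (card {i\<in>J. \<omega> i \<in> A})} \<in> sets (sample_space N)"
proof -
  have "{\<omega> \<in> space (sample_space N). i \<in> {i \<in> J. \<omega> i \<in> A}} \<in> sets (sample_space N)" for i
    using sets_sample_all[of "{i}" N "\<lambda>_. A"] assms by (cases "i \<in> J") auto
  then have [measurable]: "(\<lambda>\<omega>. card {i\<in>J. \<omega> i \<in> A}) \<in> measurable (sample_space N) (count_space UNIV)"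
    by (rule measurable_card)
  show ?thesis by measurable
qed

section \<open>Exponential moments and order statistics of uniform samples\<close>

lemma exp_le_quadratic:
  fixes t :: real assumes "\<bar>t\<bar> \<le> 1" shows "exp t \<le> 1 + t + t\<^sup>2"
proof (cases "0 \<le> t")
  case True then show ?thesis using exp_bound[of t] assms by simp
next
  case False
  then have "1 - t \<le> exp (- t)" using exp_ge_add_one_self[of "- t"] by simp
  then have "exp t \<le> 1 / (1 - t)"
    using False by (simp add: exp_minus field_simps)
  also have "\<dots> \<le> 1 + t + t\<^sup>2"
  proof -
    have "(1 + t + t\<^sup>2) * (1 - t) = 1 - t ^ 3" by (simp add: algebra_simps power2_eq_square power3_eq_cube)
    moreover have "t ^ 3 \<le> 0" using False by (simp add: power_le_zero_eq)
    ultimately have "1 \<le> (1 + t + t\<^sup>2) * (1 - t)" by linarith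
    then show ?thesis using False by (subst pos_divide_le_eq) auto
  qed
  finally show ?thesis .
qed

text \<open>Chernoff's bound; the sign of \<open>t\<close> selects the tail.\<close>
lemma count_tail:
  assumes J: "J \<subseteq> {..N}" and A: "A \<in> sets borel" and t: "\<bar>t\<bar> \<le> 1"
  shows "measure (sample_space N)
           {\<omega> \<in> space (sample_space N). t * x \<le> t * real (card {i\<in>J. \<omega> i \<in> A})}
         \<le> exp (- t * x + real (card J) * measure unif A * (t + t\<^sup>2))"
proof -
  interpret product_prob_space "\<lambda>_::nat. unif" "{..N}"
    by (rule product_prob_spaceI) (rule prob_space_unif)
  interpret S: prob_space "sample_space N" by (rule prob_space_sample)
  let ?p = "measure unif A"
  \<comment> \<open>With factor 1 off \<open>J\<close>, the exponential moment of the count over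
    \<open>J\<close> becomes the integral of a product over all coordinates, where the product
    formula applies.\<close>
  define F :: "nat \<Rightarrow> real \<Rightarrow> ennreal"
    where "F i y = (if i \<in> J then ennreal (1 + (exp t - 1) * indicator A y) else 1)" for i y
  have [measurable]: "A \<in> sets borel" by fact
  have fin: "finite J" using J finite_subset by blast
  have FM: "F i \<in> borel_measurable unif" for i
    unfolding F_def by (cases "i \<in> J") simp_all
  have FM': "F i \<in> borel_measurable borel" for i
    unfolding F_def by (cases "i \<in> J") simp_all
  have pos: "0 \<le> 1 + (exp t - 1) * indicator A y" for y :: real
    by (simp add: indicator_def)
  have p0: "0 \<le> 1 + ?p * (exp t - 1)"
  proof -
    have "1 + ?p * (exp t - 1) = (1 - ?p) + ?p * exp t" by (simp add: algebra_simps)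
    moreover have "0 \<le> 1 - ?p" using M.prob_le_1[of A] by (simp del: measure_uniform_measure)
    moreover have "0 \<le> ?p * exp t" by (intro mult_nonneg_nonneg) auto
    ultimately show ?thesis by linarith
  qed
  have int: "integral\<^sup>N unif (F i) = ennreal (1 + ?p * (exp t - 1))" if "i \<in> J" for i
  proof -
    have "integral\<^sup>N unif (F i) = (\<integral>\<^sup>+y. ennreal (exp t) * indicator A y + indicator (- A) y \<partial>unif)"
      using that by (intro nn_integral_cong) (auto simp: F_def indicator_def)
    also have "\<dots> = ennreal (exp t) * emeasure unif A + emeasure unif (- A)"
      by (subst nn_integral_add) (auto simp: nn_integral_cmult_indicator)
    also have "emeasure unif (- A) = ennreal (1 - ?p)"
      using M.prob_compl[of A] by (simp add: M.emeasure_eq_measure Compl_eq_Diff_UNIV)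
    also have "emeasure unif A = ennreal ?p" by (rule M.emeasure_eq_measure)
    finally show ?thesis
      using M.prob_le_1[of A] by (simp add: ennreal_mult[symmetric] ennreal_plus[symmetric] algebra_simps del: ennreal_plus)
  qed
  have prodF: "(\<Prod>i\<in>{..N}. F i (\<omega> i)) = ennreal (exp (t * real (card {i\<in>J. \<omega> i \<in> A})))" for \<omega>
  proof -
    have "(\<Prod>i\<in>{..N}. F i (\<omega> i)) = (\<Prod>i\<in>J. F i (\<omega> i))"
      using J by (intro prod.mono_neutral_right) (auto simp: F_def)
    also have "\<dots> = (\<Prod>i\<in>J. if \<omega> i \<in> A then ennreal (exp t) else 1)"
      by (intro prod.cong) (auto simp: F_def)
    also have "\<dots> = ennreal (exp t) ^ card {i\<in>J. \<omega> i \<in> A}"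
    proof -
      have "{i\<in>J. \<omega> i \<in> A} = J \<inter> {i. \<omega> i \<in> A}" by auto
      then show ?thesis using fin by (simp add: prod.If_cases)
    qed
    also have "\<dots> = ennreal (exp (t * real (card {i\<in>J. \<omega> i \<in> A})))"
      by (simp add: ennreal_power exp_of_nat_mult[symmetric] mult.commute)
    finally show ?thesis .
  qed
  let ?S = "{\<omega> \<in> space (sample_space N). t * x \<le> t * real (card {i\<in>J. \<omega> i \<in> A})}"
  have "emeasure (sample_space N) ?S \<le> (\<integral>\<^sup>+\<omega>. ennreal (exp (- t * x)) * (\<Prod>i\<in>{..N}. F i (\<omega> i)) \<partial>sample_space N)"
  \<comment> \<open>A set outside the sigma-algebra has \<open>emeasure\<close> zero by convention,
    which makes the other case trivial.\<close>
  proof (cases "?S \<in> sets (sample_space N)")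
    case True
    then have "emeasure (sample_space N) ?S = (\<integral>\<^sup>+\<omega>. indicator ?S \<omega> \<partial>sample_space N)" by simp
    also have "\<dots> \<le> (\<integral>\<^sup>+\<omega>. ennreal (exp (- t * x)) * (\<Prod>i\<in>{..N}. F i (\<omega> i)) \<partial>sample_space N)"
    proof (rule nn_integral_mono)
      fix \<omega>
      show "indicator ?S \<omega> \<le> ennreal (exp (- t * x)) * (\<Prod>i\<in>{..N}. F i (\<omega> i))"
      proof (cases "\<omega> \<in> ?S")
        case True
        then have "1 \<le> exp (- t * x + t * real (card {i\<in>J. \<omega> i \<in> A}))" by simp
        then have "ennreal 1 \<le> ennreal (exp (- t * x) * exp (t * real (card {i\<in>J. \<omega> i \<in> A})))"
          unfolding exp_add by (rule ennreal_leI)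
        then show ?thesis using True unfolding prodF by (simp add: ennreal_mult)
      qed simp
    qed
    finally show ?thesis .
  qed (simp add: emeasure_notin_sets)
  also have "\<dots> = ennreal (exp (- t * x)) * (\<integral>\<^sup>+\<omega>. (\<Prod>i\<in>{..N}. F i (\<omega> i)) \<partial>sample_space N)"
  proof (rule nn_integral_cmult)
    show "(\<lambda>\<omega>. \<Prod>i\<in>{..N}. F i (\<omega> i)) \<in> borel_measurable (sample_space N)"
    proof (rule borel_measurable_prod_ennreal)
      fix i assume "i \<in> {..N}"
      then have "(\<lambda>\<omega>. \<omega> i) \<in> borel_measurable (sample_space N)" by (intro sample_component) simp
      then show "(\<lambda>\<omega>. F i (\<omega> i)) \<in> borel_measurable (sample_space N)"
        by (rule measurable_compose) (rule FM')
    qed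
  qed
  also have "(\<integral>\<^sup>+\<omega>. (\<Prod>i\<in>{..N}. F i (\<omega> i)) \<partial>sample_space N) = (\<Prod>i\<in>{..N}. integral\<^sup>N unif (F i))"
    unfolding sample_space_def by (rule product_nn_integral_prod) (auto simp: FM)
  also have "\<dots> = (\<Prod>i\<in>J. integral\<^sup>N unif (F i))"
  proof (rule prod.mono_neutral_right)
    show "\<forall>i\<in>{..N} - J. integral\<^sup>N unif (F i) = 1"
    proof
      fix i assume "i \<in> {..N} - J"
      then have "F i = (\<lambda>_. 1)" by (auto simp: F_def)
      then show "integral\<^sup>N unif (F i) = 1"
        by (simp only: nn_integral_const mult_1 M.emeasure_space_1)
    qed
  qed (use J in auto)
  also have "\<dots> = ennreal ((1 + ?p * (exp t - 1)) ^ card J)"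
    using p0 by (simp add: int ennreal_power)
  also have "ennreal (exp (- t * x)) * ennreal ((1 + ?p * (exp t - 1)) ^ card J)
      \<le> ennreal (exp (- t * x) * exp (?p * (t + t\<^sup>2)) ^ card J)"
  proof -
    have "1 + ?p * (exp t - 1) \<le> exp (?p * (t + t\<^sup>2))"
    proof -
      have "?p * (exp t - 1) \<le> ?p * (t + t\<^sup>2)"
        using exp_le_quadratic[OF t] by (intro mult_left_mono) auto
      then show ?thesis using exp_ge_add_one_self[of "?p * (t + t\<^sup>2)"] by linarith
    qed
    with p0 show ?thesis
      by (subst ennreal_mult[symmetric]) (auto intro!: ennreal_leI mult_left_mono power_mono)
  qed
  also have "exp (- t * x) * exp (?p * (t + t\<^sup>2)) ^ card J
      = exp (- t * x + real (card J) * ?p * (t + t\<^sup>2))"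
    by (simp add: exp_of_nat_mult[symmetric] exp_add[symmetric] algebra_simps)
  finally show ?thesis
    unfolding S.emeasure_eq_measure by simp
qed

lemma measure_unif_Iio: "0 \<le> x \<Longrightarrow> x \<le> 1 \<Longrightarrow> measure unif {..<x} = x"
proof -
  assume x: "0 \<le> x" "x \<le> 1"
  then have "{0..1} \<inter> {..<x} = {0..<x}" by auto
  then show ?thesis using x by (simp add: measure_unif)
qed

lemma measure_unif_Iic: "0 \<le> x \<Longrightarrow> x \<le> 1 \<Longrightarrow> measure unif {..x} = x"
proof -
  assume x: "0 \<le> x" "x \<le> 1"
  then have "{0..1} \<inter> {..x} = {0..x}" by auto
  then show ?thesis using x by (simp add: measure_unif)
qed

lemma measure_unif_Ioi: "0 \<le> x \<Longrightarrow> x \<le> 1 \<Longrightarrow> measure unif {x<..} = 1 - x"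
proof -
  assume x: "0 \<le> x" "x \<le> 1"
  then have "{0..1} \<inter> {x<..} = {x<..1}" by auto
  then show ?thesis using x by (simp add: measure_unif)
qed

lemma measure_unif_Ioc01: "measure unif {0<..1} = 1"
proof -
  have "{0..1} \<inter> {0<..1} = {0<..1::real}" by auto
  then show ?thesis by (simp add: measure_unif)
qed

text \<open>Up to rounding, the rank \<open>k\<close> is the midpoint of the expected counts, half a
  gap away from each. Chernoff's bound keeps the variance factor \<open>hi\<close>: for a bracket of
  relative width \<open>\<eta>\<close> the exponent per sample is of order
  \<open>\<eta>\<^sup>2 * hi\<close>, where Hoeffding's bound would give
  \<open>\<eta>\<^sup>2 * hi\<^sup>2\<close>.\<close>

lemma order_statistic_fails:
  fixes lo hi :: real
  assumes J: "J \<subseteq> {..N}" and lohi: "0 \<le> lo" "lo < hi" "hi \<le> 1"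
    and k: "k = nat \<lceil>real (card J) * ((lo + hi) / 2)\<rceil>"
  shows "measure (sample_space N) {\<omega> \<in> space (sample_space N). k \<le> card {i\<in>J. \<omega> i \<in> {..<lo}}}
           \<le> exp (- (real (card J) * (hi - lo)\<^sup>2 / (16 * hi)))"
    and "measure (sample_space N) {\<omega> \<in> space (sample_space N). card {i\<in>J. \<omega> i \<in> {..hi}} < k}
           \<le> exp (- (real (card J) * (hi - lo)\<^sup>2 / (16 * hi)))"
proof -
  interpret S: prob_space "sample_space N" by (rule prob_space_sample)
  define m where "m = real (card J)"
  \<comment> \<open>The minimiser of \<open>hi * t\<^sup>2 - t * (hi - lo) / 2\<close>, the exponent
    per sample of both tails once \<open>lo\<close> is replaced by \<open>hi\<close> in the
    quadratic term of the first.\<close>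
  define t where "t = (hi - lo) / (4 * hi)"
  have t: "0 \<le> t" "t \<le> 1" using lohi by (auto simp: t_def field_simps)
  have hm: "hi * t\<^sup>2 = (hi - lo)\<^sup>2 / (16 * hi)" "t * (hi - lo) / 2 = (hi - lo)\<^sup>2 / (8 * hi)"
    using lohi by (auto simp: t_def field_simps power2_eq_square)
  \<comment> \<open>Rounding up costs nothing on either side: a count of at least \<open>k\<close>
    reaches the midpoint, and an integer below the ceiling does not exceed it.\<close>
  have k1: "m * ((lo + hi) / 2) \<le> real k" "k \<le> n \<or> real n \<le> m * ((lo + hi) / 2)" for n
    unfolding k m_def[symmetric] by linarith+
  have ex: "m * (hi * t\<^sup>2 - t * (hi - lo) / 2) = - (m * (hi - lo)\<^sup>2 / (16 * hi))"
  proof -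
    have "hi * t\<^sup>2 - t * (hi - lo) / 2 = - ((hi - lo)\<^sup>2 / (16 * hi))"
      unfolding hm by simp
    then show ?thesis by simp
  qed
  have "measure (sample_space N) {\<omega> \<in> space (sample_space N). k \<le> card {i\<in>J. \<omega> i \<in> {..<lo}}}
      \<le> measure (sample_space N) {\<omega> \<in> space (sample_space N).
           t * (m * ((lo + hi) / 2)) \<le> t * real (card {i\<in>J. \<omega> i \<in> {..<lo}})}"
  proof (intro S.finite_measure_mono Collect_mono impI conjI; (elim conjE)?)
    fix \<omega> assume "k \<le> card {i\<in>J. \<omega> i \<in> {..<lo}}"
    then have "m * ((lo + hi) / 2) \<le> real (card {i\<in>J. \<omega> i \<in> {..<lo}})"
      using k1(1) by linarith
    then show "t * (m * ((lo + hi) / 2)) \<le> t * real (card {i\<in>J. \<omega> i \<in> {..<lo}})"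
      by (rule mult_left_mono[OF _ t(1)])
  next
    show "{\<omega> \<in> space (sample_space N).
           t * (m * ((lo + hi) / 2)) \<le> t * real (card {i\<in>J. \<omega> i \<in> {..<lo}})} \<in> S.events"
      by (rule sets_sample_count[OF J]) simp
  qed
  also have "\<dots> \<le> exp (- t * (m * ((lo + hi) / 2)) + m * lo * (t + t\<^sup>2))"
    using count_tail[OF J, of "{..<lo}" t "m * ((lo + hi) / 2)"] t
    unfolding measure_unif_Iio[OF lohi(1) less_imp_le[OF less_le_trans[OF lohi(2,3)]]]
    by (simp only: m_def lessThan_borel abs_of_nonneg simp_thms)
  also have "- t * (m * ((lo + hi) / 2)) + m * lo * (t + t\<^sup>2) \<le> - (m * (hi - lo)\<^sup>2 / (16 * hi))"
  proof -
    have "- t * (m * ((lo + hi) / 2)) + m * lo * (t + t\<^sup>2) = m * (lo * t\<^sup>2 - t * (hi - lo) / 2)"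
      by (simp add: algebra_simps diff_divide_distrib add_divide_distrib)
    also have "\<dots> \<le> m * (hi * t\<^sup>2 - t * (hi - lo) / 2)"
      using lohi by (intro mult_left_mono diff_right_mono mult_right_mono) (auto simp: m_def)
    also note ex
    finally show ?thesis .
  qed
  finally show "measure (sample_space N) {\<omega> \<in> space (sample_space N). k \<le> card {i\<in>J. \<omega> i \<in> {..<lo}}}
           \<le> exp (- (real (card J) * (hi - lo)\<^sup>2 / (16 * hi)))" by (simp add: m_def)
  have "measure (sample_space N) {\<omega> \<in> space (sample_space N). card {i\<in>J. \<omega> i \<in> {..hi}} < k}
      \<le> measure (sample_space N) {\<omega> \<in> space (sample_space N).
           (- t) * (m * ((lo + hi) / 2)) \<le> (- t) * real (card {i\<in>J. \<omega> i \<in> {..hi}})}"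
  proof (intro S.finite_measure_mono Collect_mono impI conjI; (elim conjE)?)
    fix \<omega> assume "card {i\<in>J. \<omega> i \<in> {..hi}} < k"
    then have "real (card {i\<in>J. \<omega> i \<in> {..hi}}) \<le> m * ((lo + hi) / 2)"
      using k1(2) not_le by blast
    then show "(- t) * (m * ((lo + hi) / 2)) \<le> (- t) * real (card {i\<in>J. \<omega> i \<in> {..hi}})"
      by (rule mult_left_mono_neg) (use t in simp)
  next
    show "{\<omega> \<in> space (sample_space N).
           (- t) * (m * ((lo + hi) / 2)) \<le> (- t) * real (card {i\<in>J. \<omega> i \<in> {..hi}})} \<in> S.events"
      by (rule sets_sample_count[OF J]) simp
  qed
  also have "\<dots> \<le> exp (t * (m * ((lo + hi) / 2)) + m * hi * (- t + t\<^sup>2))"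
    using count_tail[OF J, of "{..hi}" "- t" "m * ((lo + hi) / 2)"] t
    unfolding measure_unif_Iic[OF order_trans[OF lohi(1) less_imp_le[OF lohi(2)]] lohi(3)]
    by (simp only: m_def atMost_borel abs_of_nonneg simp_thms minus_minus power2_minus abs_minus_cancel)
  also have "t * (m * ((lo + hi) / 2)) + m * hi * (- t + t\<^sup>2) = - (m * (hi - lo)\<^sup>2 / (16 * hi))"
  proof -
    have "t * (m * ((lo + hi) / 2)) + m * hi * (- t + t\<^sup>2) = m * (hi * t\<^sup>2 - t * (hi - lo) / 2)"
      by (simp add: algebra_simps diff_divide_distrib add_divide_distrib)
    also note ex
    finally show ?thesis .
  qed
  finally show "measure (sample_space N) {\<omega> \<in> space (sample_space N). card {i\<in>J. \<omega> i \<in> {..hi}} < k}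
           \<le> exp (- (real (card J) * (hi - lo)\<^sup>2 / (16 * hi)))" by (simp add: m_def)
qed

subsection \<open>Histories as random lists\<close>

text \<open>Measurability of a random list is expressed through its constant length and its entries,
  which avoids choosing a sigma-algebra on lists of varying length.\<close>

definition rlist :: "'a measure \<Rightarrow> nat \<Rightarrow> ('a \<Rightarrow> real list) \<Rightarrow> bool" where
  "rlist M n X \<longleftrightarrow> (\<forall>\<omega>. length (X \<omega>) = n) \<and> (\<forall>i<n. (\<lambda>\<omega>. X \<omega> ! i) \<in> borel_measurable M)"

text \<open>Closure under composition is taken as the definition, so that query and price rules,
  which act on lists, can be applied to random histories directly.\<close>

definition lmeas :: "'a measure \<Rightarrow> nat \<Rightarrow> (real list \<Rightarrow> real) \<Rightarrow> bool" where
  "lmeas M n f \<longleftrightarrow> (\<forall>X. rlist M n X \<longrightarrow> (\<lambda>\<omega>. f (X \<omega>)) \<in> borel_measurable M)"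

lemma lmeasD: "lmeas M n f \<Longrightarrow> rlist M n X \<Longrightarrow> (\<lambda>\<omega>. f (X \<omega>)) \<in> borel_measurable M"
  by (simp add: lmeas_def)

lemma rlist_Nil: "rlist M 0 (\<lambda>_. [])"
  by (simp add: rlist_def)

lemma rlist_snoc:
  assumes "rlist M n X" "f \<in> borel_measurable M"
  shows "rlist M (Suc n) (\<lambda>\<omega>. X \<omega> @ [f \<omega>])"
  using assms by (auto simp: rlist_def nth_append less_Suc_eq)

lemma rlist_take:
  assumes "rlist M n X" "r \<le> n" shows "rlist M r (\<lambda>\<omega>. take r (X \<omega>))"
  using assms by (auto simp: rlist_def)

lemma rlist_nth: "rlist M n X \<Longrightarrow> i < n \<Longrightarrow> (\<lambda>\<omega>. X \<omega> ! i) \<in> borel_measurable M"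
  by (simp add: rlist_def)

lemma length_hist [simp]: "length (hist D Q \<omega> n) = n"
  by (induction n) auto

lemma take_hist: "i \<le> n \<Longrightarrow> take i (hist D Q \<omega> n) = hist D Q \<omega> i"
  by (induction n) (auto simp: le_Suc_eq)

lemma hist_nth:
  assumes "i < n"
  shows "hist D (\<lambda>_. q) \<omega> n ! i = val_at D (fst (q (hist D (\<lambda>_. q) \<omega> i))
     + (snd (q (hist D (\<lambda>_. q) \<omega> i)) - fst (q (hist D (\<lambda>_. q) \<omega> i))) * \<omega> (Suc i))"
  using assms by (induction n) (auto simp: nth_append less_Suc_eq)

lemma rlist_hist:
  assumes D: "value_dist D"
    and q: "\<And>n. lmeas (sample_space N) n (\<lambda>h. fst (q h))" "\<And>n. lmeas (sample_space N) n (\<lambda>h. snd (q h))"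
    and "n \<le> N"
  shows "rlist (sample_space N) n (\<lambda>\<omega>. hist D (\<lambda>_. q) \<omega> n)"
  using \<open>n \<le> N\<close>
proof (induction n)
  case 0 then show ?case by (simp add: rlist_Nil)
next
  case (Suc n)
  then have IH: "rlist (sample_space N) n (\<lambda>\<omega>. hist D (\<lambda>_. q) \<omega> n)" by simp
  note [measurable] = lmeasD[OF q(1) IH] lmeasD[OF q(2) IH]
  have [measurable]: "(\<lambda>\<omega>. \<omega> (Suc n)) \<in> borel_measurable (sample_space N)"
    using Suc.prems by (rule sample_component)
  note [measurable] = val_at_measurable[OF D]
  show ?case
    unfolding hist.simps by (rule rlist_snoc[OF IH]) measurable
qed

text \<open>A success event outside the sigma-algebra would have \<open>measure\<close> zero by
  convention; this is why measurability of the rules and of the goal is carried through the whole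
  proof. Failures only have to be covered by some event \<open>bad\<close>, which need not mention
  the rules.\<close>

lemma success_probI:
  assumes D: "value_dist D"
    and q: "\<And>n. lmeas (sample_space N) n (\<lambda>h. fst (q h))" "\<And>n. lmeas (sample_space N) n (\<lambda>h. snd (q h))"
    and p: "lmeas (sample_space N) N p"
    and Goal: "{x. Goal x} \<in> sets borel"
    and bad: "bad \<in> sets (sample_space N)" "measure (sample_space N) bad \<le> \<delta>"
    and good: "\<And>\<omega>. \<omega> \<in> space (sample_space N) \<Longrightarrow> \<omega> \<notin> bad \<Longrightarrow> Goal (p (hist D (\<lambda>_. q) \<omega> N))"
  shows "1 - \<delta> \<le> success_prob D N (\<lambda>_. q) (\<lambda>_. p) Goal"
proof -
  interpret prob_space "sample_space N" by (rule prob_space_sample)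
  have "(\<lambda>\<omega>. p (hist D (\<lambda>_. q) \<omega> N)) \<in> borel_measurable (sample_space N)"
    by (rule lmeasD[OF p rlist_hist[OF D q order_refl]])
  from measurable_sets[OF this Goal]
  have ev: "{\<omega> \<in> space (sample_space N). Goal (p (hist D (\<lambda>_. q) \<omega> N))} \<in> events"
    by (simp add: vimage_def Int_def conj_commute)
  have "1 - \<delta> \<le> 1 - prob bad" using bad by simp
  also have "\<dots> = prob (space (sample_space N) - bad)" using prob_compl[OF bad(1)] by simp
  also have "\<dots> \<le> success_prob D N (\<lambda>_. q) (\<lambda>_. p) Goal"
    unfolding success_prob_def using good by (intro finite_measure_mono[OF _ ev]) auto
  finally show ?thesis .
qed

subsection \<open>Choosing the best guaranteed revenue\<close>

text \<open>Running maximum of the guarantees \<open>l r * x r\<close>, paired with a price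
  attaining it. The start \<open>(0, 0)\<close> is sound for every distribution, since price 0 earns
  0.\<close>

primrec best :: "(nat \<Rightarrow> real) \<Rightarrow> (nat \<Rightarrow> real) \<Rightarrow> nat \<Rightarrow> real \<times> real" where
  "best l x 0 = (0, 0)"
| "best l x (Suc n) = (if fst (best l x n) < l n * x n then (l n * x n, x n) else best l x n)"

lemma best_upper: "r < n \<Longrightarrow> l r * x r \<le> fst (best l x n)"
  by (induction n) (auto simp: less_Suc_eq)

text \<open>A lower bound \<open>l r\<close> on the selling probability at price \<open>x r\<close>
  turns the computable product \<open>l r * x r\<close> into a lower bound on the unknown
  revenue.\<close>

lemma best_rev:
  assumes "\<And>r. r < n \<Longrightarrow> l r \<le> quant D (x r)" "\<And>r. r < n \<Longrightarrow> 0 \<le> x r"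
  shows "fst (best l x n) \<le> rev D (snd (best l x n))"
  using assms by (induction n) (auto simp: rev_def mult.commute[of "l _"] intro!: mult_left_mono)

lemma best_measurable:
  assumes "\<And>r. r < n \<Longrightarrow> (\<lambda>\<omega>. l r \<omega>) \<in> borel_measurable M"
    "\<And>r. r < n \<Longrightarrow> (\<lambda>\<omega>. x r \<omega>) \<in> borel_measurable M"
  shows "(\<lambda>\<omega>. fst (best (\<lambda>r. l r \<omega>) (\<lambda>r. x r \<omega>) n)) \<in> borel_measurable M \<and>
         (\<lambda>\<omega>. snd (best (\<lambda>r. l r \<omega>) (\<lambda>r. x r \<omega>) n)) \<in> borel_measurable M"
  using assms
proof (induction n)
  case (Suc n)
  have [measurable]: "(\<lambda>\<omega>. fst (best (\<lambda>r. l r \<omega>) (\<lambda>r. x r \<omega>) n)) \<in> borel_measurable M"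
    "(\<lambda>\<omega>. snd (best (\<lambda>r. l r \<omega>) (\<lambda>r. x r \<omega>) n)) \<in> borel_measurable M"
    "l n \<in> borel_measurable M" "x n \<in> borel_measurable M"
    using Suc by auto
  show ?case by (auto simp: if_distrib[of fst] if_distrib[of snd])
qed simp

subsection \<open>Learning from one block of unconditional samples\<close>

text \<open>The max-min formula for an order statistic. Compared with sorting, it makes
  measurability a matter of finite \<open>Max\<close> and \<open>Min\<close>.\<close>

definition kth_largest :: "nat \<Rightarrow> nat \<Rightarrow> real list \<Rightarrow> real" where
  "kth_largest k m h = Max ((\<lambda>S. Min ((\<lambda>i. h ! i) ` S)) ` {S. S \<subseteq> {..<m} \<and> card S = k})"

text \<open>Values decrease in the quantile, so large values belong to small quantiles. A
  \<open>k\<close>-set attaining the maximum cannot consist of quantiles below \<open>lo\<close>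
  only, which bounds its minimum from above; some \<open>k\<close>-set of quantiles up to
  \<open>hi\<close> competes in the maximum, which bounds it from below.\<close>

lemma kth_largest_bracket:
  assumes D: "value_dist D" and u: "\<And>i. i < m \<Longrightarrow> 0 < u i \<and> u i \<le> 1"
    and h: "\<And>i. i < m \<Longrightarrow> h ! i = val_at D (u i)"
    and k: "1 \<le> k" "k \<le> m" and "hi \<le> 1"
    and lo: "card {i. i < m \<and> u i < lo} < k" and hi: "k \<le> card {i. i < m \<and> u i \<le> hi}"
  shows "lo \<le> quant D (kth_largest k m h)" "val_at D hi \<le> kth_largest k m h" "0 \<le> kth_largest k m h"
proof -
  let ?F = "{S. S \<subseteq> {..<m} \<and> card S = k}"
  have finF: "finite ?F" by (rule finite_subset[of _ "Pow {..<m}"]) auto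
  have S: "finite S" "S \<noteq> {}" if "S \<in> ?F" for S
    using that k finite_subset[of S "{..<m}"] by auto
  have "{..<k} \<in> ?F" using k by simp
  then have ne: "?F \<noteq> {}" by blast
  have "kth_largest k m h \<in> (\<lambda>S. Min ((\<lambda>i. h ! i) ` S)) ` ?F"
    unfolding kth_largest_def
    by (intro Max_in finite_imageI finF) (simp only: image_is_empty ne not_False_eq_True)
  then obtain S where SF: "S \<in> ?F" and x: "kth_largest k m h = Min ((\<lambda>i. h ! i) ` S)"
    by (rule imageE)
  have Sm: "S \<subseteq> {..<m}" "card S = k" "finite S" "S \<noteq> {}" using SF S[OF SF] by simp_all
  have "\<not> S \<subseteq> {i. i < m \<and> u i < lo}"
    using card_mono[of "{i. i < m \<and> u i < lo}" S] lo Sm by auto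
  then obtain i where "i \<in> S" "\<not> (i < m \<and> u i < lo)" by blast
  moreover from this have "i < m" using Sm(1) by auto
  ultimately have i: "i \<in> S" "lo \<le> u i" "i < m" by auto
  have "kth_largest k m h \<le> val_at D (u i)"
    unfolding x using i Sm h[of i] by (metis Min_le finite_imageI imageI)
  then have "quant D (val_at D (u i)) \<le> quant D (kth_largest k m h)"
    by (rule quant_antimono[OF D])
  then show "lo \<le> quant D (kth_largest k m h)"
    using quant_val_at[OF D, of "u i"] u[OF i(3)] i(2) by linarith
  have "Min ((\<lambda>i. h ! i) ` S) \<in> (\<lambda>i. h ! i) ` S" using Sm by (intro Min_in) auto
  then obtain j where "j \<in> S" "Min ((\<lambda>i. h ! i) ` S) = h ! j" by auto
  then show "0 \<le> kth_largest k m h"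
    unfolding x using h[of j] u[of j] Sm(1) val_at_nonneg[OF D, of "u j"] by auto
  obtain S' where S': "S' \<subseteq> {i. i < m \<and> u i \<le> hi}" "card S' = k"
    using obtain_subset_with_card_n[OF hi] by metis
  then have F': "S' \<in> ?F" by auto
  have "val_at D hi \<le> Min ((\<lambda>i. h ! i) ` S')"
  proof (subst Min_ge_iff)
    show "\<forall>a\<in>(\<lambda>i. h ! i) ` S'. val_at D hi \<le> a"
      using S' u h val_at_antimono[OF D _ _ \<open>hi \<le> 1\<close>] by auto
  qed (use S[OF F'] in auto)
  also have "\<dots> \<le> kth_largest k m h"
    unfolding kth_largest_def using finF F' by (intro Max_ge) auto
  finally show "val_at D hi \<le> kth_largest k m h" .
qed

lemma kth_largest_measurable:
  assumes "rlist M m X" shows "(\<lambda>\<omega>. kth_largest k m (X \<omega>)) \<in> borel_measurable M"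
  unfolding kth_largest_def
proof (rule borel_measurable_Max)
  show "finite {S. S \<subseteq> {..<m} \<and> card S = k}"
    by (rule finite_subset[of _ "Pow {..<m}"]) auto
  fix S assume "S \<in> {S. S \<subseteq> {..<m} \<and> card S = k}"
  then show "(\<lambda>\<omega>. Min ((\<lambda>i. X \<omega> ! i) ` S)) \<in> borel_measurable M"
    using rlist_nth[OF assms] by (intro borel_measurable_Min) (auto intro: finite_subset)
qed

text \<open>At level 0 \<open>val_at\<close> is a default value, so a uniform equal to 0 has to be
  excluded; together with the points outside \<open>[0,1]\<close> this is a null event.\<close>

definition out_of_range :: "nat \<Rightarrow> (nat \<Rightarrow> real) set" where
  "out_of_range N = space (sample_space N) - {\<omega> \<in> space (sample_space N). \<forall>i\<in>{1..N}. \<omega> i \<in> {0<..1}}"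

lemma out_of_range_null:
  "out_of_range N \<in> sets (sample_space N)" "measure (sample_space N) (out_of_range N) = 0"
proof -
  interpret prob_space "sample_space N" by (rule prob_space_sample)
  have J: "{1..N} \<subseteq> {..N}" by auto
  have ev: "{\<omega> \<in> space (sample_space N). \<forall>i\<in>{1..N}. \<omega> i \<in> {0<..1}} \<in> events"
    by (rule sets_sample_all[OF J]) simp
  then show "out_of_range N \<in> sets (sample_space N)" by (simp add: out_of_range_def)
  show "measure (sample_space N) (out_of_range N) = 0"
    unfolding out_of_range_def prob_compl[OF ev] prob_all_in[OF J, of "{0<..1}", simplified]
    using prob_all_in[OF J, of "{0<..1}"] by (simp add: measure_unif_Ioc01 del: measure_uniform_measure)
qed

lemma card_Suc_block: "card {i \<in> Suc ` {..<m}. P i} = card {i. i < m \<and> P (Suc i)}"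
proof -
  have "{i \<in> Suc ` {..<m}. P i} = Suc ` {i. i < m \<and> P (Suc i)}" by auto
  then show ?thesis by (simp add: card_image)
qed

text \<open>The same \<open>m\<close> answers serve all brackets: bracket \<open>j\<close> reads off
  the order statistic at the middle of \<open>lo j\<close> and \<open>hi j\<close>. The factor
  \<open>2 * J\<close> is the union bound over two tails per bracket.\<close>

lemma one_block_learner:
  fixes lo hi :: "nat \<Rightarrow> real"
  assumes "\<Delta> \<le> 1" "0 < m" "0 \<le> \<delta>"
    and grid: "\<And>j. j < J \<Longrightarrow> 0 < lo j \<and> lo j < hi j \<and> hi j \<le> 1"
    and m: "\<And>j. j < J \<Longrightarrow> 2 * real J * exp (- (real m * (hi j - lo j)\<^sup>2 / (16 * hi j))) \<le> \<delta>"
    and Class: "\<And>D. Class D \<Longrightarrow> value_dist D" "\<And>D. Class D \<Longrightarrow> {x. Goal D x} \<in> sets borel"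
    and Goal: "\<And>D x. Class D \<Longrightarrow> (\<And>j. j < J \<Longrightarrow> lo j * val_at D (hi j) \<le> rev D x) \<Longrightarrow> Goal D x"
  shows "\<exists>Q P. learns \<Delta> m Q P Class Goal \<delta>"
proof -
  interpret prob_space "sample_space m" by (rule prob_space_sample)
  define q :: "real list \<Rightarrow> real \<times> real" where "q h = (0, 1)" for h
  define k where "k j = nat \<lceil>real m * ((lo j + hi j) / 2)\<rceil>" for j
  define p where "p h = snd (best lo (\<lambda>j. kth_largest (k j) m h) J)" for h
  let ?I = "Suc ` {..<m}"
  define low where "low j = {\<omega> \<in> space (sample_space m). k j \<le> card {i\<in>?I. \<omega> i \<in> {..<lo j}}}" for j
  define high where "high j = {\<omega> \<in> space (sample_space m). card {i\<in>?I. \<omega> i \<in> {..hi j}} < k j}" for j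
  define bad where "bad = out_of_range m \<union> (\<Union>j\<in>{..<J}. low j \<union> high j)"
  have I: "?I \<subseteq> {..m}" "card ?I = m" by (auto simp: card_image)
  have ev: "low j \<in> events" "high j \<in> events" for j
    unfolding low_def high_def by (rule sets_sample_count[OF I(1)]; simp)+
  have bad_ev: "bad \<in> events" unfolding bad_def using ev out_of_range_null(1) by auto
  have "prob bad \<le> prob (out_of_range m) + prob (\<Union>j\<in>{..<J}. low j \<union> high j)"
    unfolding bad_def using ev out_of_range_null(1) by (intro measure_Un_le) auto
  also have "prob (\<Union>j\<in>{..<J}. low j \<union> high j) \<le> (\<Sum>j\<in>{..<J}. prob (low j \<union> high j))"
    using ev by (intro measure_UNION_le) auto
  also have "\<dots> \<le> (\<Sum>j\<in>{..<J}. \<delta> / real J)"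
  proof (rule sum_mono)
    fix j assume j: "j \<in> {..<J}"
    let ?e = "exp (- (real m * (hi j - lo j)\<^sup>2 / (16 * hi j)))"
    have "prob (low j) \<le> ?e" "prob (high j) \<le> ?e"
      using order_statistic_fails[OF I(1), of "lo j" "hi j" "k j"] grid[of j] j
      unfolding I(2) low_def high_def k_def by auto
    moreover have "prob (low j \<union> high j) \<le> prob (low j) + prob (high j)"
      using ev by (intro measure_Un_le) auto
    moreover have "2 * ?e \<le> \<delta> / real J"
      using m[of j] j by (simp add: field_simps)
    ultimately show "prob (low j \<union> high j) \<le> \<delta> / real J" by linarith
  qed
  also have "\<dots> \<le> \<delta>" using \<open>0 \<le> \<delta>\<close> by simp
  finally have bad_prob: "prob bad \<le> \<delta>" using out_of_range_null(2) by simp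
  have "valid_queries \<Delta> (\<lambda>_. q)" using \<open>\<Delta> \<le> 1\<close> by (simp add: valid_queries_def q_def)
  moreover have "1 - \<delta> \<le> success_prob D m (\<lambda>_. q) (\<lambda>_. p) (Goal D)" if CD: "Class D" for D
  proof (rule success_probI[OF Class(1)[OF CD] _ _ _ Class(2)[OF CD] bad_ev bad_prob])
    show "lmeas (sample_space m) n (\<lambda>h. fst (q h))" "lmeas (sample_space m) n (\<lambda>h. snd (q h))" for n
      by (simp_all add: lmeas_def q_def)
    show "lmeas (sample_space m) m p"
      unfolding lmeas_def p_def
      by (intro allI impI conjunct2[OF best_measurable] kth_largest_measurable) simp_all
    fix \<omega> assume \<omega>: "\<omega> \<in> space (sample_space m)" "\<omega> \<notin> bad"
    let ?h = "hist D (\<lambda>_. q) \<omega> m"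
    have u: "0 < \<omega> (Suc i) \<and> \<omega> (Suc i) \<le> 1" if "i < m" for i
      using \<omega> that by (auto simp: bad_def out_of_range_def)
    have h: "?h ! i = val_at D (\<omega> (Suc i))" if "i < m" for i
      using hist_nth[OF that, of D q \<omega>] by (simp add: q_def)
    have br: "lo j \<le> quant D (kth_largest (k j) m ?h)" "val_at D (hi j) \<le> kth_largest (k j) m ?h"
      "0 \<le> kth_largest (k j) m ?h" if j: "j < J" for j
    proof -
      have g: "0 < lo j" "lo j < hi j" "hi j \<le> 1" using grid[OF j] by auto
      have "0 < real m * ((lo j + hi j) / 2)" using g \<open>0 < m\<close> by simp
      moreover have "real m * ((lo j + hi j) / 2) \<le> real m * 1"
        using g by (intro mult_left_mono) auto
      \<comment> \<open>The midpoint lies in \<open>(0,1]\<close>, so rounding up gives a rank that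
        the \<open>m\<close> answers really have.\<close>
      ultimately have k: "1 \<le> k j" "k j \<le> m" unfolding k_def by linarith+
      have "card {i. i < m \<and> \<omega> (Suc i) < lo j} < k j" "k j \<le> card {i. i < m \<and> \<omega> (Suc i) \<le> hi j}"
        using \<omega> j unfolding bad_def low_def high_def card_Suc_block by (auto simp: not_le not_less)
      from kth_largest_bracket[OF Class(1)[OF CD] u h k g(3) this]
      show "lo j \<le> quant D (kth_largest (k j) m ?h)" "val_at D (hi j) \<le> kth_largest (k j) m ?h"
        "0 \<le> kth_largest (k j) m ?h" by auto
    qed
    show "Goal D (p ?h)"
    proof (rule Goal[OF CD])
      fix j assume j: "j < J"
      have "lo j * val_at D (hi j) \<le> lo j * kth_largest (k j) m ?h"
        using br[OF j] grid[OF j] by (intro mult_left_mono) auto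
      also have "\<dots> \<le> fst (best lo (\<lambda>j. kth_largest (k j) m ?h) J)"
        using best_upper[OF j] .
      also have "\<dots> \<le> rev D (p ?h)"
        unfolding p_def by (rule best_rev) (use br in auto)
      finally show "lo j * val_at D (hi j) \<le> rev D (p ?h)" .
    qed
  qed
  ultimately show ?thesis unfolding learns_def by blast
qed

subsection \<open>Adaptive learning in blocks\<close>

text \<open>The interval is anchored at \<open>lo\<close> if there is room above it and at
  \<open>hi\<close> otherwise. The maximum is taken because a bracket longer than
  \<open>\<Delta>\<close> can be requested as it is.\<close>

definition request :: "real \<Rightarrow> real \<times> real \<Rightarrow> real \<times> real" where
  "request \<Delta> br = (if fst br \<le> 1 / 2 then (fst br, fst br + max \<Delta> (snd br - fst br))
                    else (snd br - max \<Delta> (snd br - fst br), snd br))"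

text \<open>Anchored at \<open>lo\<close>, every answer sells with probability at least
  \<open>lo\<close>, and the largest answer has the smallest quantile, hence the best chance of a
  quantile up to \<open>hi\<close>. Anchored at \<open>hi\<close>, the roles are exchanged.\<close>

definition extreme :: "real \<times> real \<Rightarrow> real set \<Rightarrow> real" where
  "extreme br A = (if fst br \<le> 1 / 2 then Max A else Min A)"

text \<open>The last conjunct records that \<open>x\<close> is a genuine answer. It gives
  \<open>0 \<le> x\<close> and, when \<open>quant\<close> inverts \<open>val_at\<close>, identifies
  \<open>x\<close> as the value at its own quantile, where a supergradient is available.\<close>

definition brackets :: "real measure \<Rightarrow> real \<times> real \<Rightarrow> real \<Rightarrow> bool" where
  "brackets D br x \<longleftrightarrow> fst br \<le> quant D x \<and> val_at D (snd br) \<le> x \<and> (\<exists>u. 0 < u \<and> u \<le> 1 \<and> x = val_at D u)"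

text \<open>Each block of \<open>m\<close> answers is condensed to one price, and \<open>B\<close>
  chooses the bracket of the next block from these prices alone.\<close>

primrec results :: "(real list \<Rightarrow> real \<times> real) \<Rightarrow> nat \<Rightarrow> real list \<Rightarrow> nat \<Rightarrow> real list" where
  "results B m h 0 = []"
| "results B m h (Suc r) = results B m h r @
     [extreme (B (results B m h r)) ((\<lambda>i. h ! i) ` {r * m..<Suc r * m})]"

lemma request_valid:
  assumes "0 < lo" "lo < hi" "hi \<le> 1" "\<Delta> \<le> 1 / 2"
  shows "0 \<le> fst (request \<Delta> (lo, hi)) \<and> fst (request \<Delta> (lo, hi)) + \<Delta> \<le> snd (request \<Delta> (lo, hi))
    \<and> snd (request \<Delta> (lo, hi)) \<le> 1"
  using assms by (auto simp: request_def max_def)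

text \<open>The anchor makes one bound hold for every answer. For the other, a normalised uniform
  within \<open>\<rho>\<close> of the anchor moves away from it by at most
  \<open>\<rho> * max \<Delta> (hi - lo) \<le> hi - lo\<close>, so its quantile stays in the
  bracket, and the extreme answer is at least as good.\<close>

lemma extreme_brackets:
  fixes lo hi :: real
  assumes D: "value_dist D" and lohi: "0 < lo" "lo < hi" "hi \<le> 1" and \<Delta>: "0 < \<Delta>" "\<Delta> \<le> 1 / 2"
    and \<rho>: "0 \<le> \<rho>" "\<rho> \<le> 1" "\<rho> * \<Delta> \<le> hi - lo"
    and I: "finite I" "\<And>i. i \<in> I \<Longrightarrow> 0 < w i \<and> w i \<le> 1"
    and hits: "\<exists>i\<in>I. w i \<le> \<rho>" "\<exists>i\<in>I. 1 - \<rho> \<le> w i"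
    and y: "\<And>i. i \<in> I \<Longrightarrow> y i = val_at D (fst (request \<Delta> (lo, hi))
       + (snd (request \<Delta> (lo, hi)) - fst (request \<Delta> (lo, hi))) * w i)"
  shows "brackets D (lo, hi) (extreme (lo, hi) (y ` I))"
proof -
  let ?l = "max \<Delta> (hi - lo)"
  have \<rho>l: "\<rho> * ?l \<le> hi - lo"
    using \<rho> lohi mult_right_mono[of \<rho> 1 "hi - lo"] by (auto simp: max_def)
  have l: "0 < ?l" using \<Delta> by simp
  have ne: "y ` I \<noteq> {}" "finite (y ` I)" using hits I by auto
  show ?thesis
  proof (cases "lo \<le> 1 / 2")
    case True
    define u where "u i = lo + ?l * w i" for i
    have yu: "y i = val_at D (u i)" if "i \<in> I" for i
      using y[OF that] True by (simp add: request_def u_def)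
    have lu: "lo \<le> u i" "u i \<le> 1" if "i \<in> I" for i
    proof -
      have "0 \<le> ?l * w i" "?l * w i \<le> ?l * 1" using I(2)[OF that] l by (auto intro!: mult_left_mono)
      moreover have "lo + ?l \<le> 1" using True \<Delta> lohi by (auto simp: max_def)
      ultimately show "lo \<le> u i" "u i \<le> 1" by (auto simp: u_def)
    qed
    have ext: "extreme (lo, hi) (y ` I) = Max (y ` I)" using True by (simp add: extreme_def)
    obtain i where i: "i \<in> I" "Max (y ` I) = y i" using Max_in[OF ne(2,1)] by (metis imageE)
    obtain j where j: "j \<in> I" "w j \<le> \<rho>" using hits by blast
    have "?l * w j \<le> \<rho> * ?l" using j l by (simp add: mult.commute[of \<rho>])
    then have "u j \<le> hi" using \<rho>l by (simp add: u_def)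
    then have "val_at D hi \<le> y j"
      unfolding yu[OF j(1)] using lu(1)[OF j(1)] lohi by (intro val_at_antimono[OF D]) auto
    also have "y j \<le> Max (y ` I)" using ne j by (intro Max_ge) auto
    finally have "val_at D hi \<le> Max (y ` I)" .
    moreover have "lo \<le> quant D (y i)"
      unfolding yu[OF i(1)] using quant_val_at[OF D, of "u i"] lu[OF i(1)] lohi by linarith
    moreover have "\<exists>u. 0 < u \<and> u \<le> 1 \<and> y i = val_at D u"
      using yu[OF i(1)] lu[OF i(1)] lohi by (intro exI[of _ "u i"]) auto
    ultimately show ?thesis unfolding brackets_def ext i(2) by simp
  next
    case False
    define u where "u i = hi - ?l + ?l * w i" for i
    have yu: "y i = val_at D (u i)" if "i \<in> I" for i
      using y[OF that] False by (simp add: request_def u_def)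
    have lu: "0 < u i" "u i \<le> hi" if "i \<in> I" for i
    proof -
      have "0 < ?l * w i" "?l * w i \<le> ?l * 1" using I(2)[OF that] l by (auto intro!: mult_left_mono)
      moreover have "0 \<le> hi - ?l" using False \<Delta> lohi by (auto simp: max_def)
      ultimately show "0 < u i" "u i \<le> hi" by (auto simp: u_def)
    qed
    have ext: "extreme (lo, hi) (y ` I) = Min (y ` I)" using False by (simp add: extreme_def)
    obtain i where i: "i \<in> I" "Min (y ` I) = y i" using Min_in[OF ne(2,1)] by (metis imageE)
    obtain j where j: "j \<in> I" "1 - \<rho> \<le> w j" using hits by blast
    have "?l * (1 - \<rho>) \<le> ?l * w j" using j l by (intro mult_left_mono) auto
    moreover have "?l * (1 - \<rho>) = ?l - \<rho> * ?l" by (simp only: right_diff_distrib mult_1_right mult.commute[of _ \<rho>])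
    ultimately have "lo \<le> u j" using \<rho>l unfolding u_def by linarith
    also have "u j \<le> quant D (y j)"
      unfolding yu[OF j(1)] using lu[OF j(1)] lohi by (intro quant_val_at[OF D]) auto
    also have "\<dots> \<le> quant D (Min (y ` I))"
      using ne j by (intro quant_antimono[OF D] Min_le) auto
    finally have "lo \<le> quant D (Min (y ` I))" .
    moreover have "val_at D hi \<le> y i"
      unfolding yu[OF i(1)] using lu[OF i(1)] lohi by (intro val_at_antimono[OF D]) auto
    moreover have "\<exists>u. 0 < u \<and> u \<le> 1 \<and> y i = val_at D u"
      using yu[OF i(1)] lu[OF i(1)] lohi by (intro exI[of _ "u i"]) auto
    ultimately show ?thesis unfolding brackets_def ext i(2) by simp
  qed
qed

lemma length_results [simp]: "length (results B m h r) = r"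
  by (induction r) auto

lemma take_results: "r \<le> T \<Longrightarrow> take r (results B m h T) = results B m h r"
  by (induction T) (auto simp: le_Suc_eq)

lemma results_nth:
  "r < T \<Longrightarrow> results B m h T ! r
     = extreme (B (results B m h r)) ((\<lambda>i. h ! i) ` {r * m..<Suc r * m})"
  by (induction T) (auto simp: nth_append less_Suc_eq)

text \<open>What the query rule computes from the history so far agrees with what is computed from
  the complete history, so the bracket requested is the one analysed afterwards.\<close>

lemma results_take:
  assumes "r * m \<le> n" shows "results B m (take n h) r = results B m h r"
  using assms
proof (induction r)
  case (Suc r)
  have "(\<lambda>i. take n h ! i) ` {r * m..<Suc r * m} = (\<lambda>i. h ! i) ` {r * m..<Suc r * m}"
    using Suc.prems by (intro image_cong) auto
  then show ?case using Suc by simp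
qed simp

lemma rlist_results:
  assumes X: "rlist M n X"
    and B: "\<And>r. lmeas M r (\<lambda>xs. fst (B xs))"
    and "r * m \<le> n"
  shows "rlist M r (\<lambda>\<omega>. results B m (X \<omega>) r)"
  using \<open>r * m \<le> n\<close>
proof (induction r)
  case 0 then show ?case by (simp add: rlist_Nil)
next
  case (Suc r)
  then have IH: "rlist M r (\<lambda>\<omega>. results B m (X \<omega>) r)" by simp
  have X': "(\<lambda>\<omega>. X \<omega> ! i) \<in> borel_measurable M" if "i \<in> {r * m..<Suc r * m}" for i
    using that Suc.prems by (intro rlist_nth[OF X]) auto
  have [measurable]: "(\<lambda>\<omega>. Max ((\<lambda>i. X \<omega> ! i) ` {r * m..<Suc r * m})) \<in> borel_measurable M"
    "(\<lambda>\<omega>. Min ((\<lambda>i. X \<omega> ! i) ` {r * m..<Suc r * m})) \<in> borel_measurable M"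
    by (intro borel_measurable_Max borel_measurable_Min X' finite_atLeastLessThan; assumption)+
  note [measurable] = lmeasD[OF B IH]
  show ?case
    unfolding results.simps extreme_def by (rule rlist_snoc[OF IH]) measurable
qed

text \<open>Which end serves as anchor depends on earlier answers, so the good event asks every
  block for a uniform near 0 and for one near 1. This is the factor 2 in the failure bound; each end
  piece is missed with probability \<open>(1 - \<rho>) ^ m\<close>.\<close>

lemma block_learner:
  fixes B :: "real list \<Rightarrow> real \<times> real"
  assumes \<Delta>: "0 < \<Delta>" "\<Delta> \<le> 1 / 2" and "0 < m"
    and \<rho>: "0 \<le> \<rho>" "\<rho> \<le> 1" "2 * real T * (1 - \<rho>) ^ m \<le> \<delta>"
    and B: "\<And>xs. 0 < fst (B xs) \<and> fst (B xs) < snd (B xs) \<and> snd (B xs) \<le> 1 \<and> \<rho> * \<Delta> \<le> snd (B xs) - fst (B xs)"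
    and meas: "\<And>r. lmeas (sample_space (T * m)) r (\<lambda>xs. fst (B xs))"
      "\<And>r. lmeas (sample_space (T * m)) r (\<lambda>xs. snd (B xs))"
    and Class: "\<And>D. Class D \<Longrightarrow> value_dist D" "\<And>D. Class D \<Longrightarrow> {x. Goal D x} \<in> sets borel"
    and Goal: "\<And>D x xs. Class D \<Longrightarrow> length xs = T \<Longrightarrow>
       (\<And>r. r < T \<Longrightarrow> brackets D (B (take r xs)) (xs ! r)) \<Longrightarrow>
       (\<And>r. r < T \<Longrightarrow> fst (B (take r xs)) * xs ! r \<le> rev D x) \<Longrightarrow> Goal D x"
  shows "\<exists>Q P. learns \<Delta> (T * m) Q P Class Goal \<delta>"
proof -
  define N where "N = T * m"
  interpret prob_space "sample_space N" by (rule prob_space_sample)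
  \<comment> \<open>\<open>length h div m\<close> counts the finished blocks, so all
    \<open>m\<close> requests of a block use the same bracket.\<close>
  define q where "q h = request \<Delta> (B (results B m h (length h div m)))" for h
  define p where "p h = (let xs = results B m h T in
     snd (best (\<lambda>r. fst (B (take r xs))) (\<lambda>r. xs ! r) T))" for h
  let ?I = "\<lambda>r. Suc ` {r * m..<Suc r * m}"
  define low where "low r = {\<omega> \<in> space (sample_space N). \<forall>i\<in>?I r. \<omega> i \<in> {\<rho><..}}" for r
  define high where "high r = {\<omega> \<in> space (sample_space N). \<forall>i\<in>?I r. \<omega> i \<in> {..<1 - \<rho>}}" for r
  define bad where "bad = out_of_range N \<union> (\<Union>r\<in>{..<T}. low r \<union> high r)"
  have I: "?I r \<subseteq> {..N}" "card (?I r) = m" if "r < T" for r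
  proof -
    have "Suc r * m \<le> N" using that unfolding N_def by (intro mult_le_mono1) simp
    then show "?I r \<subseteq> {..N}" by auto
    show "card (?I r) = m" by (simp add: card_image)
  qed
  have ev: "low r \<in> events" "high r \<in> events" if "r < T" for r
    unfolding low_def high_def by (rule sets_sample_all[OF I(1)[OF that]]; simp)+
  have bad_ev: "bad \<in> events" unfolding bad_def using ev out_of_range_null(1) by auto
  have "prob bad \<le> prob (out_of_range N) + prob (\<Union>r\<in>{..<T}. low r \<union> high r)"
    unfolding bad_def using ev out_of_range_null(1) by (intro measure_Un_le) auto
  also have "prob (\<Union>r\<in>{..<T}. low r \<union> high r) \<le> (\<Sum>r\<in>{..<T}. prob (low r \<union> high r))"
    using ev by (intro measure_UNION_le) auto
  also have "\<dots> \<le> (\<Sum>r\<in>{..<T}. 2 * (1 - \<rho>) ^ m)"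
  proof (rule sum_mono)
    fix r assume r: "r \<in> {..<T}"
    have "prob (low r) = (1 - \<rho>) ^ m"
      unfolding low_def using r I[of r] \<rho> prob_all_in[OF I(1), of r "{\<rho><..}"]
      by (simp only: measure_unif_Ioi greaterThan_borel lessThan_iff)
    moreover have "prob (high r) = (1 - \<rho>) ^ m"
    proof -
      have "measure unif {..<1 - \<rho>} = 1 - \<rho>" using \<rho> by (intro measure_unif_Iio) auto
      then show ?thesis
        unfolding high_def using r I[of r] prob_all_in[OF I(1), of r "{..<1 - \<rho>}"]
        by (simp only: lessThan_borel lessThan_iff)
    qed
    moreover have "prob (low r \<union> high r) \<le> prob (low r) + prob (high r)"
      using ev r by (intro measure_Un_le) auto
    ultimately show "prob (low r \<union> high r) \<le> 2 * (1 - \<rho>) ^ m" by linarith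
  qed
  also have "\<dots> \<le> \<delta>" using \<rho>(3) by simp
  finally have bad_prob: "prob bad \<le> \<delta>" using out_of_range_null(2) by simp
  have res: "rlist (sample_space N) (n div m) (\<lambda>\<omega>. results B m (X \<omega>) (n div m))"
    if "rlist (sample_space N) n X" for n X
    by (rule rlist_results[OF that meas(1)[folded N_def]]) simp
  have "valid_queries \<Delta> (\<lambda>_. q)"
    unfolding valid_queries_def q_def using request_valid[OF _ _ _ \<Delta>(2)] B by (metis prod.collapse)
  moreover have "1 - \<delta> \<le> success_prob D N (\<lambda>_. q) (\<lambda>_. p) (Goal D)" if CD: "Class D" for D
  proof (rule success_probI[OF Class(1)[OF CD] _ _ _ Class(2)[OF CD] bad_ev bad_prob])
    show "lmeas (sample_space N) n (\<lambda>h. fst (q h))" for n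
      unfolding lmeas_def
    proof (intro allI impI)
      fix X assume X: "rlist (sample_space N) n X"
      then have len: "length (X \<omega>) = n" for \<omega> by (simp add: rlist_def)
      note [measurable] = lmeasD[OF meas(1)[folded N_def] res[OF X]] lmeasD[OF meas(2)[folded N_def] res[OF X]]
      show "(\<lambda>\<omega>. fst (q (X \<omega>))) \<in> borel_measurable (sample_space N)"
        unfolding q_def request_def len if_distrib[of fst] fst_conv by measurable
    qed
    show "lmeas (sample_space N) n (\<lambda>h. snd (q h))" for n
      unfolding lmeas_def
    proof (intro allI impI)
      fix X assume X: "rlist (sample_space N) n X"
      then have len: "length (X \<omega>) = n" for \<omega> by (simp add: rlist_def)
      note [measurable] = lmeasD[OF meas(1)[folded N_def] res[OF X]] lmeasD[OF meas(2)[folded N_def] res[OF X]]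
      show "(\<lambda>\<omega>. snd (q (X \<omega>))) \<in> borel_measurable (sample_space N)"
        unfolding q_def request_def len if_distrib[of snd] snd_conv by measurable
    qed
    show "lmeas (sample_space N) N p"
      unfolding lmeas_def
    proof (intro allI impI)
      fix X assume X: "rlist (sample_space N) N X"
      have R: "rlist (sample_space N) T (\<lambda>\<omega>. results B m (X \<omega>) T)"
        by (rule rlist_results[OF X meas(1)[folded N_def]]) (simp add: N_def)
      show "(\<lambda>\<omega>. p (X \<omega>)) \<in> borel_measurable (sample_space N)"
        unfolding p_def Let_def
      proof (intro conjunct2[OF best_measurable])
        fix r assume r: "r < T"
        show "(\<lambda>\<omega>. fst (B (take r (results B m (X \<omega>) T)))) \<in> borel_measurable (sample_space N)"
          using r by (intro lmeasD[OF meas(1)[folded N_def] rlist_take[OF R]]) simp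
        show "(\<lambda>\<omega>. results B m (X \<omega>) T ! r) \<in> borel_measurable (sample_space N)"
          by (rule rlist_nth[OF R r])
      qed
    qed
    fix \<omega> assume \<omega>: "\<omega> \<in> space (sample_space N)" "\<omega> \<notin> bad"
    define h where "h = hist D (\<lambda>_. q) \<omega> N"
    define xs where "xs = results B m h T"
    have u: "0 < \<omega> (Suc i) \<and> \<omega> (Suc i) \<le> 1" if "i < N" for i
      using \<omega> that by (auto simp: bad_def out_of_range_def)
    have br: "brackets D (B (take r xs)) (xs ! r)" if r: "r < T" for r
    proof -
      have tk: "take r xs = results B m h r" using r by (simp add: xs_def take_results)
      have x: "xs ! r = extreme (B (take r xs)) ((\<lambda>i. h ! i) ` {r * m..<Suc r * m})"
        unfolding tk using r by (simp add: xs_def results_nth)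
      have rm: "Suc r * m \<le> N" using r unfolding N_def by (intro mult_le_mono1) simp
      have y: "h ! i = val_at D (fst (request \<Delta> (B (take r xs)))
         + (snd (request \<Delta> (B (take r xs))) - fst (request \<Delta> (B (take r xs)))) * \<omega> (Suc i))"
        if i: "i \<in> {r * m..<Suc r * m}" for i
      proof -
        have "i < N" using i rm by auto
        have "i div m = r" using i by (intro div_nat_eqI) (auto simp: mult.commute)
        moreover have "hist D (\<lambda>_. q) \<omega> i = take i h" using \<open>i < N\<close> by (simp add: h_def take_hist)
        ultimately have "q (hist D (\<lambda>_. q) \<omega> i) = request \<Delta> (B (take r xs))"
          unfolding q_def tk using i \<open>i < N\<close> by (simp add: results_take h_def)
        then show ?thesis using hist_nth[OF \<open>i < N\<close>, of D q \<omega>] by (simp add: h_def)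
      qed
      have hits: "\<exists>i\<in>{r * m..<Suc r * m}. \<omega> (Suc i) \<le> \<rho>" "\<exists>i\<in>{r * m..<Suc r * m}. 1 - \<rho> \<le> \<omega> (Suc i)"
        using \<omega> r unfolding bad_def low_def high_def
        by (auto simp: not_less simp del: image_Suc_atLeastLessThan)
      obtain lo hi where lohi: "B (take r xs) = (lo, hi)" by (rule prod.exhaust)
      show ?thesis unfolding x unfolding lohi
      proof (rule extreme_brackets[OF Class(1)[OF CD] _ _ _ \<Delta> \<rho>(1,2)])
        show "0 < lo" "lo < hi" "hi \<le> 1" "\<rho> * \<Delta> \<le> hi - lo" using B[of "take r xs"] lohi by auto
        show "0 < \<omega> (Suc i) \<and> \<omega> (Suc i) \<le> 1" if "i \<in> {r * m..<Suc r * m}" for i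
          using that rm by (intro u) auto
      qed (use hits y lohi in simp_all)
    qed
    have "Goal D (p h)"
    proof (rule Goal[OF CD _ br])
      show "length xs = T" by (simp add: xs_def)
      fix r assume r: "r < T"
      have pos: "0 \<le> xs ! r" if "r < T" for r
        using br[OF that] val_at_nonneg[OF Class(1)[OF CD]] unfolding brackets_def by auto
      have "fst (B (take r xs)) * xs ! r \<le> fst (best (\<lambda>r. fst (B (take r xs))) (\<lambda>r. xs ! r) T)"
        using best_upper[OF r, of "\<lambda>r. fst (B (take r xs))" "\<lambda>r. xs ! r"] .
      also have "\<dots> \<le> rev D (p h)"
        unfolding p_def Let_def xs_def[symmetric]
        by (rule best_rev) (use br pos in \<open>auto simp: brackets_def\<close>)
      finally show "fst (B (take r xs)) * xs ! r \<le> rev D (p h)" .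
    qed
    then show "Goal D (p (hist D (\<lambda>_. q) \<omega> N))" by (simp add: h_def)
  qed
  ultimately show ?thesis unfolding learns_def N_def by blast
qed

subsection \<open>Regular and MHR distributions\<close>

text \<open>A substitute for differentiation: over \<open>n\<close> equal pieces the increments add
  up to at most \<open>K * (b - a)\<^sup>2 / n\<close>, which tends to 0. The density is merely
  measurable, so the functions compared later need not be differentiable everywhere.\<close>

lemma nonincreasing_if_quadratic_increments:
  fixes h :: "real \<Rightarrow> real"
  assumes "a \<le> b" and inc: "\<And>v w. a \<le> v \<Longrightarrow> v \<le> w \<Longrightarrow> w \<le> b \<Longrightarrow> h w - h v \<le> K * (w - v)\<^sup>2"
  shows "h b \<le> h a"
proof (rule ccontr)
  assume "\<not> h b \<le> h a"
  then have d: "0 < h b - h a" by simp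
  obtain n0 :: nat where "K * (b - a)\<^sup>2 / (h b - h a) < real n0" using reals_Archimedean2 by blast
  then have n0: "K * (b - a)\<^sup>2 < real (Suc n0) * (h b - h a)"
    using d by (simp add: pos_divide_less_eq algebra_simps)
  define n where "n = Suc n0"
  define t where "t i = a + real i * ((b - a) / real n)" for i
  have n: "0 < real n" by (simp add: n_def)
  have tn: "t n = b" "t 0 = a" using n by (auto simp: t_def)
  have step: "t (Suc i) - t i = (b - a) / real n" for i
    by (simp add: t_def algebra_simps add_divide_distrib diff_divide_distrib)
  have "h b - h a = (\<Sum>i<n. h (t (Suc i)) - h (t i))"
    using sum_lessThan_telescope[of "\<lambda>i. h (t i)" n] tn by simp
  also have "\<dots> \<le> (\<Sum>i<n. K * ((b - a) / real n)\<^sup>2)"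
  proof (rule sum_mono)
    fix i assume i: "i \<in> {..<n}"
    have nn: "0 \<le> (b - a) / real n" using \<open>a \<le> b\<close> by simp
    have "real (Suc i) * ((b - a) / real n) \<le> real n * ((b - a) / real n)"
      using i by (intro mult_right_mono[OF _ nn]) simp
    then have "t (Suc i) \<le> b" using n by (simp add: t_def)
    moreover have "a \<le> t i" using mult_nonneg_nonneg[OF of_nat_0_le_iff nn, of i] by (simp add: t_def)
    moreover have "t i \<le> t (Suc i)" using step[of i] nn by linarith
    ultimately show "h (t (Suc i)) - h (t i) \<le> K * ((b - a) / real n)\<^sup>2"
      using inc[of "t i" "t (Suc i)"] by (simp only: step)
  qed
  also have "\<dots> = K * (b - a)\<^sup>2 / real n"
    using n by (simp add: power2_eq_square)
  finally have "real n * (h b - h a) \<le> K * (b - a)\<^sup>2"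
    using n by (simp add: pos_le_divide_eq mult.commute)
  then show False using n0 by (simp add: n_def)
qed

section \<open>Distributions with a density that is positive on an interval\<close>

locale positive_density =
  fixes D :: "real measure" and f :: "real \<Rightarrow> real" and S :: "real set"
  assumes vd: "value_dist D"
    and S: "is_interval S" and f [measurable]: "f \<in> borel_measurable borel"
    and f_pos: "\<And>x. x \<in> S \<Longrightarrow> 0 < f x" and f_zero: "\<And>x. x \<notin> S \<Longrightarrow> f x = 0"
    and D: "D = density lborel (\<lambda>x. ennreal (f x))"
begin

sublocale prob_space D using value_distD(1)[OF vd] .

lemma f_nonneg: "0 \<le> f x"
  using f_pos[of x] f_zero[of x] by (cases "x \<in> S") auto

lemma emeasure_D: "A \<in> sets borel \<Longrightarrow> emeasure D A = (\<integral>\<^sup>+x. ennreal (f x) * indicator A x \<partial>lborel)"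
  unfolding D by (rule emeasure_density) auto

lemma measure_singleton: "measure D {x} = 0"
proof -
  have "emeasure D {x} = 0"
    unfolding emeasure_D[OF borel_singleton[OF sets.empty_sets]] by (intro nn_integral_null_set) (simp add: null_sets_def)
  then show ?thesis by (simp add: measure_def)
qed

lemma sets_D [simp]: "sets D = sets borel" "space D = UNIV"
  using value_distD[OF vd] by auto

lemma measure_greaterThan: "measure D {v<..} = quant D v"
proof -
  have "measure D ({v} \<union> {v<..}) = measure D {v} + measure D {v<..}"
    by (rule finite_measure_Union) auto
  moreover have "{v} \<union> {v<..} = {x. v \<le> x}" by auto
  ultimately show ?thesis by (simp add: quant_def measure_singleton)
qed

lemma quant_diff:
  assumes "v \<le> w" shows "quant D v - quant D w = measure D {v<..w}"
proof -
  have "measure D ({v<..w} \<union> {w<..}) = measure D {v<..w} + measure D {w<..}"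
    by (rule finite_measure_Union) auto
  moreover have "{v<..w} \<union> {w<..} = {v<..}" using assms by auto
  ultimately show ?thesis by (simp add: measure_greaterThan)
qed

lemma quant_diff_le:
  assumes "v \<le> w" "0 \<le> K" "\<And>t. v < t \<Longrightarrow> t \<le> w \<Longrightarrow> f t \<le> K"
  shows "quant D v - quant D w \<le> K * (w - v)"
proof -
  have "emeasure D {v<..w} \<le> (\<integral>\<^sup>+x. ennreal K * indicator {v<..w} x \<partial>lborel)"
    unfolding emeasure_D[OF greaterThanAtMost_borel]
    using assms by (intro nn_integral_mono) (auto simp: indicator_def intro!: ennreal_leI)
  also have "\<dots> = ennreal (K * (w - v))"
    using assms by (simp add: nn_integral_cmult_indicator ennreal_mult)
  finally show ?thesis
    using assms by (simp add: quant_diff emeasure_eq_measure)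
qed

lemma quant_diff_ge:
  assumes "v \<le> w" "0 \<le> K" "\<And>t. v < t \<Longrightarrow> t \<le> w \<Longrightarrow> K \<le> f t"
  shows "K * (w - v) \<le> quant D v - quant D w"
proof -
  have "ennreal (K * (w - v)) = (\<integral>\<^sup>+x. ennreal K * indicator {v<..w} x \<partial>lborel)"
    using assms by (simp add: nn_integral_cmult_indicator ennreal_mult)
  also have "\<dots> \<le> emeasure D {v<..w}"
    unfolding emeasure_D[OF greaterThanAtMost_borel]
    using assms by (intro nn_integral_mono) (auto simp: indicator_def intro!: ennreal_leI)
  finally show ?thesis
    using assms by (simp add: quant_diff emeasure_eq_measure)
qed

lemma quant_cont: "isCont (quant D) v"
proof -
  interpret finite_borel_measure D by standard simp
  have "quant D = (\<lambda>v. 1 - cdf D v)"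
  proof
    fix v
    have "measure D (UNIV - {..v}) = 1 - measure D {..v}" using prob_compl[of "{..v}"] by simp
    moreover have "UNIV - {..v} = {v<..}" by auto
    ultimately show "quant D v = 1 - cdf D v" by (simp add: cdf_def measure_greaterThan)
  qed
  moreover have "isCont (cdf D) v" by (simp add: isCont_cdf measure_singleton)
  ultimately show ?thesis by simp
qed

text \<open>Without atoms the tail is continuous and attains every level in \<open>(0,1]\<close> at
  some nonnegative price, which excludes the strict inequality.\<close>

lemma quant_val_at_eq:
  assumes "0 < u" "u \<le> 1" shows "quant D (val_at D u) = u"
proof -
  obtain w where w: "0 \<le> w" "quant D w < u" using quant_below[OF vd assms(1)] by auto
  have "\<exists>v\<ge>0. v \<le> w \<and> quant D v = u"
    using w assms quant_eq_1[OF vd, of 0] quant_cont by (intro IVT2) auto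
  then obtain v where v: "0 \<le> v" "quant D v = u" by auto
  then have "v \<le> val_at D u" using assms by (intro le_val_at[OF vd]) auto
  then have "quant D (val_at D u) \<le> u" using quant_antimono[OF vd, of v] v by auto
  then show ?thesis using quant_val_at[OF vd assms] by simp
qed

lemma measure_off_support:
  assumes "A \<in> sets borel" "A \<inter> S = {}" shows "measure D A = 0"
proof -
  have "emeasure D A = (\<integral>\<^sup>+(x::real). 0 \<partial>lborel)"
    unfolding emeasure_D[OF assms(1)]
  proof (rule nn_integral_cong)
    fix x show "ennreal (f x) * indicator A x = 0"
      using assms(2) f_zero[of x] by (cases "x \<in> S") (auto simp: indicator_def)
  qed
  then show ?thesis by (simp add: measure_def)
qed

text \<open>There is mass on both sides of \<open>v\<close>, hence points of the interval
  \<open>S\<close> on both sides. So virtual values at such prices divide by a positive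
  density.\<close>

lemma interior_in_S:
  assumes "0 < quant D v" "quant D v < 1" shows "v \<in> S"
proof -
  have "{..v} \<inter> S \<noteq> {}"
  proof
    assume "{..v} \<inter> S = {}"
    then have "measure D {..v} = 0" by (intro measure_off_support) auto
    then have "measure D {v<..} = 1"
      using prob_compl[of "{..v}"] by (simp add: Compl_eq_Diff_UNIV[symmetric] Compl_atMost)
    then show False using assms(2) by (simp add: measure_greaterThan)
  qed
  moreover have "{v..} \<inter> S \<noteq> {}"
  proof
    assume "{v..} \<inter> S = {}"
    then have "measure D {v..} = 0" by (intro measure_off_support) auto
    then show False using assms(1) by (simp add: quant_def atLeast_def)
  qed
  ultimately obtain a b where "a \<in> S" "b \<in> S" "a \<le> v" "v \<le> b" by auto
  then show ?thesis using mem_is_interval_1_I[OF S] by blast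
qed

end

locale regular_density = positive_density +
  assumes mono: "mono_on S (\<lambda>v. v - measure D {v<..} / f v)"
begin

text \<open>The revenue curve, as a function of the quantile, has at \<open>v0\<close> the virtual value as a
  supergradient. Writing \<open>c\<close> for it, the claim is that \<open>(v - c) * quant D v\<close> peaks at \<open>v0\<close>: beyond
  \<open>v0\<close> monotonicity gives \<open>(t - c) * f t \<ge> quant D t\<close>, before \<open>v0\<close> the reverse.\<close>
lemma supergradient:
  assumes v0: "0 < quant D v0" "quant D v0 < 1" and c: "c = v0 - quant D v0 / f v0" and "0 \<le> p"
  shows "rev D p \<le> rev D v0 + c * (quant D p - quant D v0)"
proof -
  let ?G = "quant D"
  define h where "h v = (v - c) * ?G v" for v
  have v0S: "v0 \<in> S" using v0 by (rule interior_in_S)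
  have cv0: "c < v0" using f_pos[OF v0S] v0 by (simp add: c)
  note G0 = quant_nonneg[of D]
  have G1: "?G v \<le> 1" for v by (rule quant_le_1[OF vd])
  have ph: "x - ?G x / f x \<le> y - ?G y / f y" if "x \<in> S" "y \<in> S" "x \<le> y" for x y
    using mono_onD[OF mono that] by (simp add: measure_greaterThan)
  have "h p \<le> h v0"
  proof (cases "v0 \<le> p")
    case True
    show ?thesis
    \<comment> \<open>If \<open>?G p\<close> is positive, all of \<open>[v0, p]\<close> lies in
      \<open>S\<close> and has virtual values; if it is 0, the claim reduces to
      \<open>0 \<le> h v0\<close>.\<close>
    proof (cases "?G p = 0")
      case True
      then show ?thesis using cv0 by (simp add: h_def)
    next
      case False
      then have "0 < ?G p" using G0[of p] by linarith
      then have pS: "p \<in> S"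
        using quant_antimono[OF vd \<open>v0 \<le> p\<close>] v0 by (intro interior_in_S) auto
      show ?thesis
      proof (rule nonincreasing_if_quadratic_increments[OF \<open>v0 \<le> p\<close>, where K = "1 / (v0 - c)"])
        fix v w assume vw: "v0 \<le> v" "v \<le> w" "w \<le> p"
        \<comment> \<open>A constant lower bound for the density on \<open>(v, w]\<close>. Using it
          in place of the density leaves only the second-order term
          \<open>?K * (w - v)\<^sup>2\<close>.\<close>
        let ?K = "?G w / (w - c)"
        have wc: "0 < w - c" "v0 - c \<le> w - c" "0 < v0 - c" using vw cv0 by auto
        have "?K \<le> f t" if t: "v < t" "t \<le> w" for t
        proof -
          have tS: "t \<in> S" using mem_is_interval_1_I[OF S v0S pS] t vw by auto
          have "c \<le> t - ?G t / f t" using ph[OF v0S tS] t vw by (simp add: c)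
          then have "?G t \<le> (t - c) * f t" using f_pos[OF tS] by (simp add: field_simps)
          moreover have "?G w \<le> ?G t" using t by (intro quant_antimono[OF vd])
          moreover have "(t - c) * f t \<le> (w - c) * f t"
            using t f_nonneg[of t] by (intro mult_right_mono) auto
          ultimately show ?thesis using wc by (simp add: pos_divide_le_eq mult.commute)
        qed
        then have "?K * (w - v) \<le> ?G v - ?G w"
          using vw wc G0[of w] by (intro quant_diff_ge) auto
        then have "?G w + ?K * (w - v) \<le> ?G v" by simp
        then have "(v - c) * (?G w + ?K * (w - v)) \<le> h v"
          unfolding h_def using vw cv0 by (intro mult_left_mono) auto
        moreover have "h w - (v - c) * (?G w + ?K * (w - v)) = ?K * (w - v)\<^sup>2"
          using wc by (simp add: h_def power2_eq_square field_simps)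
        moreover have "?K * (w - v)\<^sup>2 \<le> 1 / (v0 - c) * (w - v)\<^sup>2"
          using wc G1[of w] G0[of w] by (intro mult_right_mono frac_le) auto
        ultimately show "h w - h v \<le> 1 / (v0 - c) * (w - v)\<^sup>2" by linarith
      qed
    qed
  next
    case False
    show ?thesis
    \<comment> \<open>Up to \<open>c\<close> the factor \<open>v - c\<close> is not positive and
      signs decide. Above \<open>c\<close> the distance \<open>p - c\<close> bounds that factor from
      below and controls the constant \<open>K\<close>.\<close>
    proof (cases "p \<le> c")
      case True
      then have "h p \<le> 0" using G0[of p] by (simp add: h_def mult_nonpos_nonneg)
      also have "0 \<le> h v0" using cv0 G0[of v0] by (simp add: h_def)
      finally show ?thesis .
    next
      case pc: False
      have "- h v0 \<le> - h p"
      proof (rule nonincreasing_if_quadratic_increments[where h = "\<lambda>v. - h v" and K = "1 / (p - c)"])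
        fix v w assume vw: "p \<le> v" "v \<le> w" "w \<le> v0"
        let ?K = "?G v / (v - c)"
        have vc: "0 < v - c" "p - c \<le> v - c" "0 < p - c" using vw pc by auto
        have "f t \<le> ?K" if t: "v < t" "t \<le> w" for t
        proof (cases "t \<in> S")
          case True
          have "t - ?G t / f t \<le> c" using ph[OF True v0S] t vw by (simp add: c)
          then have "(t - c) * f t \<le> ?G t" using f_pos[OF True] by (simp add: field_simps)
          moreover have "?G t \<le> ?G v" using t by (intro quant_antimono[OF vd]) auto
          moreover have "(v - c) * f t \<le> (t - c) * f t"
            using t f_nonneg[of t] by (intro mult_right_mono) auto
          ultimately show ?thesis using vc by (simp add: pos_le_divide_eq mult.commute)
        next
          case False
          then show ?thesis using f_zero[OF False] vc G0[of v] by simp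
        qed
        then have "?G v - ?G w \<le> ?K * (w - v)"
          using vw vc G0[of v] by (intro quant_diff_le) auto
        then have "?G v - ?K * (w - v) \<le> ?G w" by simp
        then have "(w - c) * (?G v - ?K * (w - v)) \<le> h w"
          unfolding h_def using vw vc by (intro mult_left_mono) auto
        moreover have "(w - c) * (?G v - ?K * (w - v)) - h v = - (?K * (w - v)\<^sup>2)"
          using vc by (simp add: h_def power2_eq_square field_simps)
        moreover have "?K * (w - v)\<^sup>2 \<le> 1 / (p - c) * (w - v)\<^sup>2"
          using vc G1[of v] G0[of v] by (intro mult_right_mono frac_le) auto
        ultimately show "- h w - - h v \<le> 1 / (p - c) * (w - v)\<^sup>2" by linarith
      qed (use False in simp)
      then show ?thesis by simp
    qed
  qed
  then show ?thesis by (simp add: h_def rev_def algebra_simps)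
qed

end

section \<open>Monotone hazard rates\<close>

locale mhr_density = positive_density +
  assumes hazard_mono: "mono_on {v\<in>S. 0 < measure D {v<..}} (\<lambda>v. f v / measure D {v<..})"
begin

lemma hazard_le:
  assumes "x \<in> S" "y \<in> S" "x \<le> y" "0 < quant D y"
  shows "f x / quant D x \<le> f y / quant D y"
proof -
  have "0 < quant D x" using quant_antimono[OF vd assms(3)] assms(4) by linarith
  then show ?thesis
    using mono_onD[OF hazard_mono, of x y] assms by (simp add: measure_greaterThan)
qed

text \<open>The reciprocal of the hazard rate decreases, so the virtual value increases. A point of
  \<open>S\<close> with tail 0 is treated apart: hazard rates are compared only where the tail is
  positive, and there the virtual value is the point itself.\<close>

sublocale regular_density
proof
  show "mono_on S (\<lambda>v. v - measure D {v<..} / f v)"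
  proof (rule mono_onI, unfold measure_greaterThan)
    fix x y assume xy: "x \<in> S" "y \<in> S" "x \<le> y"
    note pos = f_pos[OF xy(1)] f_pos[OF xy(2)]
    show "x - quant D x / f x \<le> y - quant D y / f y"
    proof (cases "0 < quant D y")
      case True
      then have x: "0 < quant D x" using quant_antimono[OF vd xy(3)] by linarith
      have "quant D y / f y \<le> quant D x / f x"
        using hazard_le[OF xy True] True x pos by (simp add: field_simps)
      then show ?thesis using xy by linarith
    next
      case False
      then have "quant D y = 0" using quant_nonneg[of D y] by linarith
      moreover have "0 \<le> quant D x / f x" using pos by simp
      ultimately show ?thesis using xy by simp
    qed
  qed
qed

text \<open>Let \<open>k\<close> be the hazard rate at \<open>y\<close>. The density is at most
  \<open>k\<close> up to the median \<open>x\<close> and at most \<open>k / 2\<close> from there to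
  \<open>y\<close>, so the drops of the tail by 1/2 and by 1/4 each contribute 1/2 to
  \<open>1 \<le> k * y\<close>. The two steps replace the integral of the hazard rate. A nonnegative
  slope at quantile 1/4 is what permits the floor \<open>1/4\<close> for MHR values.\<close>

lemma virtual_value_quarter:
  "quant D (val_at D (1 / 4)) / f (val_at D (1 / 4)) \<le> val_at D (1 / 4)"
proof -
  define x where "x = val_at D (1 / 2)"
  define y where "y = val_at D (1 / 4)"
  have q: "quant D x = 1 / 2" "quant D y = 1 / 4" by (simp_all add: x_def y_def quant_val_at_eq)
  have xy: "0 \<le> x" "x \<le> y"
    unfolding x_def y_def by (auto intro: val_at_nonneg[OF vd] val_at_antimono[OF vd])
  have yS: "y \<in> S" using q by (intro interior_in_S) auto
  define k where "k = f y / quant D y"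
  have k: "0 < k" using f_pos[OF yS] q by (simp add: k_def)
  have fk: "f t \<le> k * quant D t" if "t \<le> y" for t
  proof (cases "t \<in> S")
    case True
    have "0 < quant D t" using quant_antimono[OF vd that] q by linarith
    moreover have "f t / quant D t \<le> k" unfolding k_def using q by (intro hazard_le[OF True yS that]) simp
    ultimately show ?thesis by (simp add: pos_divide_le_eq)
  next
    case False then show ?thesis using f_zero k by simp
  qed
  have "quant D 0 - quant D x \<le> k * (x - 0)"
  proof (rule quant_diff_le)
    fix t assume t: "0 < t" "t \<le> x"
    then have "f t \<le> k * quant D t" using xy by (intro fk) auto
    also have "\<dots> \<le> k * 1" using k quant_le_1[OF vd, of t] by (intro mult_left_mono) auto
    finally show "f t \<le> k" by simp
  qed (use xy k in auto)
  moreover have "quant D x - quant D y \<le> k / 2 * (y - x)"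
  proof (rule quant_diff_le)
    fix t assume t: "x < t" "t \<le> y"
    then have "f t \<le> k * quant D t" by (intro fk) auto
    also have "\<dots> \<le> k * (1 / 2)"
      using k quant_antimono[OF vd, of x t] t q by (intro mult_left_mono) auto
    finally show "f t \<le> k / 2" by simp
  qed (use xy k in auto)
  ultimately have "1 \<le> k * y" using q quant_eq_1[OF vd, of 0] by (simp add: field_simps)
  then show ?thesis using k f_pos[OF yS] q unfolding y_def[symmetric] k_def by (simp add: field_simps)
qed

end

text \<open>What the learners need from regularity. The slope \<open>c\<close> stands for a virtual
  value and hence does not exceed the value itself. \<open>q0\<close> is a floor for quantiles: no
  price selling less often beats the price at \<open>q0\<close> by more than the factor
  \<open>1 / (1 - \<eta>)\<close>.\<close>

definition concave_revenue :: "real \<Rightarrow> real \<Rightarrow> real measure \<Rightarrow> bool" where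
  "concave_revenue q0 \<eta> D \<longleftrightarrow> value_dist D
     \<and> (\<forall>u. 0 < u \<longrightarrow> u \<le> 1 \<longrightarrow> quant D (val_at D u) = u)
     \<and> (\<forall>u. 0 < u \<longrightarrow> u < 1 \<longrightarrow> (\<exists>c\<le>val_at D u. \<forall>p\<ge>0.
           rev D p \<le> rev D (val_at D u) + c * (quant D p - u)))
     \<and> (\<forall>p\<ge>0. quant D p < q0 \<longrightarrow> (1 - \<eta>) * rev D p \<le> rev D (val_at D q0))"

lemma rev_nonneg: "0 \<le> p \<Longrightarrow> 0 \<le> rev D p"
  by (simp add: rev_def)

lemma (in regular_density) supergradient_val_at:
  assumes u: "0 < u" "u < 1" and "0 \<le> p"
  shows "rev D p \<le> rev D (val_at D u) + (val_at D u - u / f (val_at D u)) * (quant D p - u)"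
  using supergradient[of "val_at D u" _ p] quant_val_at_eq[of u] assms by simp

lemma (in regular_density) concave_revenueI:
  assumes "\<And>p. 0 \<le> p \<Longrightarrow> quant D p < q0 \<Longrightarrow> (1 - \<eta>) * rev D p \<le> rev D (val_at D q0)"
  shows "concave_revenue q0 \<eta> D"
proof -
  have "\<exists>c\<le>val_at D u. \<forall>p\<ge>0. rev D p \<le> rev D (val_at D u) + c * (quant D p - u)"
    if u: "0 < u" "u < 1" for u
    using supergradient_val_at[OF u] f_nonneg u
    by (intro exI[of _ "val_at D u - u / f (val_at D u)"]) auto
  then show ?thesis
    unfolding concave_revenue_def using vd quant_val_at_eq assms by auto
qed

text \<open>If the slope at quantile \<open>\<eta>\<close> is negative, the supergradient inequality
  at price 0, which has quantile 1 and revenue 0, limits its size to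
  \<open>R / (1 - \<eta>)\<close>. Going down from \<open>\<eta>\<close> by at most
  \<open>\<eta>\<close> then gains at most \<open>\<eta> * R / (1 - \<eta>)\<close>.\<close>

lemma regular_concave_revenue:
  assumes "regular_dist D" and \<eta>: "0 < \<eta>" "\<eta> < 1"
  shows "concave_revenue \<eta> \<eta> D"
proof -
  obtain f S where *: "value_dist D" "is_interval S" "f \<in> borel_measurable borel"
      "\<And>x. x \<in> S \<Longrightarrow> 0 < f x" "\<And>x. x \<notin> S \<Longrightarrow> f x = 0"
      "D = density lborel (\<lambda>x. ennreal (f x))"
      and mono: "mono_on S (\<lambda>v. v - measure D {v<..} / f v)"
    using assms(1) unfolding regular_dist_def by blast
  interpret regular_density D f S
    by (intro regular_density.intro positive_density.intro regular_density_axioms.intro) (fact * mono)+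
  show ?thesis
  proof (rule concave_revenueI)
    fix p assume p: "0 \<le> p" "quant D p < \<eta>"
    define R where "R = rev D (val_at D \<eta>)"
    define c where "c = val_at D \<eta> - \<eta> / f (val_at D \<eta>)"
    have sg: "rev D x \<le> R + c * (quant D x - \<eta>)" if "0 \<le> x" for x
      unfolding R_def c_def by (rule supergradient_val_at[OF \<eta> that])
    have R: "0 \<le> R" unfolding R_def using \<eta> by (intro rev_nonneg val_at_nonneg[OF vd]) auto
    show "(1 - \<eta>) * rev D p \<le> rev D (val_at D \<eta>)"
    proof (cases "0 \<le> c")
      case True
      then have "rev D p \<le> R"
        using sg[OF p(1)] mult_nonneg_nonpos[of c "quant D p - \<eta>"] p by linarith
      moreover have "(1 - \<eta>) * rev D p \<le> 1 * rev D p"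
        using rev_nonneg[OF p(1)] \<eta> by (intro mult_right_mono) auto
      ultimately show ?thesis by (simp add: R_def)
    next
      case False
      have "- c * (1 - \<eta>) \<le> R"
        using sg[of 0] quant_eq_1[OF vd, of 0] by (simp add: rev_def)
      then have 1: "\<eta> * (- c * (1 - \<eta>)) \<le> \<eta> * R" using \<eta> by (intro mult_left_mono) auto
      have "- c * (\<eta> - quant D p) \<le> - c * \<eta>"
        using False by (intro mult_left_mono) auto
      then have "rev D p \<le> R + - c * \<eta>" using sg[OF p(1)] by (simp add: algebra_simps)
      then have "(1 - \<eta>) * rev D p \<le> (1 - \<eta>) * (R + - c * \<eta>)"
        using \<eta> by (intro mult_left_mono) auto
      then show ?thesis using 1 by (simp add: R_def algebra_simps)
    qed
  qed
qed

text \<open>The slope at quantile 1/4 is the virtual value there, which is nonnegative, so smaller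
  quantiles earn no more.\<close>

lemma mhr_concave_revenue:
  assumes "mhr_dist D" and \<eta>: "0 \<le> \<eta>"
  shows "concave_revenue (1 / 4) \<eta> D"
proof -
  obtain f S where *: "value_dist D" "is_interval S" "f \<in> borel_measurable borel"
      "\<And>x. x \<in> S \<Longrightarrow> 0 < f x" "\<And>x. x \<notin> S \<Longrightarrow> f x = 0"
      "D = density lborel (\<lambda>x. ennreal (f x))"
      and mono: "mono_on {v\<in>S. 0 < measure D {v<..}} (\<lambda>v. f v / measure D {v<..})"
    using assms(1) unfolding mhr_dist_def by blast
  interpret mhr_density D f S
    by (intro mhr_density.intro positive_density.intro mhr_density_axioms.intro) (fact * mono)+
  show ?thesis
  proof (rule concave_revenueI)
    fix p assume p: "0 \<le> p" "quant D p < 1 / 4"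
    let ?v = "val_at D (1 / 4)"
    have "0 \<le> ?v - 1 / 4 / f ?v"
      using virtual_value_quarter quant_val_at_eq[of "1 / 4"] by simp
    then have "(?v - 1 / 4 / f ?v) * (quant D p - 1 / 4) \<le> 0"
      using p by (intro mult_nonneg_nonpos) auto
    then have "rev D p \<le> rev D ?v" using supergradient_val_at[of "1 / 4" p] p by simp
    moreover have "(1 - \<eta>) * rev D p \<le> 1 * rev D p"
      using rev_nonneg[OF p(1)] \<eta> by (intro mult_right_mono) auto
    ultimately show "(1 - \<eta>) * rev D p \<le> rev D ?v" by simp
  qed
qed

subsection \<open>Noisy ternary search\<close>

text \<open>Round \<open>r\<close> owns the results with indices \<open>3 * r\<close> (left end of the window, needed only once the
  window is too short for its thirds to be told apart), \<open>3 * r + 1\<close> and \<open>3 * r + 2\<close> (the thirds).\<close>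

primrec window :: "real \<Rightarrow> real list \<Rightarrow> nat \<Rightarrow> real \<times> real" where
  "window q0 xs 0 = (q0, 1)"
| "window q0 xs (Suc r) =
    (if (fst (window q0 xs r) + 2 * (snd (window q0 xs r) - fst (window q0 xs r)) / 3) * xs ! (3 * r + 2)
       \<le> (fst (window q0 xs r) + (snd (window q0 xs r) - fst (window q0 xs r)) / 3) * xs ! (3 * r + 1)
     then (fst (window q0 xs r), fst (window q0 xs r) + 2 * (snd (window q0 xs r) - fst (window q0 xs r)) / 3)
     else (fst (window q0 xs r) + (snd (window q0 xs r) - fst (window q0 xs r)) / 3, snd (window q0 xs r)))"

definition probe_point :: "real \<Rightarrow> real list \<Rightarrow> nat \<Rightarrow> real" where
  "probe_point q0 xs n = fst (window q0 xs (n div 3)) +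
     real (n mod 3) * (snd (window q0 xs (n div 3)) - fst (window q0 xs (n div 3))) / 3"

text \<open>The width is relative to the probe point, so the guarantee loses the same factor
  \<open>1 - \<eta>\<close> wherever the probe lies.\<close>

definition probe :: "real \<Rightarrow> real \<Rightarrow> real list \<Rightarrow> real \<times> real" where
  "probe q0 \<eta> xs = ((1 - \<eta>) * probe_point q0 xs (length xs), probe_point q0 xs (length xs))"

lemma window_bounds:
  assumes "q0 \<le> 1"
  shows "q0 \<le> fst (window q0 xs r) \<and> snd (window q0 xs r) \<le> 1 \<and>
    snd (window q0 xs r) - fst (window q0 xs r) = (2 / 3) ^ r * (1 - q0)"
proof (induction r)
  case (Suc r)
  let ?l = "fst (window q0 xs r)" and ?h = "snd (window q0 xs r)"
  define d where "d = ?h - ?l"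
  have "0 \<le> (2 / 3) ^ r * (1 - q0)" using assms by simp
  then have d: "q0 \<le> ?l" "?h \<le> 1" "0 \<le> d" "?h = ?l + d" using Suc by (auto simp: d_def)
  have d': "(2 / 3) ^ Suc r * (1 - q0) = 2 * d / 3" using Suc by (simp add: d_def)
  have "q0 \<le> ?l + d / 3" "?l + 2 * d / 3 \<le> 1"
    "?l + 2 * d / 3 - ?l = (2 / 3) ^ Suc r * (1 - q0)" "?h - (?l + d / 3) = (2 / 3) ^ Suc r * (1 - q0)"
    unfolding d' using d by linarith+
  then show ?case using d(1,2) by (auto simp only: window.simps fst_conv snd_conv d_def split: if_split)
qed (use assms in simp)

text \<open>The window of round \<open>r\<close> is decided by results with indices below
  \<open>3 * r\<close>, so the adaptive choice from a prefix can be analysed on the complete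
  list.\<close>

lemma window_take: "3 * r \<le> n \<Longrightarrow> window q0 (take n xs) r = window q0 xs r"
  by (induction r) simp_all

lemma probe_take:
  assumes "n < length xs"
  shows "probe q0 \<eta> (take n xs) = ((1 - \<eta>) * probe_point q0 xs n, probe_point q0 xs n)"
  using assms by (simp add: probe_def probe_point_def window_take)

lemma probe_point_bounds:
  assumes "q0 \<le> 1" shows "q0 \<le> probe_point q0 xs n" "probe_point q0 xs n \<le> 1"
proof -
  let ?w = "window q0 xs (n div 3)"
  have b: "q0 \<le> fst ?w" "snd ?w \<le> 1" "0 \<le> snd ?w - fst ?w"
    using window_bounds[OF assms, of xs "n div 3"] assms by auto
  define d where "d = snd ?w - fst ?w"
  define t where "t = real (n mod 3) * d"
  have "t \<le> 3 * d" unfolding t_def using b by (intro mult_right_mono) (auto simp: d_def)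
  moreover have "0 \<le> t" unfolding t_def using b by (simp add: d_def)
  moreover have "probe_point q0 xs n = fst ?w + t / 3" "snd ?w = fst ?w + d"
    by (simp_all add: probe_point_def t_def d_def)
  ultimately show "q0 \<le> probe_point q0 xs n" "probe_point q0 xs n \<le> 1"
    using b by linarith+
qed

lemma window_measurable:
  assumes X: "rlist M n X" and "3 * r \<le> n"
  shows "(\<lambda>\<omega>. fst (window q0 (X \<omega>) r)) \<in> borel_measurable M \<and> (\<lambda>\<omega>. snd (window q0 (X \<omega>) r)) \<in> borel_measurable M"
  using \<open>3 * r \<le> n\<close>
proof (induction r)
  case (Suc r)
  then have [measurable]: "(\<lambda>\<omega>. fst (window q0 (X \<omega>) r)) \<in> borel_measurable M"
    "(\<lambda>\<omega>. snd (window q0 (X \<omega>) r)) \<in> borel_measurable M"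
    "(\<lambda>\<omega>. X \<omega> ! (3 * r + 1)) \<in> borel_measurable M" "(\<lambda>\<omega>. X \<omega> ! (3 * r + 2)) \<in> borel_measurable M"
    using rlist_nth[OF X, of "3 * r + 1"] rlist_nth[OF X, of "3 * r + 2"] by auto
  show ?case
    unfolding window.simps if_distrib[of fst] if_distrib[of snd] fst_conv snd_conv
    by (intro conjI) measurable
qed simp

lemma probe_measurable:
  "lmeas M n (\<lambda>xs. fst (probe q0 \<eta> xs))" "lmeas M n (\<lambda>xs. snd (probe q0 \<eta> xs))"
proof -
  have m: "(\<lambda>\<omega>. probe_point q0 (X \<omega>) (length (X \<omega>))) \<in> borel_measurable M" if X: "rlist M n X" for X
  proof -
    have len: "length (X \<omega>) = n" for \<omega> using X by (simp add: rlist_def)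
    have [measurable]: "(\<lambda>\<omega>. fst (window q0 (X \<omega>) (n div 3))) \<in> borel_measurable M"
      "(\<lambda>\<omega>. snd (window q0 (X \<omega>) (n div 3))) \<in> borel_measurable M"
      using window_measurable[OF X, of "n div 3" q0] by auto
    show ?thesis unfolding len probe_point_def by measurable
  qed
  show "lmeas M n (\<lambda>xs. fst (probe q0 \<eta> xs))" "lmeas M n (\<lambda>xs. snd (probe q0 \<eta> xs))"
    unfolding lmeas_def probe_def fst_conv snd_conv using m by auto
qed

text \<open>A supergradient \<open>c\<close> at \<open>u1\<close> bounds \<open>R2\<close> as well; as \<open>R2\<close> is almost \<open>R1\<close>, this limits the slope \<open>c\<close>
  in the direction away from \<open>u2\<close>.\<close>
lemma flat_supergradient:
  fixes R R1 R2 c u1 u2 q \<eta> :: real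
  assumes "R \<le> R1 + c * (q - u1)" "R2 \<le> R1 + c * (u2 - u1)" "(1 - \<eta>) * R1 \<le> R2" "0 \<le> \<eta> * R1"
    and far: "(u1 < u2 \<and> q \<le> u1 \<and> u1 - q \<le> 3 * (u2 - u1)) \<or> (u2 < u1 \<and> u1 \<le> q \<and> q - u1 \<le> 3 * (u1 - u2))"
  shows "R \<le> (1 + 3 * \<eta>) * R1"
proof -
  have flat: "- (c * (u2 - u1)) \<le> \<eta> * R1" using assms(2,3) by (simp add: algebra_simps)
  have "c * (q - u1) \<le> 3 * (\<eta> * R1)"
    using far
  proof
    assume f: "u1 < u2 \<and> q \<le> u1 \<and> u1 - q \<le> 3 * (u2 - u1)"
    show ?thesis
    proof (cases "0 \<le> c")
      case True
      then have "c * (q - u1) \<le> 0" using f by (intro mult_nonneg_nonpos) auto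
      then show ?thesis using assms(4) by linarith
    next
      case False
      have "(- c) * (u1 - q) \<le> (- c) * (3 * (u2 - u1))" using f False by (intro mult_left_mono) auto
      then show ?thesis using flat by (simp add: algebra_simps)
    qed
  next
    assume f: "u2 < u1 \<and> u1 \<le> q \<and> q - u1 \<le> 3 * (u1 - u2)"
    show ?thesis
    proof (cases "c \<le> 0")
      case True
      then have "c * (q - u1) \<le> 0" using f by (intro mult_nonpos_nonneg) auto
      then show ?thesis using assms(4) by linarith
    next
      case False
      have "c * (q - u1) \<le> c * (3 * (u1 - u2))" using f False by (intro mult_left_mono) auto
      then show ?thesis using flat by (simp add: algebra_simps)
    qed
  qed
  then show ?thesis using assms(1) by (simp add: algebra_simps)
qed

text \<open>The 7 is dictated by the narrow windows of the search, where
  \<open>(1 - \<eta>) * (1 - 6 * \<eta>)\<close> is bounded by \<open>1 - 7 * \<eta>\<close> from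
  below; it also absorbs the factor \<open>1 + 3 * \<eta>\<close> here.\<close>

lemma near_optimal_probe:
  fixes R :: real
  assumes "R \<le> (1 + 3 * \<eta>) * e" "(1 - \<eta>) * e \<le> V" "0 \<le> e" "0 \<le> \<eta>" "\<eta> \<le> 1 / 8"
  shows "(1 - 7 * \<eta>) * R \<le> V"
proof -
  have "(1 - 7 * \<eta>) * R \<le> (1 - 7 * \<eta>) * ((1 + 3 * \<eta>) * e)"
    using assms by (intro mult_left_mono) auto
  also have "\<dots> = ((1 - 7 * \<eta>) * (1 + 3 * \<eta>)) * e" by simp
  also have "\<dots> \<le> (1 - \<eta>) * e"
    using assms by (intro mult_right_mono) (auto simp: algebra_simps)
  finally show ?thesis using assms(2) by linarith
qed

text \<open>Suppose no guarantee comes within \<open>1 - 7 * \<eta>\<close> of the revenue at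
  \<open>p\<close>, with quantile above the floor. Then every window holding the quantile of
  \<open>p\<close> is wide, as the left end of a narrow one would be good enough, and the quantile
  is never discarded, as otherwise one of the thirds would be good enough. But the windows shrink
  geometrically.\<close>

lemma ternary_search:
  assumes conc: "concave_revenue q0 \<eta> D" and \<eta>: "0 < \<eta>" "\<eta> \<le> 1 / 8" and q0: "0 < q0" "q0 < 1"
    and xs: "length xs = 3 * Suc T" and T: "(2 / 3) ^ T \<le> \<eta> * q0"
    and br: "\<And>i. i < 3 * Suc T \<Longrightarrow> brackets D (probe q0 \<eta> (take i xs)) (xs ! i)"
    and V: "\<And>i. i < 3 * Suc T \<Longrightarrow> fst (probe q0 \<eta> (take i xs)) * xs ! i \<le> V"
    and "0 \<le> p"
  shows "(1 - 8 * \<eta>) * rev D p \<le> V"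
proof -
  have D: "value_dist D" and qv: "\<And>u. 0 < u \<Longrightarrow> u \<le> 1 \<Longrightarrow> quant D (val_at D u) = u"
    and sg: "\<And>u. 0 < u \<Longrightarrow> u < 1 \<Longrightarrow> \<exists>c\<le>val_at D u. \<forall>p\<ge>0. rev D p \<le> rev D (val_at D u) + c * (quant D p - u)"
    and small: "\<And>p. 0 \<le> p \<Longrightarrow> quant D p < q0 \<Longrightarrow> (1 - \<eta>) * rev D p \<le> rev D (val_at D q0)"
    using conc by (auto simp: concave_revenue_def)
  define lw where "lw r = fst (window q0 xs r)" for r
  define hw where "hw r = snd (window q0 xs r)" for r
  define pt where "pt r k = lw r + real k * (hw r - lw r) / 3" for r k
  have win: "q0 \<le> lw r" "hw r \<le> 1" "hw r - lw r = (2 / 3) ^ r * (1 - q0)" for r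
    using window_bounds[of q0 xs r] q0 by (auto simp: lw_def hw_def)
  have wpos: "lw r < hw r" for r
  proof -
    have "0 < (2 / 3) ^ r * (1 - q0)" using q0 by simp
    then show ?thesis using win(3)[of r] by linarith
  qed
  have probe: "0 \<le> xs ! (3 * r + k)" "(1 - \<eta>) * pt r k \<le> quant D (xs ! (3 * r + k))"
      "quant D (xs ! (3 * r + k)) \<le> pt r k" "val_at D (pt r k) \<le> xs ! (3 * r + k)"
      "xs ! (3 * r + k) = val_at D (quant D (xs ! (3 * r + k)))"
      "(1 - \<eta>) * (pt r k * xs ! (3 * r + k)) \<le> V"
    if rk: "r < Suc T" "k < 3" for r k
  proof -
    let ?i = "3 * r + k"
    have "3 * Suc r \<le> 3 * Suc T" using rk by simp
    then have i: "?i < 3 * Suc T" using rk(2) by simp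
    have pp: "probe_point q0 xs ?i = pt r k"
      using rk by (simp add: probe_point_def pt_def lw_def hw_def)
    have pb: "0 < pt r k" "pt r k \<le> 1" using probe_point_bounds[of q0 xs ?i] q0 by (auto simp: pp)
    have pr: "probe q0 \<eta> (take ?i xs) = ((1 - \<eta>) * pt r k, pt r k)"
      using probe_take[of ?i xs] i xs by (simp add: pp)
    from br[OF i] obtain u where u: "0 < u" "u \<le> 1" "xs ! ?i = val_at D u"
      and b: "(1 - \<eta>) * pt r k \<le> quant D (xs ! ?i)" "val_at D (pt r k) \<le> xs ! ?i"
      unfolding brackets_def pr by auto
    show "0 \<le> xs ! ?i" using u val_at_nonneg[OF D] by simp
    show "(1 - \<eta>) * pt r k \<le> quant D (xs ! ?i)" "val_at D (pt r k) \<le> xs ! ?i" by fact+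
    show "quant D (xs ! ?i) \<le> pt r k"
      using quant_antimono[OF D b(2)] qv[OF pb] by simp
    show "xs ! ?i = val_at D (quant D (xs ! ?i))" using u qv by simp
    show "(1 - \<eta>) * (pt r k * xs ! ?i) \<le> V" using V[OF i] by (simp add: pr mult.assoc)
  qed
  have main: "(1 - 7 * \<eta>) * rev D p \<le> V" if p: "0 \<le> p" "q0 \<le> quant D p" for p
  proof (rule ccontr)
    assume not: "\<not> (1 - 7 * \<eta>) * rev D p \<le> V"
    let ?q = "quant D p"
    \<comment> \<open>The 6 leaves room for probing errors: with length \<open>L\<close> at least
      \<open>6 * \<eta> * hw r\<close>, a third is probed with error at most \<open>L / 6\<close>,
      half the distance of the thirds.\<close>
    have wide: "6 * (\<eta> * hw r) \<le> hw r - lw r" if r: "r < Suc T" and q: "lw r \<le> ?q" "?q \<le> hw r" for r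
    proof (rule ccontr)
      assume "\<not> 6 * (\<eta> * hw r) \<le> hw r - lw r"
      then have "(1 - 6 * \<eta>) * hw r \<le> lw r" by (simp add: algebra_simps)
      moreover have "(1 - 6 * \<eta>) * ?q \<le> (1 - 6 * \<eta>) * hw r" using q \<eta> by (intro mult_left_mono) auto
      ultimately have l: "(1 - 6 * \<eta>) * ?q \<le> lw r" by linarith
      \<comment> \<open>The left end has a quantile no larger than that of \<open>p\<close>, hence a
        value at least \<open>p\<close>; in a narrow window little is lost in the quantile.\<close>
      have "p \<le> val_at D (lw r)" using win(1)[of r] q0 q p by (intro le_val_at[OF D]) auto
      also have "\<dots> \<le> xs ! (3 * r)" using probe(4)[OF r, of 0] by (simp add: pt_def)
      finally have "((1 - 6 * \<eta>) * ?q) * p \<le> lw r * xs ! (3 * r)"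
        using l p \<eta> win(1)[of r] q0 by (intro mult_mono) auto
      then have "(1 - \<eta>) * (((1 - 6 * \<eta>) * ?q) * p) \<le> (1 - \<eta>) * (lw r * xs ! (3 * r))"
        using \<eta> by (intro mult_left_mono) auto
      also have "\<dots> \<le> V" using probe(6)[OF r, of 0] by (simp add: pt_def)
      finally have "((1 - \<eta>) * (1 - 6 * \<eta>)) * rev D p \<le> V" by (simp add: rev_def mult_ac)
      moreover have "(1 - 7 * \<eta>) * rev D p \<le> ((1 - \<eta>) * (1 - 6 * \<eta>)) * rev D p"
        using rev_nonneg[OF p(1)] by (intro mult_right_mono) (auto simp: algebra_simps)
      ultimately show False using not by linarith
    qed
    have inv: "lw r \<le> ?q \<and> ?q \<le> hw r" if "r \<le> T" for r
      using that
    proof (induction r)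
      case 0 then show ?case using p quant_le_1[OF D] by (simp add: lw_def hw_def)
    next
      case (Suc r)
      then have q: "lw r \<le> ?q" "?q \<le> hw r" and r: "r < Suc T" by auto
      define L where "L = hw r - lw r"
      define x1 where "x1 = lw r + L / 3"
      define x2 where "x2 = lw r + 2 * L / 3"
      define w1 where "w1 = xs ! (3 * r + 1)"
      define w2 where "w2 = xs ! (3 * r + 2)"
      define u1 where "u1 = quant D w1"
      define u2 where "u2 = quant D w2"
      have pt: "pt r 1 = x1" "pt r 2 = x2" by (auto simp: pt_def x1_def x2_def L_def)
      note P1 = probe[OF r, of 1, unfolded pt, folded w1_def, folded u1_def, simplified]
      note P2 = probe[OF r, of 2, unfolded pt, folded w2_def, folded u2_def, simplified]
      have L: "0 < L" "6 * (\<eta> * hw r) \<le> L" using wpos[of r] wide[OF r q] by (auto simp: L_def)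
      have hL: "hw r = lw r + L" by (simp add: L_def)
      have x: "0 < x1" "0 < x2" "x1 < 1" "x2 < 1" "x1 \<le> hw r" "x2 \<le> hw r"
        using win(1,2)[of r] q0 L(1) hL unfolding x1_def x2_def by linarith+
      have \<eta>x: "\<eta> * x1 \<le> L / 6" "\<eta> * x2 \<le> L / 6"
        using L(2) mult_left_mono[OF x(5), of \<eta>] mult_left_mono[OF x(6), of \<eta>] \<eta> by linarith+
      have u: "x1 - \<eta> * x1 \<le> u1" "x2 - \<eta> * x2 \<le> u2" "u1 \<le> x1" "u2 \<le> x2"
        using P1 P2 by (auto simp: algebra_simps)
      have u01: "0 < u1" "u1 < 1" "0 < u2" "u2 < 1"
      proof -
        have "\<eta> * x1 < 1 * x1" "\<eta> * x2 < 1 * x2"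
          by (intro mult_strict_right_mono x; use \<eta> in simp)+
        then show "0 < u1" "u1 < 1" "0 < u2" "u2 < 1" using u x by linarith+
      qed
      \<comment> \<open>Probes only undershoot: \<open>u2\<close> falls below \<open>x2\<close> by
        at most \<open>L / 6\<close>, \<open>u1\<close> does not exceed \<open>x1\<close>, and
        \<open>x1\<close> and \<open>x2\<close> are \<open>L / 3\<close> apart.\<close>
      have sep: "L / 6 \<le> u2 - u1" using u \<eta>x unfolding x1_def x2_def by linarith
      have R: "rev D w1 = u1 * w1" "rev D w2 = u2 * w2" by (simp_all add: rev_def u1_def u2_def)
      have Rle: "rev D w1 \<le> x1 * w1" "rev D w2 \<le> x2 * w2"
        unfolding R by (intro mult_right_mono u P1(1) P2(1))+
      have Rge: "(1 - \<eta>) * (x1 * w1) \<le> rev D w1" "(1 - \<eta>) * (x2 * w2) \<le> rev D w2"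
        unfolding R mult.assoc[symmetric] by (intro mult_right_mono P1(1,2) P2(1,2))+
      have Rpos: "0 \<le> rev D w1" "0 \<le> rev D w2" using P1(1) P2(1) rev_nonneg by auto
      have good: False
        if "rev D p \<le> (1 + 3 * \<eta>) * rev D w1 \<or> rev D p \<le> (1 + 3 * \<eta>) * rev D w2"
        using that
      proof
        assume a: "rev D p \<le> (1 + 3 * \<eta>) * rev D w1"
        have "(1 - \<eta>) * rev D w1 \<le> (1 - \<eta>) * (x1 * w1)" using Rle \<eta> by (intro mult_left_mono) auto
        then have "(1 - \<eta>) * rev D w1 \<le> V" using P1(6) by linarith
        from near_optimal_probe[OF a this] show False using not Rpos \<eta> by simp
      next
        assume a: "rev D p \<le> (1 + 3 * \<eta>) * rev D w2"
        have "(1 - \<eta>) * rev D w2 \<le> (1 - \<eta>) * (x2 * w2)" using Rle \<eta> by (intro mult_left_mono) auto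
        then have "(1 - \<eta>) * rev D w2 \<le> V" using P2(6) by linarith
        from near_optimal_probe[OF a this] show False using not Rpos \<eta> by simp
      qed
      have next_window: "(lw (Suc r), hw (Suc r)) = (if x2 * w2 \<le> x1 * w1 then (lw r, x2) else (x1, hw r))"
        by (auto simp: lw_def hw_def x1_def x2_def w1_def w2_def L_def)
      show ?case
      proof (cases "x2 * w2 \<le> x1 * w1")
        case True
        \<comment> \<open>Otherwise \<open>?q\<close> lies beyond \<open>u2\<close> at distance at
          most \<open>L / 3 + L / 6\<close>, three times the separation \<open>L / 6\<close>. This
          is the 3 in \<open>flat_supergradient\<close>.\<close>
        have "?q \<le> x2"
        proof (rule ccontr)
          assume "\<not> ?q \<le> x2"
          obtain c where c: "\<forall>p\<ge>0. rev D p \<le> rev D w2 + c * (quant D p - u2)"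
            using sg[OF u01(3,4)] P2(5) by metis
          have "(1 - \<eta>) * rev D w2 \<le> (1 - \<eta>) * (x2 * w2)" using Rle \<eta> by (intro mult_left_mono) auto
          also have "\<dots> \<le> (1 - \<eta>) * (x1 * w1)" using True \<eta> by (intro mult_left_mono) auto
          finally have flat: "(1 - \<eta>) * rev D w2 \<le> rev D w1" using Rge(1) by linarith
          have "hw r = x2 + L / 3" unfolding x2_def using hL by linarith
          then have "?q - u2 \<le> 3 * (u2 - u1)" using sep u(2) \<eta>x(2) q(2) by (simp add: algebra_simps)
          then have far: "u1 < u2 \<and> u2 \<le> ?q \<and> ?q - u2 \<le> 3 * (u2 - u1)"
            using sep L(1) u(4) \<open>\<not> ?q \<le> x2\<close> by linarith
          have A: "rev D p \<le> rev D w2 + c * (?q - u2)" using c p(1) by blast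
          have B: "rev D w1 \<le> rev D w2 + c * (u1 - u2)" using c P1(1) unfolding u1_def by blast
          have "0 \<le> \<eta> * rev D w2" using Rpos(2) \<eta>(1) by simp
          from flat_supergradient[OF A B flat this disjI2[OF far]] show False using good by blast
        qed
        then show ?thesis using next_window True q by auto
      next
        case False
        have "x1 \<le> ?q"
        proof (rule ccontr)
          assume nq: "\<not> x1 \<le> ?q"
          obtain c where cw: "c \<le> w1" and c: "\<forall>p\<ge>0. rev D p \<le> rev D w1 + c * (quant D p - u1)"
            using sg[OF u01(1,2)] P1(5) by metis
          have "(1 - \<eta>) * rev D w1 \<le> (1 - \<eta>) * (x1 * w1)" using Rle \<eta> by (intro mult_left_mono) auto
          also have "\<dots> \<le> (1 - \<eta>) * (x2 * w2)" using False \<eta> by (intro mult_left_mono) auto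
          finally have flat: "(1 - \<eta>) * rev D w1 \<le> rev D w2" using Rge(2) by linarith
          have "rev D p \<le> (1 + 3 * \<eta>) * rev D w1"
          \<comment> \<open>As probes undershoot, \<open>?q\<close> may be below \<open>x1\<close>
            but above \<open>u1\<close>, on the side where flatness does not help. That gap is at
            most \<open>\<eta> * x1\<close> and the slope at most \<open>w1\<close>, so the gain is
            at most \<open>\<eta> * (x1 * w1)\<close>.\<close>
          proof (cases "?q \<le> u1")
            case True
            have "u1 - ?q \<le> L / 3" using u(3) q(1) unfolding x1_def by linarith
            then have far: "u1 < u2 \<and> ?q \<le> u1 \<and> u1 - ?q \<le> 3 * (u2 - u1)"
              using sep L(1) True by (simp add: algebra_simps)
            have A: "rev D p \<le> rev D w1 + c * (?q - u1)" using c p(1) by blast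
            have B: "rev D w2 \<le> rev D w1 + c * (u2 - u1)" using c P2(1) unfolding u2_def by blast
            have "0 \<le> \<eta> * rev D w1" using Rpos(1) \<eta>(1) by simp
            from flat_supergradient[OF A B flat this disjI1[OF far]] show ?thesis .
          next
            case False
            have "c * (?q - u1) \<le> w1 * (\<eta> * x1)"
            proof (rule mult_mono)
              show "?q - u1 \<le> \<eta> * x1" using nq u(1) by linarith
            qed (use cw P1(1) False in auto)
            also have "\<dots> = \<eta> * (x1 * w1)" by simp
            also have "\<dots> \<le> \<eta> * (3 * rev D w1)"
            proof (rule mult_left_mono)
              have "(1 / 3) * (x1 * w1) \<le> (1 - \<eta>) * (x1 * w1)"
                using \<eta> x(1) P1(1) by (intro mult_right_mono) auto
              then show "x1 * w1 \<le> 3 * rev D w1" using Rge(1) by linarith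
            qed (use \<eta> in simp)
            finally have "c * (?q - u1) \<le> \<eta> * (3 * rev D w1)" .
            moreover have "rev D p \<le> rev D w1 + c * (?q - u1)" using c p(1) by blast
            moreover have "(1 + 3 * \<eta>) * rev D w1 = rev D w1 + \<eta> * (3 * rev D w1)" by (simp add: algebra_simps)
            ultimately show ?thesis by linarith
          qed
          then show False using good by blast
        qed
        then show ?thesis using next_window False q by auto
      qed
    qed
    have "6 * (\<eta> * hw T) \<le> hw T - lw T" using wide inv by simp
    also have "\<dots> \<le> (2 / 3) ^ T * 1" unfolding win(3) using q0 by (intro mult_left_mono) auto
    also have "\<dots> \<le> \<eta> * q0" using T by simp
    also have "\<dots> \<le> \<eta> * hw T" using win(1)[of T] wpos[of T] \<eta> by (intro mult_left_mono) auto
    finally have "\<eta> * hw T \<le> 0" by simp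
    moreover have "0 < \<eta> * hw T" using win(1)[of T] wpos[of T] \<eta> q0 by simp
    ultimately show False by linarith
  qed
  show ?thesis
  proof (cases "q0 \<le> quant D p")
    case True
    have "(1 - 8 * \<eta>) * rev D p \<le> (1 - 7 * \<eta>) * rev D p"
      using \<eta> rev_nonneg[OF \<open>0 \<le> p\<close>] by (intro mult_right_mono) auto
    then show ?thesis using main[OF \<open>0 \<le> p\<close> True] by linarith
  next
    case False
    \<comment> \<open>Below the floor the comparison passes through the price at \<open>q0\<close>,
      which costs the eighth \<open>\<eta>\<close>.\<close>
    let ?v = "val_at D q0"
    have v: "0 \<le> ?v" "q0 \<le> quant D ?v" using q0 qv val_at_nonneg[OF D] by auto
    have "(1 - 7 * \<eta>) * ((1 - \<eta>) * rev D p) \<le> (1 - 7 * \<eta>) * rev D ?v"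
      using small[OF \<open>0 \<le> p\<close>] False \<eta> by (intro mult_left_mono) auto
    also have "\<dots> \<le> V" by (rule main[OF v])
    finally have "((1 - 7 * \<eta>) * (1 - \<eta>)) * rev D p \<le> V" by (simp add: mult_ac)
    moreover have "(1 - 8 * \<eta>) * rev D p \<le> ((1 - 7 * \<eta>) * (1 - \<eta>)) * rev D p"
      using rev_nonneg[OF \<open>0 \<le> p\<close>] by (intro mult_right_mono) (auto simp: algebra_simps)
    ultimately show ?thesis by linarith
  qed
qed

subsection \<open>Sample sizes\<close>

lemma power_le_exp:
  fixes x :: real assumes "x \<le> 1" shows "(1 - x) ^ n \<le> exp (- (x * real n))"
proof -
  have "1 - x \<le> exp (- x)" using exp_ge_add_one_self[of "- x"] by simp
  then have "(1 - x) ^ n \<le> exp (- x) ^ n" using assms by (intro power_mono) auto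
  then show ?thesis by (simp add: exp_of_nat_mult[symmetric] mult.commute)
qed

text \<open>Bounding the logarithm away from 0 lets the \<open>+ 1\<close> of rounding up be
  absorbed into a multiple of it.\<close>

lemma ln_two_div_gt_half:
  assumes "1 \<le> (T::real)" "0 < \<delta>" "\<delta> < 1" shows "1 / 2 \<le> ln (2 * T / \<delta>)"
proof -
  have "2 * 1 \<le> 2 * T / \<delta>" using assms by (simp add: field_simps)
  then have "ln 2 \<le> ln (2 * T / \<delta>)" using assms by simp
  then show ?thesis using ln2_ge_two_thirds by linarith
qed

lemma exp_minus_ln:
  assumes "1 \<le> (T::real)" "0 < \<delta>" "ln (2 * T / \<delta>) \<le> x" shows "2 * T * exp (- x) \<le> \<delta>"
proof -
  have "exp (- x) \<le> exp (- ln (2 * T / \<delta>))" using assms by simp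
  also have "\<dots> = \<delta> / (2 * T)" using assms by (simp add: exp_minus)
  finally show ?thesis using assms by (simp add: field_simps)
qed

text \<open>\<open>\<rho>\<close> is the share of a request of length \<open>\<Delta>\<close> that a
  bracket of width \<open>w\<close> covers, and \<open>l / \<rho>\<close> trials push the failure
  below \<open>\<delta> / (2 * T)\<close>. The minimum with 1 handles \<open>\<Delta> < w\<close>,
  where every sample succeeds, and leads to the summand 1 in the bound.\<close>

lemma block_size:
  assumes T: "1 \<le> T" and \<delta>: "0 < \<delta>" "\<delta> < 1" and \<Delta>: "0 < \<Delta>" and w: "0 < w"
  shows "\<exists>m \<rho>. 0 < m \<and> 0 \<le> \<rho> \<and> \<rho> \<le> 1 \<and> 2 * real T * (1 - \<rho>) ^ m \<le> \<delta> \<and> \<rho> * \<Delta> \<le> w \<and>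
    real (T * m) \<le> 3 * real T * ln (2 * real T / \<delta>) * (1 + \<Delta> / w)"
proof -
  define \<rho> where "\<rho> = min 1 (w / \<Delta>)"
  define l where "l = ln (2 * real T / \<delta>)"
  define m where "m = nat \<lceil>l / \<rho>\<rceil>"
  have l: "1 / 2 \<le> l" unfolding l_def using T \<delta> by (intro ln_two_div_gt_half) auto
  have \<rho>: "0 < \<rho>" "\<rho> \<le> 1" "\<rho> * \<Delta> \<le> w" using w \<Delta> by (auto simp: \<rho>_def min_def field_simps)
  have inv: "1 / \<rho> \<le> 1 + \<Delta> / w" using w \<Delta> by (auto simp: \<rho>_def min_def)
  have pos: "0 < l / \<rho>" using l \<rho> by simp
  then have m: "0 < m" "l / \<rho> \<le> real m" "real m \<le> l / \<rho> + 1" unfolding m_def by linarith+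
  have "2 * real T * (1 - \<rho>) ^ m \<le> 2 * real T * exp (- (\<rho> * real m))"
    using power_le_exp[OF \<rho>(2)] by (intro mult_left_mono) auto
  also have "\<dots> \<le> \<delta>"
  proof (rule exp_minus_ln)
    show "ln (2 * real T / \<delta>) \<le> \<rho> * real m"
      using m(2) \<rho>(1) unfolding l_def[symmetric] by (simp add: pos_divide_le_eq mult.commute)
  qed (use T \<delta> in auto)
  finally have fail: "2 * real T * (1 - \<rho>) ^ m \<le> \<delta>" .
  have "real m \<le> l * (1 / \<rho>) + 2 * l * 1" using m(3) l by simp
  also have "\<dots> \<le> l * (1 + \<Delta> / w) + 2 * l * (1 + \<Delta> / w)"
    using inv l w \<Delta> by (intro add_mono mult_left_mono) auto
  finally have "real T * real m \<le> real T * (3 * l * (1 + \<Delta> / w))"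
    by (intro mult_left_mono) (auto simp: algebra_simps)
  then have "real (T * m) \<le> 3 * real T * l * (1 + \<Delta> / w)" by (simp add: mult_ac)
  then show ?thesis using m(1) \<rho> fail unfolding l_def by (intro exI[of _ m] exI[of _ \<rho>]) auto
qed

lemma grid_learner_blocks:
  fixes lo hi :: "nat \<Rightarrow> real"
  assumes \<Delta>: "0 < \<Delta>" "\<Delta> \<le> 1 / 2" and \<delta>: "0 < \<delta>" "\<delta> < 1" and J: "1 \<le> J" and w: "0 < w"
    and grid: "\<And>j. j < J \<Longrightarrow> 0 < lo j \<and> hi j \<le> 1 \<and> w \<le> hi j - lo j"
    and Class: "\<And>D. Class D \<Longrightarrow> value_dist D" "\<And>D. Class D \<Longrightarrow> {x. Goal D x} \<in> sets borel"
    and Goal: "\<And>D x. Class D \<Longrightarrow> (\<And>j. j < J \<Longrightarrow> lo j * val_at D (hi j) \<le> rev D x) \<Longrightarrow> Goal D x"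
  shows "\<exists>N Q P. real N \<le> 3 * real J * ln (2 * real J / \<delta>) * (1 + \<Delta> / w) \<and> learns \<Delta> N Q P Class Goal \<delta>"
proof -
  obtain m \<rho> where m: "0 < m" and \<rho>: "0 \<le> \<rho>" "\<rho> \<le> 1" "2 * real J * (1 - \<rho>) ^ m \<le> \<delta>" "\<rho> * \<Delta> \<le> w"
    and N: "real (J * m) \<le> 3 * real J * ln (2 * real J / \<delta>) * (1 + \<Delta> / w)"
    using block_size[OF J \<delta> \<Delta>(1) w] by blast
  \<comment> \<open>Every list must yield a legal bracket, so the index is cut off at
    \<open>J - 1\<close>; on the prefixes that occur it is their length.\<close>
  define B where "B xs = (lo (min (length xs) (J - 1)), hi (min (length xs) (J - 1)))" for xs :: "real list"
  have "\<exists>Q P. learns \<Delta> (J * m) Q P Class Goal \<delta>"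
  proof (rule block_learner[OF \<Delta> m \<rho>(1-3) _ _ _ Class])
    show "0 < fst (B xs) \<and> fst (B xs) < snd (B xs) \<and> snd (B xs) \<le> 1 \<and> \<rho> * \<Delta> \<le> snd (B xs) - fst (B xs)" for xs
    proof -
      have "min (length xs) (J - 1) < J" using J by simp
      from grid[OF this] show ?thesis using w \<rho>(4) unfolding B_def fst_conv snd_conv by linarith
    qed
    show "lmeas (sample_space (J * m)) r (\<lambda>xs. fst (B xs))" "lmeas (sample_space (J * m)) r (\<lambda>xs. snd (B xs))" for r
      by (simp_all add: lmeas_def rlist_def B_def)
    fix D x and xs :: "real list"
    assume D: "Class D" and xs: "length xs = J"
      and br: "\<And>r. r < J \<Longrightarrow> brackets D (B (take r xs)) (xs ! r)"
      and V: "\<And>r. r < J \<Longrightarrow> fst (B (take r xs)) * xs ! r \<le> rev D x"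
    show "Goal D x"
    proof (rule Goal[OF D])
      fix j assume j: "j < J"
      have "min (min (length xs) j) (J - 1) = j" using j xs by simp
      then have B: "B (take j xs) = (lo j, hi j)" by (simp add: B_def)
      have "lo j * val_at D (hi j) \<le> lo j * xs ! j"
        using br[OF j] grid[OF j] by (intro mult_left_mono) (auto simp: brackets_def B)
      also have "\<dots> \<le> rev D x" using V[OF j] by (simp add: B)
      finally show "lo j * val_at D (hi j) \<le> rev D x" .
    qed
  qed
  then show ?thesis using N by blast
qed

text \<open>\<open>K\<close> bounds \<open>hi / (hi - lo)\<^sup>2\<close>, the reciprocal of the
  Chernoff exponent up to the factor 16. Rounding up raises 16 to 18 because \<open>K * l\<close> is
  at least 1/2.\<close>

lemma grid_learner_one_block:
  fixes lo hi :: "nat \<Rightarrow> real"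
  assumes \<Delta>: "\<Delta> \<le> 1" and \<delta>: "0 < \<delta>" "\<delta> < 1" and J: "1 \<le> J" and K: "1 \<le> K"
    and grid: "\<And>j. j < J \<Longrightarrow> 0 < lo j \<and> lo j < hi j \<and> hi j \<le> 1 \<and> hi j \<le> K * (hi j - lo j)\<^sup>2"
    and Class: "\<And>D. Class D \<Longrightarrow> value_dist D" "\<And>D. Class D \<Longrightarrow> {x. Goal D x} \<in> sets borel"
    and Goal: "\<And>D x. Class D \<Longrightarrow> (\<And>j. j < J \<Longrightarrow> lo j * val_at D (hi j) \<le> rev D x) \<Longrightarrow> Goal D x"
  shows "\<exists>N Q P. real N \<le> 18 * K * ln (2 * real J / \<delta>) \<and> learns \<Delta> N Q P Class Goal \<delta>"
proof -
  define l where "l = ln (2 * real J / \<delta>)"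
  define m where "m = nat \<lceil>16 * K * l\<rceil>"
  have l: "1 / 2 \<le> l" unfolding l_def using J \<delta> by (intro ln_two_div_gt_half) auto
  have Kl: "1 / 2 \<le> K * l" using mult_mono[of 1 K "1/2" l] K l by simp
  then have m: "0 < m" "16 * K * l \<le> real m" "real m \<le> 16 * K * l + 1" unfolding m_def by linarith+
  have "\<exists>Q P. learns \<Delta> m Q P Class Goal \<delta>"
  proof (rule one_block_learner[OF \<Delta> m(1) _ _ _ Class Goal])
    show "0 < lo j \<and> lo j < hi j \<and> hi j \<le> 1" if "j < J" for j using grid[OF that] by simp
    fix j assume j: "j < J"
    show "2 * real J * exp (- (real m * (hi j - lo j)\<^sup>2 / (16 * hi j))) \<le> \<delta>"
    proof (rule exp_minus_ln)
      have h: "0 < hi j" "hi j \<le> K * (hi j - lo j)\<^sup>2" using grid[OF j] by auto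
      have "l * (16 * hi j) \<le> l * (16 * (K * (hi j - lo j)\<^sup>2))" using h l by (intro mult_left_mono) auto
      also have "\<dots> = (16 * K * l) * (hi j - lo j)\<^sup>2" by simp
      also have "\<dots> \<le> real m * (hi j - lo j)\<^sup>2" using m(2) by (intro mult_right_mono) auto
      finally show "ln (2 * real J / \<delta>) \<le> real m * (hi j - lo j)\<^sup>2 / (16 * hi j)"
        using h unfolding l_def[symmetric] by (simp add: pos_le_divide_eq)
    qed (use J \<delta> in auto)
  qed (use \<delta> in auto)
  moreover have "real m \<le> 18 * K * l" using m(3) Kl by linarith
  ultimately show ?thesis unfolding l_def by blast
qed

text \<open>The number of brackets is at most polynomial in \<open>1 / \<epsilon>\<close> and
  \<open>\<Lambda>\<close>, so its logarithm is linear in \<open>\<Lambda>\<close>.\<close>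

lemma log_count_le:
  assumes "1 \<le> J" "J \<le> c * (\<Lambda> / \<epsilon>)" "1 \<le> c" "1 \<le> \<Lambda>" "1 + ln (1 / \<epsilon>) + ln (1 / \<delta>) \<le> \<Lambda>"
    and "0 < \<epsilon>" "0 < (\<delta>::real)"
  shows "ln (2 * J / \<delta>) \<le> (2 * c + 1) * \<Lambda>"
proof -
  have "ln (2 * J / \<delta>) \<le> ln (2 * c * (\<Lambda> * ((1 / \<epsilon>) * (1 / \<delta>))))"
    using assms by (subst ln_le_cancel_iff) (auto simp: field_simps)
  also have "\<dots> = ln (2 * c) + (ln \<Lambda> + (ln (1 / \<epsilon>) + ln (1 / \<delta>)))"
    using assms by (subst ln_mult_pos, simp, simp)+ simp
  also have "\<dots> \<le> (2 * c - 1) + ((\<Lambda> - 1) + (\<Lambda> - 1))"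
    using assms ln_le_minus_one[of "2 * c"] ln_le_minus_one[of \<Lambda>] by (intro add_mono) auto
  also have "\<dots> \<le> (2 * c - 1) * \<Lambda> + ((\<Lambda> - 1) + (\<Lambda> - 1))"
  proof -
    have "(2 * c - 1) * 1 \<le> (2 * c - 1) * \<Lambda>" using assms by (intro mult_left_mono) auto
    then show ?thesis by simp
  qed
  also have "\<dots> \<le> (2 * c + 1) * \<Lambda>" by (simp add: algebra_simps)
  finally show ?thesis .
qed

subsection \<open>Geometric grids\<close>

text \<open>Cutting off at \<open>q0\<close> turns the tail of the grid into the floor itself and
  keeps brackets of relative width \<open>\<eta>\<close> at least \<open>\<eta> * q0\<close>
  wide.\<close>

definition geo :: "real \<Rightarrow> real \<Rightarrow> nat \<Rightarrow> real" where
  "geo q0 \<eta> j = max q0 ((1 - \<eta>) ^ j)"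

text \<open>Rounding the quantile of \<open>p\<close> down to the grid costs one factor
  \<open>1 - \<eta>\<close>, the bracket at the grid point the other. The value at the smaller
  quantile is at least \<open>p\<close>, so nothing is lost in the price.\<close>

lemma geo_guarantee:
  assumes D: "value_dist D" and q0: "0 < q0" and \<eta>: "0 < \<eta>" "\<eta> < 1" and n: "(1 - \<eta>) ^ n \<le> q0"
    and V: "\<And>j. j < Suc n \<Longrightarrow> ((1 - \<eta>) * geo q0 \<eta> j) * val_at D (geo q0 \<eta> j) \<le> V"
    and p: "0 \<le> p" "q0 \<le> quant D p"
  shows "(1 - \<eta>)\<^sup>2 * rev D p \<le> V"
proof -
  let ?P = "\<lambda>j. (1 - \<eta>) ^ j \<le> quant D p"
  define j where "j = (LEAST j. ?P j)"
  have Pn: "?P n" using n p by simp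
  have Pj: "?P j" unfolding j_def by (rule LeastI[of ?P, OF Pn])
  have jn: "j < Suc n" using Least_le[of ?P, OF Pn] by (simp add: j_def)
  have le: "geo q0 \<eta> j \<le> quant D p" using Pj p by (simp add: geo_def)
  have ge: "(1 - \<eta>) * quant D p \<le> geo q0 \<eta> j"
  proof (cases j)
    case 0
    have "(1 - \<eta>) * quant D p \<le> 1 * 1"
      using \<eta> quant_le_1[OF D] by (intro mult_mono) auto
    then show ?thesis using 0 by (simp add: geo_def)
  next
    case (Suc i)
    then have "\<not> ?P i" using not_less_Least[of i ?P] by (simp add: j_def)
    then have "(1 - \<eta>) * quant D p \<le> (1 - \<eta>) * (1 - \<eta>) ^ i" using \<eta> by (intro mult_left_mono) auto
    then show ?thesis using Suc by (simp add: geo_def)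
  qed
  have gpos: "0 < geo q0 \<eta> j" using q0 by (simp add: geo_def)
  have "p \<le> val_at D (geo q0 \<eta> j)" by (rule le_val_at[OF D gpos p(1) le])
  then have "((1 - \<eta>) * ((1 - \<eta>) * quant D p)) * p \<le> ((1 - \<eta>) * geo q0 \<eta> j) * val_at D (geo q0 \<eta> j)"
    using ge \<eta> p gpos by (intro mult_mono) auto
  also have "\<dots> \<le> V" by (rule V[OF jn])
  finally show ?thesis by (simp add: rev_def power2_eq_square mult_ac)
qed

lemma geo_length:
  assumes q0: "0 < q0" "q0 \<le> 1" and \<eta>: "0 < \<eta>" "\<eta> < 1"
  shows "\<exists>n. (1 - \<eta>) ^ n \<le> q0 \<and> real (Suc n) \<le> 2 + ln (1 / q0) / \<eta>"
proof -
  define n where "n = nat \<lceil>ln (1 / q0) / \<eta>\<rceil>"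
  have "0 \<le> ln (1 / q0) / \<eta>" using q0 \<eta> by (intro divide_nonneg_nonneg ln_ge_zero) auto
  then have n: "ln (1 / q0) / \<eta> \<le> real n" "real n \<le> ln (1 / q0) / \<eta> + 1" unfolding n_def by linarith+
  have "(1 - \<eta>) ^ n \<le> exp (- (\<eta> * real n))" using \<eta> by (intro power_le_exp) simp
  also have "\<dots> \<le> exp (- ln (1 / q0))" using n(1) \<eta> by (simp add: field_simps)
  also have "\<dots> = q0" using q0 by (simp add: exp_minus)
  finally show ?thesis using n(2) by (intro exI[of _ n]) auto
qed

lemma geo_learner_blocks:
  assumes \<Delta>: "0 < \<Delta>" "\<Delta> \<le> 1 / 2" and \<delta>: "0 < \<delta>" "\<delta> < 1" and q0: "0 < q0" "q0 \<le> 1" and \<eta>: "0 < \<eta>" "\<eta> < 1"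
    and n: "(1 - \<eta>) ^ n \<le> q0"
    and Class: "\<And>D. Class D \<Longrightarrow> value_dist D" "\<And>D. Class D \<Longrightarrow> {x. Goal D x} \<in> sets borel"
    and Goal: "\<And>D x. Class D \<Longrightarrow> (\<And>p. 0 \<le> p \<Longrightarrow> q0 \<le> quant D p \<Longrightarrow> (1 - \<eta>)\<^sup>2 * rev D p \<le> rev D x) \<Longrightarrow> Goal D x"
  shows "\<exists>N Q P. real N \<le> 3 * real (Suc n) * ln (2 * real (Suc n) / \<delta>) * (1 + \<Delta> / (\<eta> * q0)) \<and> learns \<Delta> N Q P Class Goal \<delta>"
proof (rule grid_learner_blocks[where lo = "\<lambda>j. (1 - \<eta>) * geo q0 \<eta> j" and hi = "geo q0 \<eta>", OF \<Delta> \<delta> _ _ _ Class])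
  fix j assume "j < Suc n"
  have g: "q0 \<le> geo q0 \<eta> j" "geo q0 \<eta> j \<le> 1" using q0 \<eta> by (auto simp: geo_def power_le_one)
  have "\<eta> * q0 \<le> \<eta> * geo q0 \<eta> j" using g \<eta> by (intro mult_left_mono) auto
  then show "0 < (1 - \<eta>) * geo q0 \<eta> j \<and> geo q0 \<eta> j \<le> 1 \<and> \<eta> * q0 \<le> geo q0 \<eta> j - (1 - \<eta>) * geo q0 \<eta> j"
    using g q0 \<eta> by (auto simp: algebra_simps intro!: mult_strict_right_mono[of \<eta> 1, simplified])
next
  fix D x assume D: "Class D" and V: "\<And>j. j < Suc n \<Longrightarrow> (1 - \<eta>) * geo q0 \<eta> j * val_at D (geo q0 \<eta> j) \<le> rev D x"
  show "Goal D x"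
    by (rule Goal[OF D geo_guarantee[OF Class(1)[OF D] q0(1) \<eta> n V]])
qed (use q0 \<eta> in auto)

text \<open>For brackets of relative width \<open>\<eta>\<close> the ratio
  \<open>hi / (hi - lo)\<^sup>2\<close> equals \<open>1 / (\<eta>\<^sup>2 * hi)\<close>, which is
  largest at the floor.\<close>

lemma geo_learner_one_block:
  assumes \<Delta>: "\<Delta> \<le> 1" and \<delta>: "0 < \<delta>" "\<delta> < 1" and q0: "0 < q0" "q0 \<le> 1" and \<eta>: "0 < \<eta>" "\<eta> < 1"
    and n: "(1 - \<eta>) ^ n \<le> q0"
    and Class: "\<And>D. Class D \<Longrightarrow> value_dist D" "\<And>D. Class D \<Longrightarrow> {x. Goal D x} \<in> sets borel"
    and Goal: "\<And>D x. Class D \<Longrightarrow> (\<And>p. 0 \<le> p \<Longrightarrow> q0 \<le> quant D p \<Longrightarrow> (1 - \<eta>)\<^sup>2 * rev D p \<le> rev D x) \<Longrightarrow> Goal D x"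
  shows "\<exists>N Q P. real N \<le> 18 * (1 / (\<eta>\<^sup>2 * q0)) * ln (2 * real (Suc n) / \<delta>) \<and> learns \<Delta> N Q P Class Goal \<delta>"
proof (rule grid_learner_one_block[where lo = "\<lambda>j. (1 - \<eta>) * geo q0 \<eta> j" and hi = "geo q0 \<eta>", OF \<Delta> \<delta> _ _ _ Class])
  have "\<eta>\<^sup>2 * q0 \<le> 1 * 1" using \<eta> q0 by (intro mult_mono) (auto simp: power_le_one)
  then show "1 \<le> 1 / (\<eta>\<^sup>2 * q0)" using \<eta> q0 by simp
  fix j assume "j < Suc n"
  have g: "q0 \<le> geo q0 \<eta> j" "geo q0 \<eta> j \<le> 1" using q0 \<eta> by (auto simp: geo_def power_le_one)
  have gp: "0 < geo q0 \<eta> j" using g q0 by linarith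
  have "geo q0 \<eta> j * q0 \<le> geo q0 \<eta> j * geo q0 \<eta> j" using g gp by (intro mult_left_mono) auto
  then have "geo q0 \<eta> j \<le> 1 / (\<eta>\<^sup>2 * q0) * (geo q0 \<eta> j - (1 - \<eta>) * geo q0 \<eta> j)\<^sup>2"
    using \<eta> q0 by (simp add: field_simps power2_eq_square)
  moreover have "(1 - \<eta>) * geo q0 \<eta> j < 1 * geo q0 \<eta> j" "0 < (1 - \<eta>) * geo q0 \<eta> j"
    using \<eta> gp by (intro mult_strict_right_mono, simp_all)
  ultimately show "0 < (1 - \<eta>) * geo q0 \<eta> j \<and> (1 - \<eta>) * geo q0 \<eta> j < geo q0 \<eta> j \<and> geo q0 \<eta> j \<le> 1 \<and>
      geo q0 \<eta> j \<le> 1 / (\<eta>\<^sup>2 * q0) * (geo q0 \<eta> j - (1 - \<eta>) * geo q0 \<eta> j)\<^sup>2"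
    using g by simp
next
  fix D x assume D: "Class D" and V: "\<And>j. j < Suc n \<Longrightarrow> (1 - \<eta>) * geo q0 \<eta> j * val_at D (geo q0 \<eta> j) \<le> rev D x"
  show "Goal D x"
    by (rule Goal[OF D geo_guarantee[OF Class(1)[OF D] q0(1) \<eta> n V]])
qed auto

subsection \<open>The four families\<close>

lemma logs_nonneg:
  fixes \<epsilon> \<delta> :: real assumes "0 < \<epsilon>" "\<epsilon> < 1" "0 < \<delta>" "\<delta> < 1"
  shows "0 \<le> ln (1 / \<epsilon>)" "0 \<le> ln (1 / \<delta>)"
proof -
  show "0 \<le> ln (1 / \<epsilon>)" using assms by (intro ln_ge_zero) simp
  show "0 \<le> ln (1 / \<delta>)" using assms by (intro ln_ge_zero) simp
qed

lemma ternary_learner_blocks: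
  assumes \<Delta>: "0 < \<Delta>" "\<Delta> \<le> 1 / 2" and \<delta>: "0 < \<delta>" "\<delta> < 1" and \<eta>: "0 < \<eta>" "\<eta> \<le> 1 / 8" and q0: "0 < q0" "q0 < 1"
    and T: "(2 / 3) ^ T \<le> \<eta> * q0"
    and Class: "\<And>D. Class D \<Longrightarrow> concave_revenue q0 \<eta> D"
  shows "\<exists>N Q P. real N \<le> 3 * real (3 * Suc T) * ln (2 * real (3 * Suc T) / \<delta>) * (1 + \<Delta> / (\<eta> * q0))
    \<and> learns \<Delta> N Q P Class (mult_goal (8 * \<eta>)) \<delta>"
proof -
  have vd: "value_dist D" if "Class D" for D using Class[OF that] by (simp add: concave_revenue_def)
  have w: "0 < \<eta> * q0" using \<eta> q0 by simp
  obtain m \<rho> where m: "0 < m" and \<rho>: "0 \<le> \<rho>" "\<rho> \<le> 1" "2 * real (3 * Suc T) * (1 - \<rho>) ^ m \<le> \<delta>" "\<rho> * \<Delta> \<le> \<eta> * q0"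
    and N: "real (3 * Suc T * m) \<le> 3 * real (3 * Suc T) * ln (2 * real (3 * Suc T) / \<delta>) * (1 + \<Delta> / (\<eta> * q0))"
    using block_size[OF _ \<delta> \<Delta>(1) w, of "3 * Suc T"] by auto
  have "\<exists>Q P. learns \<Delta> (3 * Suc T * m) Q P Class (mult_goal (8 * \<eta>)) \<delta>"
  proof (rule block_learner[where B = "probe q0 \<eta>", OF \<Delta> m \<rho>(1-3)])
    show "0 < fst (probe q0 \<eta> xs) \<and> fst (probe q0 \<eta> xs) < snd (probe q0 \<eta> xs) \<and> snd (probe q0 \<eta> xs) \<le> 1
        \<and> \<rho> * \<Delta> \<le> snd (probe q0 \<eta> xs) - fst (probe q0 \<eta> xs)" for xs
    proof -
      define x where "x = probe_point q0 xs (length xs)"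
      have x: "q0 \<le> x" "x \<le> 1" unfolding x_def using q0 by (auto intro: probe_point_bounds)
      have "\<eta> * q0 \<le> \<eta> * x" using x \<eta> by (intro mult_left_mono) auto
      moreover have "0 < (1 - \<eta>) * x" using x \<eta> q0 by simp
      moreover have "(1 - \<eta>) * x = x - \<eta> * x" by (simp add: algebra_simps)
      ultimately show ?thesis using \<rho>(4) w x unfolding probe_def x_def[symmetric] fst_conv snd_conv by linarith
    qed
    show "lmeas (sample_space (3 * Suc T * m)) r (\<lambda>xs. fst (probe q0 \<eta> xs))"
      "lmeas (sample_space (3 * Suc T * m)) r (\<lambda>xs. snd (probe q0 \<eta> xs))" for r
      by (rule probe_measurable)+
    show "value_dist D" "{x. mult_goal (8 * \<eta>) D x} \<in> sets borel" if "Class D" for D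
      using vd[OF that] by (auto intro: mult_goal_borel)
    fix D x and xs :: "real list"
    assume D: "Class D" and xs: "length xs = 3 * Suc T"
      and br: "\<And>r. r < 3 * Suc T \<Longrightarrow> brackets D (probe q0 \<eta> (take r xs)) (xs ! r)"
      and V: "\<And>r. r < 3 * Suc T \<Longrightarrow> fst (probe q0 \<eta> (take r xs)) * xs ! r \<le> rev D x"
    have all: "(1 - 8 * \<eta>) * rev D p \<le> rev D x" if "0 \<le> p" for p
      by (rule ternary_search[OF Class[OF D] \<eta> q0 xs T br V that])
    show "mult_goal (8 * \<eta>) D x"
    proof (cases "8 * \<eta> < 1")
      case True then show ?thesis using all by (rule mult_goalI)
    next
      \<comment> \<open>\<open>mult_goalI\<close> divides by \<open>1 - 8 * \<eta>\<close>. When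
        that is 0, the goal asks only for nonnegative revenue.\<close>
      case False
      then have "8 * \<eta> = 1" using \<eta> by linarith
      moreover have "0 \<le> rev D x" using all[of 0] by (simp add: rev_def)
      ultimately show ?thesis by (simp add: mult_goal_def)
    qed
  qed
  then show ?thesis using N by blast
qed

text \<open>Three factors \<open>1 - \<eta>\<close> are lost, to the grid, the bracket and the
  floor. Stating the weaker \<open>1 - 8 * \<eta>\<close> lets both regimes share one
  \<open>\<eta>\<close>.\<close>

lemma geometric_learner_one_block:
  assumes \<Delta>: "\<Delta> \<le> 1" and \<delta>: "0 < \<delta>" "\<delta> < 1" and \<eta>: "0 < \<eta>" "\<eta> < 1 / 8" and q0: "0 < q0" "q0 < 1"
    and n: "(1 - \<eta>) ^ n \<le> q0"
    and Class: "\<And>D. Class D \<Longrightarrow> concave_revenue q0 \<eta> D"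
  shows "\<exists>N Q P. real N \<le> 18 * (1 / (\<eta>\<^sup>2 * q0)) * ln (2 * real (Suc n) / \<delta>)
    \<and> learns \<Delta> N Q P Class (mult_goal (8 * \<eta>)) \<delta>"
proof (rule geo_learner_one_block[OF \<Delta> \<delta> _ _ _ _ n])
  show vd: "value_dist D" if "Class D" for D using Class[OF that] by (simp add: concave_revenue_def)
  then show "{x. mult_goal (8 * \<eta>) D x} \<in> sets borel" if "Class D" for D using that by (intro mult_goal_borel)
  fix D x assume D: "Class D" and V: "\<And>p. 0 \<le> p \<Longrightarrow> q0 \<le> quant D p \<Longrightarrow> (1 - \<eta>)\<^sup>2 * rev D p \<le> rev D x"
  have small: "(1 - \<eta>) * rev D p \<le> rev D (val_at D q0)" if "0 \<le> p" "quant D p < q0" for p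
    using Class[OF D] that by (simp add: concave_revenue_def)
  show "mult_goal (8 * \<eta>) D x"
  proof (rule mult_goalI)
    fix p :: real assume p: "0 \<le> p"
    have "(1 - \<eta>)\<^sup>2 * ((1 - \<eta>) * rev D p) \<le> rev D x"
    proof (cases "q0 \<le> quant D p")
      case True
      have "(1 - \<eta>) * rev D p \<le> 1 * rev D p" using rev_nonneg[OF p] \<eta> by (intro mult_right_mono) auto
      then have "(1 - \<eta>)\<^sup>2 * ((1 - \<eta>) * rev D p) \<le> (1 - \<eta>)\<^sup>2 * rev D p" by (intro mult_left_mono) auto
      then show ?thesis using V[OF p True] by linarith
    next
      case False
      have "(1 - \<eta>)\<^sup>2 * ((1 - \<eta>) * rev D p) \<le> (1 - \<eta>)\<^sup>2 * rev D (val_at D q0)"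
        using small[OF p] False by (intro mult_left_mono) auto
      also have "\<dots> \<le> rev D x"
        using q0 by (intro V val_at_nonneg[OF vd[OF D]] quant_val_at[OF vd[OF D]]) auto
      finally show ?thesis .
    qed
    moreover have "(1 - 8 * \<eta>) * rev D p \<le> ((1 - \<eta>)\<^sup>2 * (1 - \<eta>)) * rev D p"
    proof (rule mult_right_mono[OF _ rev_nonneg[OF p]])
      have "\<eta> * \<eta>\<^sup>2 \<le> \<eta> * 1" using \<eta> by (intro mult_left_mono) (auto simp: power_le_one)
      then have "1 - 8 * \<eta> \<le> 1 - 3 * \<eta> - \<eta> * \<eta>\<^sup>2" using \<eta> by linarith
      also have "\<dots> \<le> (1 - \<eta>)\<^sup>2 * (1 - \<eta>)" by (simp add: power2_eq_square algebra_simps)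
      finally show "1 - 8 * \<eta> \<le> (1 - \<eta>)\<^sup>2 * (1 - \<eta>)" .
    qed
    ultimately show "(1 - 8 * \<eta>) * rev D p \<le> rev D x" by (simp add: mult.assoc)
  qed (use \<eta> in simp)
qed (use \<eta> q0 in auto)

lemma round_count:
  assumes "0 < y" "y \<le> (1::real)"
  shows "\<exists>T. (2 / 3) ^ T \<le> y \<and> real T \<le> 3 * ln (1 / y) + 1"
proof -
  define T where "T = nat \<lceil>3 * ln (1 / y)\<rceil>"
  have "0 \<le> ln (1 / y)" using assms by (intro ln_ge_zero) auto
  then have T: "3 * ln (1 / y) \<le> real T" "real T \<le> 3 * ln (1 / y) + 1" unfolding T_def by linarith+
  have "(2 / 3) ^ T \<le> exp (- (1 / 3 * real T))" using power_le_exp[of "1 / 3" T] by simp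
  also have "\<dots> \<le> exp (- ln (1 / y))" using T(1) by simp
  also have "\<dots> = y" using assms by (simp add: exp_minus)
  finally show ?thesis using T(2) by blast
qed

lemma ln_const_div_le:
  assumes "1 \<le> c" "0 < (\<epsilon>::real)" "\<epsilon> < 1" "1 + ln (1 / \<epsilon>) \<le> \<Lambda>"
  shows "ln (c / \<epsilon>) \<le> c * \<Lambda>"
proof -
  have e: "0 \<le> ln (1 / \<epsilon>)" using assms by (intro ln_ge_zero) auto
  then have "1 \<le> \<Lambda>" using assms(4) by linarith
  have "ln (c / \<epsilon>) = ln c + ln (1 / \<epsilon>)" using assms by (simp add: ln_div)
  also have "\<dots> \<le> (c - 1) * 1 + \<Lambda>" using ln_le_minus_one[of c] assms by simp
  also have "\<dots> \<le> (c - 1) * \<Lambda> + \<Lambda>" using assms(1) \<open>1 \<le> \<Lambda>\<close> by (intro add_right_mono mult_left_mono) auto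
  finally show ?thesis by (simp add: algebra_simps)
qed

text \<open>\<open>M\<close> stands for the target rate. Up to constants and logarithms it has to
  dominate the cost of one bracket for small \<open>\<Delta>\<close> and of sampling all of
  \<open>[0,1]\<close> for large \<open>\<Delta>\<close>. The bound
  \<open>\<epsilon> / 8 \<le> q0\<close> keeps \<open>ln (1 / q0)\<close> of order
  \<open>\<Lambda>\<close>.\<close>

lemma concave_family_learner:
  assumes \<epsilon>: "0 < \<epsilon>" "\<epsilon> < 1" and \<Delta>: "0 < \<Delta>" "\<Delta> < 1" and \<delta>: "0 < \<delta>" "\<delta> < 1"
    and q0: "\<epsilon> / 8 \<le> q0" "q0 < 1"
    and Class: "\<And>D. Class D \<Longrightarrow> concave_revenue q0 (\<epsilon> / 8) D"
    and M: "\<Delta> \<le> 1 / 2 \<Longrightarrow> 1 + \<Delta> / (\<epsilon> / 8 * q0) \<le> 500 * M" "1 / 2 < \<Delta> \<Longrightarrow> 1 / ((\<epsilon> / 8)\<^sup>2 * q0) \<le> 4000 * M"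
  shows "\<exists>N Q P. real N \<le> 10 ^ 10 * (1 + ln (1 / \<epsilon>) + ln (1 / \<delta>)) ^ 2 * M \<and> learns \<Delta> N Q P Class (mult_goal \<epsilon>) \<delta>"
proof -
  define \<Lambda> where "\<Lambda> = 1 + ln (1 / \<epsilon>) + ln (1 / \<delta>)"
  define \<eta> where "\<eta> = \<epsilon> / 8"
  have logs: "0 \<le> ln (1 / \<epsilon>)" "0 \<le> ln (1 / \<delta>)" using logs_nonneg[OF \<epsilon> \<delta>] .
  have \<Lambda>: "1 \<le> \<Lambda>" "1 + ln (1 / \<epsilon>) \<le> \<Lambda>" using logs by (auto simp: \<Lambda>_def)
  have \<eta>: "0 < \<eta>" "\<eta> < 1 / 8" "8 * \<eta> = \<epsilon>" using \<epsilon> by (auto simp: \<eta>_def)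
  have q0': "0 < q0" using q0 \<epsilon> by linarith
  show ?thesis
  proof (cases "\<Delta> \<le> 1 / 2")
    case True
    have y: "0 < \<eta> * q0" "\<eta> * q0 \<le> 1" using \<eta> q0 q0' mult_mono[of \<eta> 1 q0 1] by auto
    obtain T where T: "(2 / 3) ^ T \<le> \<eta> * q0" "real T \<le> 3 * ln (1 / (\<eta> * q0)) + 1"
      using round_count[OF y] by blast
    have "\<eta> * (\<epsilon> / 8) \<le> \<eta> * q0" using q0 \<eta> by (intro mult_left_mono) auto
    then have "1 / (\<eta> * q0) \<le> 1 / (\<eta> * (\<epsilon> / 8))" using \<eta> \<epsilon> by (intro divide_left_mono) auto
    also have "\<dots> = (8 / \<epsilon>) * (8 / \<epsilon>)" using \<epsilon> by (simp add: \<eta>_def)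
    finally have "ln (1 / (\<eta> * q0)) \<le> ln ((8 / \<epsilon>) * (8 / \<epsilon>))" using y \<epsilon> by simp
    also have "\<dots> = ln (8 / \<epsilon>) + ln (8 / \<epsilon>)" using \<epsilon> by (intro ln_mult_pos) auto
    also have "\<dots> \<le> 16 * \<Lambda>" using ln_const_div_le[of 8 \<epsilon> \<Lambda>] \<epsilon> \<Lambda> by simp
    finally have TL: "real (3 * Suc T) \<le> 150 * \<Lambda>" using T(2) \<Lambda> by simp
    have "150 * \<Lambda> \<le> 150 * (\<Lambda> / \<epsilon>)" using \<epsilon> \<Lambda> by (simp add: field_simps)
    then have l: "ln (2 * real (3 * Suc T) / \<delta>) \<le> 301 * \<Lambda>"
      using log_count_le[of "real (3 * Suc T)" 150 \<Lambda> \<epsilon> \<delta>] TL \<Lambda> \<epsilon> \<delta> unfolding \<Lambda>_def by simp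
    have l0: "0 \<le> ln (2 * real (3 * Suc T) / \<delta>)"
      using ln_two_div_gt_half[of "real (3 * Suc T)" \<delta>] \<delta> by simp
    obtain N Q P where N: "real N \<le> 3 * real (3 * Suc T) * ln (2 * real (3 * Suc T) / \<delta>) * (1 + \<Delta> / (\<eta> * q0))"
      and L: "learns \<Delta> N Q P Class (mult_goal (8 * \<eta>)) \<delta>"
      using ternary_learner_blocks[OF \<Delta>(1) True \<delta> \<eta>(1) less_imp_le[OF \<eta>(2)] q0' q0(2) T(1) Class[folded \<eta>_def]]
      by blast
    have "3 * real (3 * Suc T) * ln (2 * real (3 * Suc T) / \<delta>) * (1 + \<Delta> / (\<eta> * q0))
        \<le> 3 * (150 * \<Lambda>) * (301 * \<Lambda>) * (500 * M)"
      using TL l l0 M(1)[OF True] \<Lambda> \<Delta> y by (intro mult_mono) (auto simp: \<eta>_def)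
    also have "\<dots> = 67725000 * (\<Lambda>\<^sup>2 * M)" by (simp add: power2_eq_square)
    also have "\<dots> \<le> 10 ^ 10 * (\<Lambda>\<^sup>2 * M)"
    proof (rule mult_right_mono)
      have "0 \<le> 1 + \<Delta> / (\<eta> * q0)" using y \<Delta> by simp
      then have "0 \<le> M" using M(1)[OF True] by (simp add: \<eta>_def)
      then show "0 \<le> \<Lambda>\<^sup>2 * M" by simp
    qed simp
    finally have "real N \<le> 10 ^ 10 * (\<Lambda>\<^sup>2 * M)" using N by (rule order_trans[rotated])
    then have "real N \<le> 10 ^ 10 * \<Lambda> ^ 2 * M" by (simp only: mult.assoc)
    then show ?thesis using L unfolding \<Lambda>_def \<eta>(3) by blast
  next
    case False
    obtain n where n: "(1 - \<eta>) ^ n \<le> q0" "real (Suc n) \<le> 2 + ln (1 / q0) / \<eta>"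
      using geo_length[OF q0' _ \<eta>(1)] \<eta> q0 by auto
    have "1 / q0 \<le> 8 / \<epsilon>" using q0 q0' \<epsilon> by (simp add: field_simps)
    then have "ln (1 / q0) \<le> ln (8 / \<epsilon>)" using q0' \<epsilon> by simp
    also have "\<dots> \<le> 8 * \<Lambda>" using ln_const_div_le[of 8 \<epsilon> \<Lambda>] \<epsilon> \<Lambda> by simp
    finally have "ln (1 / q0) / \<eta> \<le> 8 * \<Lambda> / \<eta>" using \<eta> by (intro divide_right_mono) auto
    also have "\<dots> = 64 * (\<Lambda> / \<epsilon>)" by (simp add: \<eta>_def)
    finally have "real (Suc n) \<le> 66 * (\<Lambda> / \<epsilon>)"
    proof -
      assume a: "ln (1 / q0) / \<eta> \<le> 64 * (\<Lambda> / \<epsilon>)"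
      have "1 \<le> \<Lambda> / \<epsilon>" using \<Lambda> \<epsilon> by (simp add: field_simps)
      then show ?thesis using a n(2) by linarith
    qed
    then have l: "ln (2 * real (Suc n) / \<delta>) \<le> 133 * \<Lambda>"
      using log_count_le[of "real (Suc n)" 66 \<Lambda> \<epsilon> \<delta>] \<Lambda> \<epsilon> \<delta> unfolding \<Lambda>_def by simp
    have l0: "0 \<le> ln (2 * real (Suc n) / \<delta>)"
      using ln_two_div_gt_half[of "real (Suc n)" \<delta>] \<delta> by simp
    obtain N Q P where N: "real N \<le> 18 * (1 / (\<eta>\<^sup>2 * q0)) * ln (2 * real (Suc n) / \<delta>)"
      and L: "learns \<Delta> N Q P Class (mult_goal (8 * \<eta>)) \<delta>"
      using geometric_learner_one_block[OF less_imp_le[OF \<Delta>(2)] \<delta> \<eta>(1,2) q0' q0(2) n(1) Class[folded \<eta>_def]] by blast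
    have M0: "1 / (\<eta>\<^sup>2 * q0) \<le> 4000 * M" using M(2) False by (simp add: \<eta>_def)
    have "0 \<le> 1 / (\<eta>\<^sup>2 * q0)" using q0' by simp
    then have Mp: "0 \<le> M" using M0 by linarith
    have "18 * (1 / (\<eta>\<^sup>2 * q0)) * ln (2 * real (Suc n) / \<delta>) \<le> 18 * (4000 * M) * (133 * \<Lambda>)"
      using l l0 M0 Mp q0' by (intro mult_mono) auto
    also have "\<dots> = 9576000 * M * \<Lambda>" by simp
    also have "\<dots> \<le> 9576000 * M * \<Lambda>\<^sup>2"
      using Mp \<Lambda> self_le_power[of \<Lambda> 2] by (intro mult_left_mono) auto
    also have "\<dots> = 9576000 * (\<Lambda>\<^sup>2 * M)" by simp
    also have "\<dots> \<le> 10 ^ 10 * (\<Lambda>\<^sup>2 * M)" using Mp by (intro mult_right_mono) auto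
    finally have "real N \<le> 10 ^ 10 * (\<Lambda>\<^sup>2 * M)" using N by (rule order_trans[rotated])
    then have "real N \<le> 10 ^ 10 * \<Lambda> ^ 2 * M" by (simp only: mult.assoc)
    then show ?thesis using L unfolding \<Lambda>_def \<eta>(3) by blast
  qed
qed

text \<open>For small \<open>\<Delta>\<close> a bracket costs about \<open>1 + a\<close> with
  \<open>a = \<Delta> / \<epsilon>\<^sup>2\<close>; once \<open>a\<close> exceeds 1 it is below both
  \<open>a * a\<close> and \<open>\<Delta> / \<epsilon>^3\<close>. For large \<open>\<Delta>\<close>
  both terms of the minimum are at least \<open>1 / \<epsilon>^3\<close> up to a constant.\<close>

lemma regular_learner:
  assumes \<epsilon>: "0 < \<epsilon>" "\<epsilon> < 1" and \<Delta>: "0 < \<Delta>" "\<Delta> < 1" and \<delta>: "0 < \<delta>" "\<delta> < 1"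
  shows "\<exists>N Q P. real N \<le> 10 ^ 10 * (1 + ln (1 / \<epsilon>) + ln (1 / \<delta>)) ^ 2 * max 1 (min (\<Delta>^2 / \<epsilon>^4) (\<Delta> / \<epsilon>^3))
    \<and> learns \<Delta> N Q P regular_dist (mult_goal \<epsilon>) \<delta>"
proof (rule concave_family_learner[OF \<epsilon> \<Delta> \<delta>, of "\<epsilon> / 8"])
  show "concave_revenue (\<epsilon> / 8) (\<epsilon> / 8) D" if "regular_dist D" for D
    using that \<epsilon> by (intro regular_concave_revenue) auto
  let ?M = "max 1 (min (\<Delta>^2 / \<epsilon>^4) (\<Delta> / \<epsilon>^3))"
  show "1 + \<Delta> / (\<epsilon> / 8 * (\<epsilon> / 8)) \<le> 500 * ?M"
  proof -
    define a where "a = \<Delta> / \<epsilon>\<^sup>2"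
    have a0: "0 \<le> a" using \<Delta> by (simp add: a_def)
    have "a \<le> ?M"
    proof (cases "a \<le> 1")
      case False
      have "a * 1 \<le> a * a" using False by (intro mult_left_mono) auto
      also have "a * a = \<Delta>^2 / \<epsilon>^4" by (simp add: a_def power2_eq_square power4_eq_xxxx)
      finally have "a \<le> \<Delta>^2 / \<epsilon>^4" by simp
      moreover have "a \<le> \<Delta> / \<epsilon>^3"
        unfolding a_def using \<epsilon> \<Delta> by (intro divide_left_mono power_decreasing) auto
      ultimately show ?thesis by simp
    qed simp
    moreover have "\<Delta> / (\<epsilon> / 8 * (\<epsilon> / 8)) = 64 * a" by (simp add: a_def power2_eq_square)
    moreover have "1 \<le> ?M" by simp
    ultimately show ?thesis by linarith
  qed
  show "1 / ((\<epsilon> / 8)\<^sup>2 * (\<epsilon> / 8)) \<le> 4000 * ?M" if "1 / 2 < \<Delta>"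
  proof -
    have "1 / \<epsilon>^3 \<le> 4 * (\<Delta> / \<epsilon>^3)" using that \<epsilon> by (simp add: field_simps)
    moreover have "1 / \<epsilon>^3 \<le> 4 * (\<Delta>^2 / \<epsilon>^4)"
    proof -
      have "1 / \<epsilon>^3 \<le> 1 / \<epsilon>^4" using \<epsilon> by (intro divide_left_mono power_decreasing) auto
      also have "\<dots> \<le> 4 * \<Delta>^2 / \<epsilon>^4"
        using that \<epsilon> mult_mono[of "1 / 2" \<Delta> "1 / 2" \<Delta>] by (intro divide_right_mono) (auto simp: power2_eq_square)
      finally show ?thesis by simp
    qed
    ultimately have "1 / \<epsilon>^3 \<le> 4 * ?M" by (auto simp: max_def min_def)
    moreover have "1 / ((\<epsilon> / 8)\<^sup>2 * (\<epsilon> / 8)) = 512 * (1 / \<epsilon>^3)" by (simp add: power2_eq_square power3_eq_cube)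
    moreover have "0 \<le> ?M" by simp
    ultimately show ?thesis by linarith
  qed
qed (use \<epsilon> in auto)

lemma mhr_learner:
  assumes \<epsilon>: "0 < \<epsilon>" "\<epsilon> < 1" and \<Delta>: "0 < \<Delta>" "\<Delta> < 1" and \<delta>: "0 < \<delta>" "\<delta> < 1"
  shows "\<exists>N Q P. real N \<le> 10 ^ 10 * (1 + ln (1 / \<epsilon>) + ln (1 / \<delta>)) ^ 2 * max 1 (\<Delta>^2 / \<epsilon>^2)
    \<and> learns \<Delta> N Q P mhr_dist (mult_goal \<epsilon>) \<delta>"
proof (rule concave_family_learner[OF \<epsilon> \<Delta> \<delta>, of "1 / 4"])
  show "concave_revenue (1 / 4) (\<epsilon> / 8) D" if "mhr_dist D" for D
    using that \<epsilon> by (intro mhr_concave_revenue) auto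
  let ?M = "max 1 (\<Delta>^2 / \<epsilon>^2)"
  show "1 + \<Delta> / (\<epsilon> / 8 * (1 / 4)) \<le> 500 * ?M"
  proof -
    define a where "a = \<Delta> / \<epsilon>"
    have "a \<le> ?M"
    proof (cases "a \<le> 1")
      case False
      then have "a * 1 \<le> a * a" by (intro mult_left_mono) auto
      then show ?thesis by (simp add: a_def power2_eq_square)
    qed simp
    moreover have "\<Delta> / (\<epsilon> / 8 * (1 / 4)) = 32 * a" by (simp add: a_def)
    moreover have "1 \<le> ?M" by simp
    ultimately show ?thesis by linarith
  qed
  show "1 / ((\<epsilon> / 8)\<^sup>2 * (1 / 4)) \<le> 4000 * ?M" if "1 / 2 < \<Delta>"
  proof -
    have "1 / \<epsilon>\<^sup>2 \<le> 4 * \<Delta>^2 / \<epsilon>^2"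
      using that \<epsilon> mult_mono[of "1 / 2" \<Delta> "1 / 2" \<Delta>] by (intro divide_right_mono) (auto simp: power2_eq_square)
    then have "1 / \<epsilon>\<^sup>2 \<le> 4 * ?M" by simp
    moreover have "1 / ((\<epsilon> / 8)\<^sup>2 * (1 / 4)) = 256 * (1 / \<epsilon>\<^sup>2)" by (simp add: power2_eq_square)
    moreover have "0 \<le> ?M" by simp
    ultimately show ?thesis by linarith
  qed
qed (use \<epsilon> in auto)

section \<open>Values in a bounded range\<close>

lemma quant_above_bound:
  assumes "bounded_dist lo hi D" "hi < p" shows "quant D p = 0"
proof -
  have D: "value_dist D" and m: "measure D {lo..hi} = 1" using assms by (auto simp: bounded_dist_def)
  interpret prob_space D using value_distD[OF D] by simp
  have "measure D ({lo..hi} \<union> {p..}) = measure D {lo..hi} + measure D {p..}"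
    using assms(2) by (intro finite_measure_Union) (auto simp: value_distD[OF D])
  then have "measure D {p..} \<le> 0" using m prob_le_1[of "{lo..hi} \<union> {p..}"] by linarith
  then have "measure D {p..} = 0" using measure_nonneg[of D "{p..}"] by linarith
  then show ?thesis by (simp add: quant_def atLeast_def)
qed

text \<open>Price 1 always sells and earns 1. A price selling with probability below
  \<open>1 / H\<close> is at most \<open>H\<close> or never sells, so it earns at most 1; this
  justifies the floor \<open>1 / H\<close>.\<close>

lemma multiplicative_bounded_goal:
  assumes D: "bounded_dist 1 H D" and H: "1 \<le> H" and \<epsilon>: "0 < \<epsilon>" "\<epsilon> < 1"
    and V: "\<And>p. 0 \<le> p \<Longrightarrow> 1 / H \<le> quant D p \<Longrightarrow> (1 - \<epsilon> / 2)\<^sup>2 * rev D p \<le> rev D x"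
  shows "mult_goal \<epsilon> D x"
proof (rule mult_goalI[OF \<epsilon>(2)])
  fix p :: real assume p: "0 \<le> p"
  have vd: "value_dist D" and m: "measure D {1..H} = 1" using D by (auto simp: bounded_dist_def)
  interpret prob_space D using value_distD[OF vd] by simp
  have "measure D {1..H} \<le> quant D 1"
    unfolding quant_def by (intro finite_measure_mono) (auto simp: value_distD[OF vd])
  then have q1: "quant D 1 = 1" using m quant_le_1[OF vd, of 1] by simp
  have V1: "(1 - \<epsilon> / 2)\<^sup>2 \<le> rev D x" using V[of 1] q1 H by (simp add: rev_def)
  have "(1 - \<epsilon> / 2)\<^sup>2 * rev D p \<le> rev D x"
  proof (cases "1 / H \<le> quant D p")
    case True then show ?thesis by (rule V[OF p])
  next
    case False
    have "rev D p \<le> 1"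
    proof (cases "p \<le> H")
      case True
      have "rev D p \<le> H * (1 / H)" unfolding rev_def using True False p H by (intro mult_mono) auto
      then show ?thesis using H by simp
    next
      case False
      then show ?thesis using quant_above_bound[OF D, of p] by (simp add: rev_def)
    qed
    then have "(1 - \<epsilon> / 2)\<^sup>2 * rev D p \<le> (1 - \<epsilon> / 2)\<^sup>2 * 1" by (intro mult_left_mono) auto
    then show ?thesis using V1 by simp
  qed
  moreover have "(1 - \<epsilon>) * rev D p \<le> (1 - \<epsilon> / 2)\<^sup>2 * rev D p"
    using rev_nonneg[OF p] by (intro mult_right_mono) (auto simp: power2_eq_square algebra_simps)
  ultimately show "(1 - \<epsilon>) * rev D p \<le> rev D x" by linarith
qed

lemma multiplicative_bounded_learner:
  assumes \<epsilon>: "0 < \<epsilon>" "\<epsilon> < 1" and \<Delta>: "0 < \<Delta>" "\<Delta> < 1" and \<delta>: "0 < \<delta>" "\<delta> < 1" and H: "1 \<le> H"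
  shows "\<exists>N Q P. real N \<le> 10 ^ 10 * (1 + ln (1 / \<epsilon>) + ln (1 / \<delta>) + ln H) ^ 2 * max (sqrt H / \<epsilon>) (\<Delta> * H / \<epsilon>^2)
    \<and> learns \<Delta> N Q P (bounded_dist 1 H) (mult_goal \<epsilon>) \<delta>"
proof -
  define \<Lambda> where "\<Lambda> = 1 + ln (1 / \<epsilon>) + ln (1 / \<delta>) + ln H"
  define M where "M = max (sqrt H / \<epsilon>) (\<Delta> * H / \<epsilon>^2)"
  define \<eta> where "\<eta> = \<epsilon> / 2"
  have logs: "0 \<le> ln (1 / \<epsilon>)" "0 \<le> ln (1 / \<delta>)" "0 \<le> ln H" using logs_nonneg[OF \<epsilon> \<delta>] H by auto
  have \<Lambda>: "1 \<le> \<Lambda>" "ln H \<le> \<Lambda>" using logs by (auto simp: \<Lambda>_def)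
  have \<eta>: "0 < \<eta>" "\<eta> < 1" using \<epsilon> by (auto simp: \<eta>_def)
  have q0: "0 < 1 / H" "1 / H \<le> 1" using H by auto
  \<comment> \<open>With about \<open>\<Lambda> / \<epsilon>\<close> grid points, the constant part
    of the cost per block is charged to \<open>sqrt H / \<epsilon>\<close> and the part proportional
    to \<open>\<Delta>\<close> to the other term.\<close>
  have "1 / \<epsilon> \<le> sqrt H / \<epsilon>" using \<epsilon> H by (intro divide_right_mono) auto
  then have M: "1 / \<epsilon> \<le> M" "\<Delta> * H / \<epsilon>\<^sup>2 \<le> M" "0 \<le> M" using \<epsilon> H by (auto simp: M_def le_max_iff_disj)
  obtain n where n: "(1 - \<eta>) ^ n \<le> 1 / H" "real (Suc n) \<le> 2 + ln (1 / (1 / H)) / \<eta>"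
    using geo_length[OF q0 \<eta>] by blast
  have "1 \<le> \<Lambda> / \<epsilon>" using \<Lambda> \<epsilon> by (simp add: field_simps)
  moreover have "ln H / \<eta> \<le> 2 * (\<Lambda> / \<epsilon>)" using \<Lambda> \<epsilon> by (simp add: \<eta>_def divide_right_mono)
  ultimately have J: "real (Suc n) \<le> 4 * (\<Lambda> / \<epsilon>)" using n(2) by simp
  then have l: "ln (2 * real (Suc n) / \<delta>) \<le> 9 * \<Lambda>"
    using log_count_le[of "real (Suc n)" 4 \<Lambda> \<epsilon> \<delta>] \<Lambda> \<epsilon> \<delta> logs unfolding \<Lambda>_def by simp
  have l0: "0 \<le> ln (2 * real (Suc n) / \<delta>)"
    using ln_two_div_gt_half[of "real (Suc n)" \<delta>] \<delta> by simp
  have Class: "value_dist D" "{x. mult_goal \<epsilon> D x} \<in> sets borel" if "bounded_dist 1 H D" for D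
    using that by (auto simp: bounded_dist_def intro: mult_goal_borel)
  have Goal: "mult_goal \<epsilon> D x" if "bounded_dist 1 H D"
    "\<And>p. 0 \<le> p \<Longrightarrow> 1 / H \<le> quant D p \<Longrightarrow> (1 - \<eta>)\<^sup>2 * rev D p \<le> rev D x" for D x
    by (rule multiplicative_bounded_goal[OF that(1) H \<epsilon> that(2)[unfolded \<eta>_def]])
  have "\<exists>N Q P. real N \<le> 10 ^ 10 * \<Lambda> ^ 2 * M \<and> learns \<Delta> N Q P (bounded_dist 1 H) (mult_goal \<epsilon>) \<delta>"
  proof (cases "\<Delta> \<le> 1 / 2")
    case True
    have "\<exists>N Q P. real N \<le> 3 * real (Suc n) * ln (2 * real (Suc n) / \<delta>) * (1 + \<Delta> / (\<eta> * (1 / H)))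
        \<and> learns \<Delta> N Q P (bounded_dist 1 H) (mult_goal \<epsilon>) \<delta>"
      by (rule geo_learner_blocks[OF \<Delta>(1) True \<delta> q0 \<eta> n(1) Class Goal])
    then obtain N Q P where N: "real N \<le> 3 * real (Suc n) * ln (2 * real (Suc n) / \<delta>) * (1 + \<Delta> / (\<eta> * (1 / H)))"
      and L: "learns \<Delta> N Q P (bounded_dist 1 H) (mult_goal \<epsilon>) \<delta>" by blast
    have "3 * real (Suc n) * ln (2 * real (Suc n) / \<delta>) * (1 + \<Delta> / (\<eta> * (1 / H)))
        \<le> 3 * (4 * (\<Lambda> / \<epsilon>)) * (9 * \<Lambda>) * (1 + \<Delta> / (\<eta> * (1 / H)))"
      using J l l0 \<Lambda> \<epsilon> \<Delta> \<eta> H by (intro mult_mono mult_right_mono) auto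
    also have "\<dots> = 108 * \<Lambda>\<^sup>2 * (1 / \<epsilon> + 2 * (\<Delta> * H / \<epsilon>\<^sup>2))"
      using \<epsilon> by (simp add: \<eta>_def field_simps power2_eq_square)
    also have "\<dots> \<le> 108 * \<Lambda>\<^sup>2 * (3 * M)" using M by (intro mult_left_mono) auto
    also have "\<dots> = 324 * (\<Lambda>\<^sup>2 * M)" by simp
    also have "\<dots> \<le> 10 ^ 10 * (\<Lambda>\<^sup>2 * M)" using M by (intro mult_right_mono) auto
    finally have "real N \<le> 10 ^ 10 * (\<Lambda>\<^sup>2 * M)" using N by (rule order_trans[rotated])
    then have "real N \<le> 10 ^ 10 * \<Lambda> ^ 2 * M" by (simp only: mult.assoc)
    then show ?thesis using L by blast
  next
    case False
    have "\<exists>N Q P. real N \<le> 18 * (1 / (\<eta>\<^sup>2 * (1 / H))) * ln (2 * real (Suc n) / \<delta>)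
        \<and> learns \<Delta> N Q P (bounded_dist 1 H) (mult_goal \<epsilon>) \<delta>"
      by (rule geo_learner_one_block[OF less_imp_le[OF \<Delta>(2)] \<delta> q0 \<eta> n(1) Class Goal])
    then obtain N Q P where N: "real N \<le> 18 * (1 / (\<eta>\<^sup>2 * (1 / H))) * ln (2 * real (Suc n) / \<delta>)"
      and L: "learns \<Delta> N Q P (bounded_dist 1 H) (mult_goal \<epsilon>) \<delta>" by blast
    have "1 / (\<eta>\<^sup>2 * (1 / H)) = 4 * (1 * H / \<epsilon>\<^sup>2)" by (simp add: \<eta>_def power2_eq_square)
    also have "\<dots> \<le> 4 * ((2 * \<Delta>) * H / \<epsilon>\<^sup>2)"
      using False H by (intro mult_left_mono divide_right_mono mult_right_mono) auto
    also have "\<dots> \<le> 8 * M" using M by simp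
    finally have "18 * (1 / (\<eta>\<^sup>2 * (1 / H))) * ln (2 * real (Suc n) / \<delta>) \<le> 18 * (8 * M) * (9 * \<Lambda>)"
      using l l0 M H by (intro mult_mono) auto
    also have "\<dots> = 1296 * M * \<Lambda>" by simp
    also have "\<dots> \<le> 1296 * M * \<Lambda>\<^sup>2"
      using M \<Lambda> self_le_power[of \<Lambda> 2] by (intro mult_left_mono) auto
    also have "\<dots> = 1296 * (\<Lambda>\<^sup>2 * M)" by simp
    also have "\<dots> \<le> 10 ^ 10 * (\<Lambda>\<^sup>2 * M)" using M by (intro mult_right_mono) auto
    finally have "real N \<le> 10 ^ 10 * (\<Lambda>\<^sup>2 * M)" using N by (rule order_trans[rotated])
    then have "real N \<le> 10 ^ 10 * \<Lambda> ^ 2 * M" by (simp only: mult.assoc)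
    then show ?thesis using L by blast
  qed
  then show ?thesis unfolding \<Lambda>_def M_def .
qed

text \<open>Prices that sell are at most 1, so an absolute grid of step \<open>1 / K\<close> serves.
  Two steps are lost, one to rounding the quantile down and one to the bracket below the grid point,
  hence \<open>2 / K \<le> \<epsilon>\<close>.\<close>

lemma additive_bounded_goal:
  assumes D: "bounded_dist 0 1 D" and K: "3 \<le> K" "2 / real K \<le> \<epsilon>"
    and V: "\<And>j. j < K - 1 \<Longrightarrow> (real (j + 1) / real K) * val_at D (real (j + 2) / real K) \<le> rev D x"
  shows "add_goal \<epsilon> D x"
proof (rule add_goalI)
  fix p :: real assume p: "0 \<le> p"
  have vd: "value_dist D" using D by (simp add: bounded_dist_def)
  define i where "i = nat \<lfloor>quant D p * real K\<rfloor>"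
  have i: "real i \<le> quant D p * real K" "quant D p * real K < real i + 1"
    using quant_nonneg[of D p] unfolding i_def by (auto simp: of_nat_nat)
  have K0: "0 < real K" using K by simp
  have x0: "0 \<le> rev D x"
  proof -
    have "0 \<le> (real (0 + 1) / real K) * val_at D (real (0 + 2) / real K)"
      using K by (intro mult_nonneg_nonneg val_at_nonneg[OF vd]) auto
    then show ?thesis using V[of 0] K by linarith
  qed
  show "rev D p \<le> rev D x + \<epsilon>"
  proof (cases "1 < p")
    case True
    then have "rev D p = 0" using quant_above_bound[OF D, of p] by (simp add: rev_def)
    then show ?thesis using x0 K(2) K0 by (smt (verit) divide_pos_pos)
  next
    case p1: False
    show ?thesis
    proof (cases "i < 2")
      case True
      have "quant D p \<le> 2 / real K" using i(2) True K0 by (simp add: field_simps)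
      moreover have "rev D p \<le> 1 * quant D p" unfolding rev_def using p1 by (intro mult_right_mono) auto
      ultimately show ?thesis using x0 K(2) by linarith
    next
      case False
      \<comment> \<open>The bracket with upper end \<open>i / K\<close>. The lowest bracket starts
        at \<open>1 / K\<close>, since a guarantee from \<open>lo = 0\<close> would be void; this is
        why \<open>i < 2\<close> was treated apart.\<close>
      define j where "j = i - 2"
      have ij: "i = j + 2" using False by (simp add: j_def)
      have "quant D p * real K \<le> 1 * real K" using quant_le_1[OF vd] by (intro mult_right_mono) auto
      then have "real i \<le> real K" using i(1) by linarith
      then have jK: "j < K - 1" using ij by simp
      have "real (j + 2) / real K \<le> quant D p" using i(1) ij K0 by (simp add: field_simps)
      then have "p \<le> val_at D (real (j + 2) / real K)" using p K0 by (intro le_val_at[OF vd]) auto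
      then have "(real (j + 1) / real K) * p \<le> (real (j + 1) / real K) * val_at D (real (j + 2) / real K)"
        by (intro mult_left_mono) auto
      also have "\<dots> \<le> rev D x" by (rule V[OF jK])
      finally have a: "(real (j + 1) / real K) * p \<le> rev D x" .
      have "quant D p \<le> real (j + 1) / real K + 2 / real K"
        using i(2) ij K0 by (simp add: field_simps)
      then have "rev D p \<le> p * (real (j + 1) / real K + 2 / real K)"
        unfolding rev_def using p by (intro mult_left_mono) auto
      also have "\<dots> = (real (j + 1) / real K) * p + p * (2 / real K)" by (simp add: algebra_simps)
      also have "p * (2 / real K) \<le> 1 * (2 / real K)" using p1 K0 by (intro mult_right_mono) auto
      finally show ?thesis using a K(2) by linarith
    qed
  qed
qed

lemma additive_bounded_learner:
  assumes \<epsilon>: "0 < \<epsilon>" "\<epsilon> < 1" and \<Delta>: "0 < \<Delta>" "\<Delta> < 1" and \<delta>: "0 < \<delta>" "\<delta> < 1"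
  shows "\<exists>N Q P. real N \<le> 10 ^ 10 * (1 + ln (1 / \<epsilon>) + ln (1 / \<delta>)) ^ 2 * max (1 / \<epsilon>) (\<Delta> / \<epsilon>^2)
    \<and> learns \<Delta> N Q P (bounded_dist 0 1) (add_goal \<epsilon>) \<delta>"
proof -
  define \<Lambda> where "\<Lambda> = 1 + ln (1 / \<epsilon>) + ln (1 / \<delta>)"
  define M where "M = max (1 / \<epsilon>) (\<Delta> / \<epsilon>^2)"
  define K where "K = nat \<lceil>2 / \<epsilon>\<rceil>"
  define lo where "lo j = real (j + 1) / real K" for j
  define hi where "hi j = real (j + 2) / real K" for j
  have logs: "0 \<le> ln (1 / \<epsilon>)" "0 \<le> ln (1 / \<delta>)" using logs_nonneg[OF \<epsilon> \<delta>] .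
  have \<Lambda>: "1 \<le> \<Lambda>" using logs by (auto simp: \<Lambda>_def)
  have M: "1 / \<epsilon> \<le> M" "\<Delta> / \<epsilon>\<^sup>2 \<le> M" "0 \<le> M" using \<epsilon> by (auto simp: M_def le_max_iff_disj)
  have e: "1 < 1 / \<epsilon>" using \<epsilon> by simp
  then have K: "2 / \<epsilon> \<le> real K" "real K \<le> 2 / \<epsilon> + 1" "3 \<le> K" unfolding K_def by linarith+
  have K3: "real K \<le> 3 * (1 / \<epsilon>)" using K(2) e by simp
  have K0: "0 < real K" using K by simp
  have K2: "2 / real K \<le> \<epsilon>" using K(1) K0 \<epsilon> by (simp add: field_simps)
  have J: "1 \<le> K - 1" "real (K - 1) \<le> 3 * (1 / \<epsilon>)" using K K3 by auto
  have "3 * (1 / \<epsilon>) \<le> 3 * (\<Lambda> / \<epsilon>)" using \<Lambda> \<epsilon> by (simp add: divide_right_mono)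
  then have l: "ln (2 * real (K - 1) / \<delta>) \<le> 7 * \<Lambda>"
    using log_count_le[of "real (K - 1)" 3 \<Lambda> \<epsilon> \<delta>] J \<Lambda> \<epsilon> \<delta> unfolding \<Lambda>_def by simp
  have l0: "0 \<le> ln (2 * real (K - 1) / \<delta>)"
    using ln_two_div_gt_half[of "real (K - 1)" \<delta>] \<delta> J(1) by simp
  have Class: "value_dist D" "{x. add_goal \<epsilon> D x} \<in> sets borel" if "bounded_dist 0 1 D" for D
    using that by (auto simp: bounded_dist_def intro: add_goal_borel)
  have Goal: "add_goal \<epsilon> D x" if "bounded_dist 0 1 D"
    "\<And>j. j < K - 1 \<Longrightarrow> lo j * val_at D (hi j) \<le> rev D x" for D x
    by (rule additive_bounded_goal[OF that(1) K(3) K2 that(2)[unfolded lo_def hi_def]])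
  have diff: "hi j - lo j = 1 / real K" for j by (simp add: lo_def hi_def diff_divide_distrib[symmetric])
  have grid: "0 < lo j" "hi j \<le> 1" if "j < K - 1" for j using that K0 by (auto simp: lo_def hi_def)
  have "\<exists>N Q P. real N \<le> 10 ^ 10 * \<Lambda> ^ 2 * M \<and> learns \<Delta> N Q P (bounded_dist 0 1) (add_goal \<epsilon>) \<delta>"
  proof (cases "\<Delta> \<le> 1 / 2")
    case True
    have "\<exists>N Q P. real N \<le> 3 * real (K - 1) * ln (2 * real (K - 1) / \<delta>) * (1 + \<Delta> / (1 / real K))
        \<and> learns \<Delta> N Q P (bounded_dist 0 1) (add_goal \<epsilon>) \<delta>"
      by (rule grid_learner_blocks[where lo = lo and hi = hi, OF \<Delta>(1) True \<delta> J(1) _ _ Class Goal]) (use K0 diff grid in auto)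
    then obtain N Q P where N: "real N \<le> 3 * real (K - 1) * ln (2 * real (K - 1) / \<delta>) * (1 + \<Delta> / (1 / real K))"
      and L: "learns \<Delta> N Q P (bounded_dist 0 1) (add_goal \<epsilon>) \<delta>" by blast
    have "\<Delta> * real K \<le> \<Delta> * (3 * (1 / \<epsilon>))" using K3 \<Delta> by (intro mult_left_mono) auto
    then have "\<Delta> / (1 / real K) \<le> 3 * (\<Delta> / \<epsilon>)" by (simp add: mult.commute)
    then have "3 * real (K - 1) * ln (2 * real (K - 1) / \<delta>) * (1 + \<Delta> / (1 / real K))
        \<le> 3 * (3 * (1 / \<epsilon>)) * (7 * \<Lambda>) * (1 + 3 * (\<Delta> / \<epsilon>))"
      using J l l0 \<Lambda> \<epsilon> \<Delta> K0 by (intro mult_mono) auto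
    also have "\<dots> = 63 * \<Lambda> * (1 / \<epsilon> + 3 * (\<Delta> / \<epsilon>\<^sup>2))"
      using \<epsilon> by (simp add: field_simps power2_eq_square)
    also have "\<dots> \<le> 63 * \<Lambda> * (4 * M)" using M \<Lambda> by (intro mult_left_mono) auto
    also have "\<dots> = 252 * M * \<Lambda>" by simp
    also have "\<dots> \<le> 252 * M * \<Lambda>\<^sup>2" using M \<Lambda> self_le_power[of \<Lambda> 2] by (intro mult_left_mono) auto
    also have "\<dots> = 252 * (\<Lambda>\<^sup>2 * M)" by simp
    also have "\<dots> \<le> 10 ^ 10 * (\<Lambda>\<^sup>2 * M)" using M by (intro mult_right_mono) auto
    finally have "real N \<le> 10 ^ 10 * (\<Lambda>\<^sup>2 * M)" using N by (rule order_trans[rotated])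
    then have "real N \<le> 10 ^ 10 * \<Lambda> ^ 2 * M" by (simp only: mult.assoc)
    then show ?thesis using L by blast
  next
    case False
    have "\<exists>N Q P. real N \<le> 18 * (real K)\<^sup>2 * ln (2 * real (K - 1) / \<delta>)
        \<and> learns \<Delta> N Q P (bounded_dist 0 1) (add_goal \<epsilon>) \<delta>"
    proof (rule grid_learner_one_block[where lo = lo and hi = hi, OF less_imp_le[OF \<Delta>(2)] \<delta> J(1) _ _ Class Goal])
      show "1 \<le> (real K)\<^sup>2" using K(3) by (intro one_le_power) simp
      fix j assume j: "j < K - 1"
      have "0 < hi j - lo j" "(real K)\<^sup>2 * (hi j - lo j)\<^sup>2 = 1"
        unfolding diff using K0 by (auto simp: power_divide)
      then show "0 < lo j \<and> lo j < hi j \<and> hi j \<le> 1 \<and> hi j \<le> (real K)\<^sup>2 * (hi j - lo j)\<^sup>2"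
        using grid[OF j] by simp
    qed
    then obtain N Q P where N: "real N \<le> 18 * (real K)\<^sup>2 * ln (2 * real (K - 1) / \<delta>)"
      and L: "learns \<Delta> N Q P (bounded_dist 0 1) (add_goal \<epsilon>) \<delta>" by blast
    have "(real K)\<^sup>2 \<le> (3 * (1 / \<epsilon>))\<^sup>2" using K3 by (intro power_mono) auto
    also have "\<dots> = 9 * (1 / \<epsilon>\<^sup>2)" by (simp add: power2_eq_square)
    also have "\<dots> \<le> 9 * (2 * \<Delta> / \<epsilon>\<^sup>2)" using False by (intro mult_left_mono divide_right_mono) auto
    also have "\<dots> \<le> 18 * M" using M by simp
    finally have "18 * (real K)\<^sup>2 * ln (2 * real (K - 1) / \<delta>) \<le> 18 * (18 * M) * (7 * \<Lambda>)"
      using l l0 M by (intro mult_mono) auto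
    also have "\<dots> = 2268 * M * \<Lambda>" by simp
    also have "\<dots> \<le> 2268 * M * \<Lambda>\<^sup>2" using M \<Lambda> self_le_power[of \<Lambda> 2] by (intro mult_left_mono) auto
    also have "\<dots> = 2268 * (\<Lambda>\<^sup>2 * M)" by simp
    also have "\<dots> \<le> 10 ^ 10 * (\<Lambda>\<^sup>2 * M)" using M by (intro mult_right_mono) auto
    finally have "real N \<le> 10 ^ 10 * (\<Lambda>\<^sup>2 * M)" using N by (rule order_trans[rotated])
    then have "real N \<le> 10 ^ 10 * \<Lambda> ^ 2 * M" by (simp only: mult.assoc)
    then show ?thesis using L by blast
  qed
  then show ?thesis unfolding \<Lambda>_def M_def .
qed

text \<open>The exponent 2 allows one logarithm for the number of rounds or grid points and one for
  the union bound over them; \<open>10 ^ 10\<close> is a generous constant common to the four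
  families.\<close>

theorem mainTheorem10:
  "\<exists>C k. C > 0 \<and>
    (\<forall>\<epsilon> \<Delta> \<delta>. 0 < \<epsilon> \<and> \<epsilon> < 1 \<and> 0 < \<Delta> \<and> \<Delta> < 1 \<and> 0 < \<delta> \<and> \<delta> < 1 \<longrightarrow>
      (\<exists>N Q P. real N \<le> C * (1 + ln (1/\<epsilon>) + ln (1/\<delta>)) ^ k
                  * max 1 (min (\<Delta>^2 / \<epsilon>^4) (\<Delta> / \<epsilon>^3))
              \<and> learns \<Delta> N Q P regular_dist (mult_goal \<epsilon>) \<delta>)
    \<and> (\<exists>N Q P. real N \<le> C * (1 + ln (1/\<epsilon>) + ln (1/\<delta>)) ^ k * max 1 (\<Delta>^2 / \<epsilon>^2)
              \<and> learns \<Delta> N Q P mhr_dist (mult_goal \<epsilon>) \<delta>)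
    \<and> (\<forall>H::real. 1 \<le> H \<longrightarrow>
         (\<exists>N Q P. real N \<le> C * (1 + ln (1/\<epsilon>) + ln (1/\<delta>) + ln H) ^ k
                       * max (sqrt H / \<epsilon>) (\<Delta> * H / \<epsilon>^2)
                   \<and> learns \<Delta> N Q P (bounded_dist 1 H) (mult_goal \<epsilon>) \<delta>))
    \<and> (\<exists>N Q P. real N \<le> C * (1 + ln (1/\<epsilon>) + ln (1/\<delta>)) ^ k * max (1/\<epsilon>) (\<Delta> / \<epsilon>^2)
              \<and> learns \<Delta> N Q P (bounded_dist 0 1) (add_goal \<epsilon>) \<delta>))"
  by (intro exI[of _ "10 ^ 10"] exI[of _ 2] conjI allI impI regular_learner mhr_learner
      multiplicative_bounded_learner additive_bounded_learner; (elim conjE)?; simp?)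

end
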